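(* Let $u$ be an infinite Blaschke product. A sequence $\mathbf A=(A_n)\in\mathcal S(\mathcal T_u(C))$ is stable if and only if the operator $W(\mathbf A)=\operatorname{s-lim}_{n\to\infty}A_nP_{u_n}$ is invertible on $K^2_u$.
   Context: $\mathbb T$ is the unit circle, $H^2\subset L^2(\mathbb T)$ the Hardy space, $P$ the orthogonal projection onto $H^2$, $M_a$ multiplication by $a$. For an inner function $v$, $K^2_v:=H^2\ominus vH^2$ and $P_v=P-M_vPM_{\bar v}$ is the orthogonal projection onto $K^2_v$. For $a\in L^\infty(\mathbb T)$ the truncated Toeplitz operator is $T_u(a):=P_uM_a|_{K^2_u}$. Blaschke factors: $b_0(z)=z$, $b_\lambda(z)=\frac{\lambda-z}{1-\bar\lambda z}\frac{|\lambda|}{\lambda}$ for $\lambda\ne0$. An infinite Blaschke product is $u=\prod_{k\ge1}b_{\lambda_k}$ with $|\lambda_k|\le|\lambda_{k+1}|$ and $\sum_k(1-|\lambda_k|)<\infty$; $u_n:=\prod_{k=1}^nb_{\lambda_k}$, and $P_{u_n}$ (restricted to $K^2_u$) is the orthogonal projection onto $K^2_{u_n}\subseteq K^2_u$; $\mathcal P_u=(P_{u_n})$ is a filtration on $K^2_u$. $\mathcal F^{\mathcal P_u}$ is the $C^*$-algebra (entrywise operations, supremum norm) of all sequences $(A_n)$ with $A_n:\operatorname{im}P_{u_n}\to\operatorname{im}P_{u_n}$ such that $A_nP_{u_n}$ converges $^*$-strongly; $W(\mathbf A)$ denotes the strong limit of $A_nP_{u_n}$. $\mathcal S(\mathcal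 T_u(C))$ is the smallest closed subalgebra of $\mathcal F^{\mathcal P_u}$ containing all sequences $(P_{u_n}(T_u(a)+K)P_{u_n})_{n\ge1}$ with $a\in C(\mathbb T)$ and $K$ compact on $K^2_u$. A sequence $(A_n)$ is stable if there is $n_0$ such that $A_n$ is invertible for all $n\ge n_0$ and $\sup_{n\ge n_0}\|A_n^{-1}\|<\infty$. *)

theory Defs
  imports "HOL-Analysis.Analysis"
begin

text \<open>Model: the Hardy space H^2 is identified (isometrically, via Fourier/Taylor
coefficients) with l^2(N) of complex sequences. Operators are functions
on sequences; only their behaviour on the relevant subspace matters.\<close>

type_synonym sq = "nat \<Rightarrow> complex"

definition l2 :: "sq set" where
  "l2 = {x. summable (\<lambda>n. (cmod (x n))\<^sup>2)}"

definition l2norm :: "sq \<Rightarrow> real" where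
  "l2norm x = sqrt (\<Sum>n. (cmod (x n))\<^sup>2)"

definition l2inner :: "sq \<Rightarrow> sq \<Rightarrow> complex" where
  "l2inner x y = (\<Sum>n. x n * cnj (y n))"

definition l2dist :: "sq \<Rightarrow> sq \<Rightarrow> real" where
  "l2dist x y = l2norm (\<lambda>i. x i - y i)"

definition fourier :: "(complex \<Rightarrow> complex) \<Rightarrow> int \<Rightarrow> complex" where
  "fourier a k = integral {0..2*pi} (\<lambda>t. a (cis t) * cis (- (of_int k * t))) / (2 * pi)"

text \<open>Toeplitz operator T(a) = P M_a on H^2, in the coefficient model.\<close>
definition toep :: "(complex \<Rightarrow> complex) \<Rightarrow> sq \<Rightarrow> sq" where
  "toep a x = (\<lambda>i. \<Sum>j. fourier a (int i - int j) * x j)"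

definition tcoef :: "(complex \<Rightarrow> complex) \<Rightarrow> nat \<Rightarrow> complex" where
  "tcoef f k = (deriv ^^ k) f 0 / fact k"

text \<open>Analytic Toeplitz operator T(v) = M_v on H^2 and its adjoint T(v)^* = P M_{conj v}.\<close>
definition atoep :: "(complex \<Rightarrow> complex) \<Rightarrow> sq \<Rightarrow> sq" where
  "atoep v x = (\<lambda>i. \<Sum>j\<le>i. tcoef v (i - j) * x j)"

definition atoep_adj :: "(complex \<Rightarrow> complex) \<Rightarrow> sq \<Rightarrow> sq" where
  "atoep_adj v x = (\<lambda>i. \<Sum>j. cnj (tcoef v j) * x (i + j))"

text \<open>P_v = P - M_v P M_{conj v}, restricted to H^2: I - T(v) T(v)^*.\<close>
definition Pin :: "(complex \<Rightarrow> complex) \<Rightarrow> sq \<Rightarrow> sq" where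
  "Pin v x = (\<lambda>i. x i - atoep v (atoep_adj v x) i)"

definition Kin :: "(complex \<Rightarrow> complex) \<Rightarrow> sq set" where
  "Kin v = {x \<in> l2. Pin v x = x}"

definition bfac :: "complex \<Rightarrow> complex \<Rightarrow> complex" where
  "bfac l z = (if l = 0 then z else (l - z) / (1 - cnj l * z) * (of_real (cmod l) / l))"

text \<open>lam k is the (k+1)-st zero; bpart lam n = u_n = product of the first n factors.\<close>
definition bpart :: "(nat \<Rightarrow> complex) \<Rightarrow> nat \<Rightarrow> complex \<Rightarrow> complex" where
  "bpart lam n z = (\<Prod>k<n. bfac (lam k) z)"

definition bprod :: "(nat \<Rightarrow> complex) \<Rightarrow> complex \<Rightarrow> complex" where
  "bprod lam z = lim (\<lambda>n. bpart lam n z)"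

definition infinite_blaschke :: "(nat \<Rightarrow> complex) \<Rightarrow> bool" where
  "infinite_blaschke lam \<longleftrightarrow> (\<forall>k. cmod (lam k) < 1) \<and> (\<forall>k. cmod (lam k) \<le> cmod (lam (Suc k)))
     \<and> summable (\<lambda>k. 1 - cmod (lam k))"

definition ttoep :: "(complex \<Rightarrow> complex) \<Rightarrow> (complex \<Rightarrow> complex) \<Rightarrow> sq \<Rightarrow> sq" where
  "ttoep u a x = Pin u (toep a x)"

definition bop :: "sq set \<Rightarrow> (sq \<Rightarrow> sq) \<Rightarrow> bool" where
  "bop V A \<longleftrightarrow> (\<forall>x\<in>V. A x \<in> V)
     \<and> (\<forall>x\<in>V. \<forall>y\<in>V. \<forall>c. A (\<lambda>i. c * x i + y i) = (\<lambda>i. c * A x i + A y i))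
     \<and> (\<exists>C. \<forall>x\<in>V. l2norm (A x) \<le> C * l2norm x)"

definition opnorm :: "sq set \<Rightarrow> (sq \<Rightarrow> sq) \<Rightarrow> real" where
  "opnorm V A = Sup {l2norm (A x) | x. x \<in> V \<and> l2norm x \<le> 1}"

definition invertible_on :: "sq set \<Rightarrow> (sq \<Rightarrow> sq) \<Rightarrow> bool" where
  "invertible_on V A \<longleftrightarrow> bop V A \<and> (\<exists>B. bop V B \<and> (\<forall>x\<in>V. B (A x) = x \<and> A (B x) = x))"

definition cpt_op :: "sq set \<Rightarrow> (sq \<Rightarrow> sq) \<Rightarrow> bool" where
  "cpt_op V K \<longleftrightarrow> bop V K \<and>
     (\<forall>xs. (\<forall>n. xs n \<in> V \<and> l2norm (xs n) \<le> 1) \<longrightarrow>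
        (\<exists>(r::nat\<Rightarrow>nat) y. strict_mono r \<and> y \<in> l2 \<and> (\<lambda>n. l2dist (K (xs (r n))) y) \<longlonglongrightarrow> 0))"

definition Ku :: "(nat \<Rightarrow> complex) \<Rightarrow> sq set" where
  "Ku lam = Kin (bprod lam)"

definition Kn :: "(nat \<Rightarrow> complex) \<Rightarrow> nat \<Rightarrow> sq set" where
  "Kn lam n = Kin (bpart lam n)"

definition Pn :: "(nat \<Rightarrow> complex) \<Rightarrow> nat \<Rightarrow> sq \<Rightarrow> sq" where
  "Pn lam n = Pin (bpart lam n)"

definition strong_conv :: "(nat \<Rightarrow> complex) \<Rightarrow> (nat \<Rightarrow> sq \<Rightarrow> sq) \<Rightarrow> bool" where
  "strong_conv lam A \<longleftrightarrow> (\<forall>x\<in>Ku lam. \<exists>y\<in>l2. (\<lambda>n. l2dist (A n (Pn lam n x)) y) \<longlonglongrightarrow> 0)"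

definition Falg :: "(nat \<Rightarrow> complex) \<Rightarrow> (nat \<Rightarrow> sq \<Rightarrow> sq) set" where
  "Falg lam = {A. (\<forall>n. bop (Kn lam n) (A n)) \<and> (\<exists>C. \<forall>n. opnorm (Kn lam n) (A n) \<le> C)
      \<and> strong_conv lam A
      \<and> (\<exists>B. (\<forall>n. bop (Kn lam n) (B n) \<and>
               (\<forall>x\<in>Kn lam n. \<forall>y\<in>Kn lam n. l2inner (A n x) y = l2inner x (B n y)))
             \<and> strong_conv lam B)}"

definition supdist :: "(nat \<Rightarrow> complex) \<Rightarrow> (nat \<Rightarrow> sq \<Rightarrow> sq) \<Rightarrow> (nat \<Rightarrow> sq \<Rightarrow> sq) \<Rightarrow> real" where
  "supdist lam A B = (SUP n. opnorm (Kn lam n) (\<lambda>x. A n x - B n x))"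

inductive_set Salg :: "(nat \<Rightarrow> complex) \<Rightarrow> (nat \<Rightarrow> sq \<Rightarrow> sq) set" for lam where
  gen: "continuous_on (sphere 0 1) a \<Longrightarrow> cpt_op (Ku lam) K \<Longrightarrow>
     (\<lambda>n x. Pn lam n (\<lambda>i. ttoep (bprod lam) a (Pn lam n x) i + K (Pn lam n x) i)) \<in> Salg lam"
| add: "A \<in> Salg lam \<Longrightarrow> B \<in> Salg lam \<Longrightarrow> (\<lambda>n x i. A n x i + B n x i) \<in> Salg lam"
| smult: "A \<in> Salg lam \<Longrightarrow> (\<lambda>n x i. c * A n x i) \<in> Salg lam"
| mult: "A \<in> Salg lam \<Longrightarrow> B \<in> Salg lam \<Longrightarrow> (\<lambda>n x. A n (B n x)) \<in> Salg lam"
| lim: "(\<And>k. B k \<in> Salg lam) \<Longrightarrow> A \<in> Falg lam \<Longrightarrow>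
     (\<lambda>k. supdist lam (B k) A) \<longlonglongrightarrow> 0 \<Longrightarrow> A \<in> Salg lam"

definition stable :: "(nat \<Rightarrow> complex) \<Rightarrow> (nat \<Rightarrow> sq \<Rightarrow> sq) \<Rightarrow> bool" where
  "stable lam A \<longleftrightarrow> (\<exists>n0 C. \<forall>n\<ge>n0. \<exists>B. bop (Kn lam n) B \<and>
       (\<forall>x\<in>Kn lam n. B (A n x) = x \<and> A n (B x) = x) \<and> opnorm (Kn lam n) B \<le> C)"

definition Wlim :: "(nat \<Rightarrow> complex) \<Rightarrow> (nat \<Rightarrow> sq \<Rightarrow> sq) \<Rightarrow> sq \<Rightarrow> sq" where
  "Wlim lam A x = (THE y. y \<in> l2 \<and> (\<lambda>n. l2dist (A n (Pn lam n x)) y) \<longlonglongrightarrow> 0)"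

end

theory Submission
  imports Defs "HOL-Complex_Analysis.Complex_Analysis" "HOL-Library.Function_Algebras"
begin

text \<open>
  The sequences in the algebra are asymptotically constant: for large \<open>m \<le> n\<close> the operators
  \<open>A n\<close> and \<open>A m\<close> almost agree in norm on the space \<open>Kn m\<close>. This property is inherited by
  sums, products and uniform limits, so it has to be checked for the generators only. Compact
  operators have it because \<open>Pn n\<close> tends to the identity strongly. For a continuous symbol it
  suffices to treat powers of \<open>z\<close>: negative ones leave every \<open>Kn m\<close> invariant, positive ones
  reduce to \<open>z\<close> itself, and multiplication by \<open>z\<close> leads out of \<open>Kn m\<close> only along the
  partial product \<open>u_m\<close>, whose projection to \<open>Kn n\<close> has squared norm
  \<open>1 - (\<Prod>m\<le>k<n. |lam k|)^2\<close>, which is small by the Blaschke condition. If \<open>A\<close> is asymptotically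
  constant with strong limit \<open>W\<close>, then \<open>W\<close> is norm-close to \<open>A n\<close> on \<open>Kn n\<close>, so lower bounds
  pass between \<open>W\<close> and \<open>A n\<close>; surjectivity of \<open>A n\<close> is then automatic as \<open>Kn n\<close> is finite
  dimensional, and surjectivity of \<open>W\<close> follows by solving \<open>A n x = Pn n y\<close>.
\<close>

section \<open>Square-summable sequences\<close>

text \<open>Finite sections often need a second limit operator that sees \<open>A n\<close> from the
  far end of the space. Here none appears: the comparison of \<open>A n\<close> with
  \<open>A m\<close> is in norm on all of \<open>Kn lam m\<close> and says nothing about the other
  directions of \<open>Kn lam n\<close>. This one-sided condition survives products because
  \<open>B m\<close> maps \<open>Kn lam m\<close> into itself. It also allows z to stand for all
  positive powers: the complement u_n H^2 is shift invariant, so compression to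
  \<open>Kn lam n\<close> is multiplicative on powers of the shift. The infinite product enters
  through its Taylor coefficients. As a coefficientwise limit of inner symbols it acts
  contractively, and the Blaschke condition keeps it from vanishing. Together with the factorisation
  of u into u_n and a tail, this describes \<open>Ku lam\<close> as a kernel and gives the strong
  convergence of the projections. Symbols are therefore treated as coefficient sequences, with inner
  read as isometric. The recurring constant 2 comes from bounding \<open>Pn lam n\<close> by the
  triangle inequality.\<close>

lemma l2_bound:
  assumes "\<And>N. (\<Sum>n<N. (cmod (x n))\<^sup>2) \<le> B\<^sup>2" and "0 \<le> B"
  shows "x \<in> l2" and "l2norm x \<le> B"
proof -
  have s: "summable (\<lambda>n. (cmod (x n))\<^sup>2)"
    by (rule summableI_nonneg_bounded[of _ "B\<^sup>2"]) (use assms(1) in auto)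
  then show "x \<in> l2" by (simp add: l2_def)
  have "(\<Sum>n. (cmod (x n))\<^sup>2) \<le> B\<^sup>2" by (rule suminf_le_const[OF s assms(1)])
  then show "l2norm x \<le> B" unfolding l2norm_def using assms(2) by (simp add: real_le_lsqrt)
qed

lemma l2norm_nonneg: "x \<in> l2 \<Longrightarrow> 0 \<le> l2norm x"
  by (auto simp: l2norm_def l2_def intro: suminf_nonneg)

lemma l2norm_power2: "x \<in> l2 \<Longrightarrow> (l2norm x)\<^sup>2 = (\<Sum>n. (cmod (x n))\<^sup>2)"
  by (auto simp: l2norm_def l2_def intro: suminf_nonneg)

lemma sum_le_l2norm:
  assumes "x \<in> l2" "finite I"
  shows "(\<Sum>n\<in>I. (cmod (x n))\<^sup>2) \<le> (l2norm x)\<^sup>2"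
  unfolding l2norm_power2[OF assms(1)]
  by (rule sum_le_suminf) (use assms in \<open>auto simp: l2_def\<close>)

lemma L2_set_le_l2norm:
  assumes "x \<in> l2" "finite I"
  shows "L2_set (\<lambda>n. cmod (x n)) I \<le> l2norm x"
  unfolding L2_set_def
  using sum_le_l2norm[OF assms] l2norm_nonneg[OF assms(1)] by (simp add: real_le_lsqrt)

lemma L2_set_power2: "(L2_set f I)\<^sup>2 = (\<Sum>n\<in>I. (f n)\<^sup>2)"
  by (simp add: L2_set_def sum_nonneg)

lemma cmod_le_l2norm: "x \<in> l2 \<Longrightarrow> cmod (x i) \<le> l2norm x"
  using L2_set_le_l2norm[of x "{i}"] by simp

lemma l2_zero [simp]: "(\<lambda>i. 0) \<in> l2"
  by (simp add: l2_def)

lemma l2norm_zero [simp]: "l2norm (\<lambda>i. 0) = 0"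
  by (simp add: l2norm_def)

lemma l2norm_eq_0_iff:
  assumes "x \<in> l2"
  shows "l2norm x = 0 \<longleftrightarrow> x = (\<lambda>i. 0)"
proof
  assume "l2norm x = 0"
  then show "x = (\<lambda>i. 0)" using cmod_le_l2norm[OF assms] by auto
qed simp

lemma
  assumes "x \<in> l2" "y \<in> l2"
  shows l2_add [simp, intro]: "(\<lambda>i. x i + y i) \<in> l2"
    and l2norm_triangle: "l2norm (\<lambda>i. x i + y i) \<le> l2norm x + l2norm y"
proof -
  have "(\<Sum>n<N. (cmod (x n + y n))\<^sup>2) \<le> (l2norm x + l2norm y)\<^sup>2" for N
  proof -
    have "L2_set (\<lambda>n. cmod (x n + y n)) {..<N} \<le> L2_set (\<lambda>n. cmod (x n) + cmod (y n)) {..<N}"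
      by (rule L2_set_mono) (auto intro: norm_triangle_ineq)
    also have "\<dots> \<le> L2_set (\<lambda>n. cmod (x n)) {..<N} + L2_set (\<lambda>n. cmod (y n)) {..<N}"
      by (rule L2_set_triangle_ineq)
    also have "\<dots> \<le> l2norm x + l2norm y"
      by (intro add_mono L2_set_le_l2norm assms) auto
    finally have "(L2_set (\<lambda>n. cmod (x n + y n)) {..<N})\<^sup>2 \<le> (l2norm x + l2norm y)\<^sup>2"
      by (rule power_mono) (rule L2_set_nonneg)
    then show ?thesis by (simp add: L2_set_power2)
  qed
  from l2_bound[OF this] show "(\<lambda>i. x i + y i) \<in> l2" "l2norm (\<lambda>i. x i + y i) \<le> l2norm x + l2norm y"
    using l2norm_nonneg assms by (auto intro: add_nonneg_nonneg)
qed

lemma l2_scale [simp, intro]: "x \<in> l2 \<Longrightarrow> (\<lambda>i. c * x i) \<in> l2"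
  by (simp add: l2_def norm_mult power_mult_distrib)

lemma l2norm_scale: "x \<in> l2 \<Longrightarrow> l2norm (\<lambda>i. c * x i) = cmod c * l2norm x"
  by (simp add: l2_def l2norm_def norm_mult power_mult_distrib suminf_mult real_sqrt_mult)

lemma l2_diff [simp, intro]: "x \<in> l2 \<Longrightarrow> y \<in> l2 \<Longrightarrow> (\<lambda>i. x i - y i) \<in> l2"
  using l2_add[of x "\<lambda>i. (-1) * y i"] l2_scale[of y "-1"] by simp

lemma l2norm_triangle_diff:
  "x \<in> l2 \<Longrightarrow> y \<in> l2 \<Longrightarrow> l2norm (\<lambda>i. x i - y i) \<le> l2norm x + l2norm y"
  using l2norm_triangle[of x "\<lambda>i. (-1) * y i"] l2norm_scale[of y "-1"] l2_scale[of y "-1"] by simp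

lemma l2dist_commute: "l2dist x y = l2dist y x"
  by (simp add: l2dist_def l2norm_def norm_minus_commute)

lemma l2dist_triangle:
  assumes "x \<in> l2" "y \<in> l2" "z \<in> l2"
  shows "l2dist x z \<le> l2dist x y + l2dist y z"
  using l2norm_triangle[of "\<lambda>i. x i - y i" "\<lambda>i. y i - z i"] assms by (simp add: l2dist_def)

lemma l2dist_nonneg: "x \<in> l2 \<Longrightarrow> y \<in> l2 \<Longrightarrow> 0 \<le> l2dist x y"
  by (simp add: l2dist_def l2norm_nonneg)

lemma l2norm_le_l2dist:
  assumes "x \<in> l2" "y \<in> l2"
  shows "l2norm x \<le> l2norm y + l2dist x y"
  using l2norm_triangle[of y "\<lambda>i. x i - y i"] assms by (simp add: l2dist_def)

lemma tendsto_l2norm: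
  assumes "\<And>n. X n \<in> l2" "y \<in> l2" "(\<lambda>n. l2dist (X n) y) \<longlonglongrightarrow> 0"
  shows "(\<lambda>n. l2norm (X n)) \<longlonglongrightarrow> l2norm y"
proof (rule LIM_zero_cancel, rule Lim_null_comparison[OF _ assms(3)], rule always_eventually, rule allI)
  fix n show "norm (l2norm (X n) - l2norm y) \<le> l2dist (X n) y"
    using l2norm_le_l2dist[OF assms(1)[of n] assms(2)] l2norm_le_l2dist[OF assms(2) assms(1)[of n]]
    by (simp add: l2dist_commute abs_le_iff)
qed

lemma l2_limit_unique:
  assumes "\<And>n. X n \<in> l2" "y \<in> l2" "z \<in> l2"
    and "(\<lambda>n. l2dist (X n) y) \<longlonglongrightarrow> 0" "(\<lambda>n. l2dist (X n) z) \<longlonglongrightarrow> 0"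
  shows "y = z"
proof -
  have "l2dist y z \<le> 0"
  proof (rule LIMSEQ_le_const)
    show "(\<lambda>n. l2dist (X n) y + l2dist (X n) z) \<longlonglongrightarrow> 0"
      using tendsto_add[OF assms(4,5)] by simp
    show "\<exists>N. \<forall>n\<ge>N. l2dist y z \<le> l2dist (X n) y + l2dist (X n) z"
      using l2dist_triangle[OF assms(2) assms(1) assms(3)] by (auto simp: l2dist_commute[of _ y])
  qed
  then have "l2norm (\<lambda>i. y i - z i) = 0"
    using l2dist_nonneg[OF assms(2,3)] by (simp add: l2dist_def)
  then have "(\<lambda>i. y i - z i) = (\<lambda>i. 0)" using l2norm_eq_0_iff[of "\<lambda>i. y i - z i"] assms by auto
  then show ?thesis by (auto simp: fun_eq_iff)
qed

lemma l2_complete: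
  assumes X: "\<And>n. X n \<in> l2"
    and C: "\<And>e. 0 < e \<Longrightarrow> \<exists>N. \<forall>m\<ge>N. \<forall>n\<ge>m. l2dist (X n) (X m) \<le> e"
  obtains y where "y \<in> l2" "(\<lambda>n. l2dist (X n) y) \<longlonglongrightarrow> 0"
proof -
  have "Cauchy (\<lambda>n. X n i)" for i
  proof (rule CauchyI')
    fix e :: real assume "0 < e"
    then obtain N where N: "\<And>m n. m \<ge> N \<Longrightarrow> n \<ge> m \<Longrightarrow> l2dist (X n) (X m) \<le> e/2"
      using C[of "e/2"] by auto
    show "\<exists>M. \<forall>m\<ge>M. \<forall>n>m. dist (X m i) (X n i) < e"
    proof (intro exI[of _ N] allI impI)
      fix m n :: nat assume "N \<le> m" "m < n"
      then have "l2dist (X n) (X m) \<le> e/2" using N by auto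
      moreover have "norm (X n i - X m i) \<le> l2dist (X n) (X m)"
        using cmod_le_l2norm[of "\<lambda>i. X n i - X m i" i] X by (simp add: l2dist_def)
      ultimately show "dist (X m i) (X n i) < e"
        using \<open>0 < e\<close> by (simp add: dist_norm norm_minus_commute)
    qed
  qed
  then have "\<forall>i. \<exists>l. (\<lambda>n. X n i) \<longlonglongrightarrow> l" using Cauchy_convergent_iff convergent_def by blast
  then obtain y where y: "\<And>i. (\<lambda>n. X n i) \<longlonglongrightarrow> y i" by metis
  \<comment> \<open>Fatou on finitely many coordinates: with \<open>m\<close> and \<open>N\<close>
    fixed, the bound on the first \<open>N\<close> terms survives \<open>n\<close> tending to
    infinity. It gives the rate of convergence and, applied to one \<open>m\<close>, membership of
    \<open>y\<close> in \<open>l2\<close>.\<close>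
  have key: "(\<lambda>i. X m i - y i) \<in> l2 \<and> l2norm (\<lambda>i. X m i - y i) \<le> e"
    if "0 < e" and m: "\<And>n. n \<ge> m \<Longrightarrow> l2dist (X n) (X m) \<le> e" for e m
  proof -
    have "(\<Sum>i<N. (cmod (X m i - y i))\<^sup>2) \<le> e\<^sup>2" for N
    proof (rule LIMSEQ_le_const2)
      show "(\<lambda>n. \<Sum>i<N. (cmod (X m i - X n i))\<^sup>2) \<longlonglongrightarrow> (\<Sum>i<N. (cmod (X m i - y i))\<^sup>2)"
        by (intro tendsto_intros y)
      show "\<exists>K. \<forall>n\<ge>K. (\<Sum>i<N. (cmod (X m i - X n i))\<^sup>2) \<le> e\<^sup>2"
      proof (intro exI[of _ m] allI impI)
        fix n assume "m \<le> n"
        have "(\<Sum>i<N. (cmod (X n i - X m i))\<^sup>2) \<le> (l2dist (X n) (X m))\<^sup>2"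
          unfolding l2dist_def using X by (intro sum_le_l2norm) auto
        also have "\<dots> \<le> e\<^sup>2"
          using m[OF \<open>m \<le> n\<close>] l2dist_nonneg[OF X X, of n m] by (intro power_mono) auto
        finally show "(\<Sum>i<N. (cmod (X m i - X n i))\<^sup>2) \<le> e\<^sup>2" by (simp add: norm_minus_commute)
      qed
    qed
    then show ?thesis using l2_bound[of "\<lambda>i. X m i - y i" e] \<open>0 < e\<close> by auto
  qed
  have yl2: "y \<in> l2"
  proof -
    obtain N where "\<And>n. n \<ge> N \<Longrightarrow> l2dist (X n) (X N) \<le> 1" using C[of 1] by auto
    then have "(\<lambda>i. X N i - y i) \<in> l2" using key[of 1 N] by auto
    then have "(\<lambda>i. X N i - (X N i - y i)) \<in> l2" using l2_diff[OF X[of N], of "\<lambda>i. X N i - y i"] by blast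
    then show ?thesis by simp
  qed
  moreover have "(\<lambda>n. l2dist (X n) y) \<longlonglongrightarrow> 0"
  proof (rule LIMSEQ_I)
    fix e :: real assume "0 < e"
    then obtain N where N: "\<And>m n. m \<ge> N \<Longrightarrow> n \<ge> m \<Longrightarrow> l2dist (X n) (X m) \<le> e/2"
      using C[of "e/2"] by auto
    show "\<exists>N. \<forall>n\<ge>N. norm (l2dist (X n) y - 0) < e"
    proof (intro exI[of _ N] allI impI)
      fix n assume "N \<le> n"
      then have "l2dist (X n) y \<le> e/2" using key[of "e/2" n] N \<open>0 < e\<close> by (auto simp: l2dist_def)
      then show "norm (l2dist (X n) y - 0) < e"
        using l2dist_nonneg[OF X yl2, of n] \<open>0 < e\<close> by simp
    qed
  qed
  ultimately show ?thesis by (rule that)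
qed

section \<open>Inner product and Cauchy-Schwarz inequality\<close>

lemma summable_l2inner:
  assumes "x \<in> l2" "y \<in> l2"
  shows "summable (\<lambda>n. cmod (x n) * cmod (y n))"
proof (rule summable_comparison_test')
  show "summable (\<lambda>n. (cmod (x n))\<^sup>2 + (cmod (y n))\<^sup>2)"
    using assms by (auto simp: l2_def intro: summable_add)
  fix n
  have "2 * (cmod (x n) * cmod (y n)) \<le> (cmod (x n))\<^sup>2 + (cmod (y n))\<^sup>2"
    using sum_squares_bound[of "cmod (x n)" "cmod (y n)"] by (simp add: mult.assoc)
  then show "norm (cmod (x n) * cmod (y n)) \<le> (cmod (x n))\<^sup>2 + (cmod (y n))\<^sup>2"
    using mult_nonneg_nonneg[OF norm_ge_zero norm_ge_zero, of "x n" "y n"]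
    unfolding real_norm_def by linarith
qed

lemma summable_l2inner':
  assumes "x \<in> l2" "y \<in> l2"
  shows "summable (\<lambda>n. x n * cnj (y n))"
  by (rule summable_norm_cancel) (simp add: norm_mult summable_l2inner[OF assms])

lemma cmod_l2inner_le:
  assumes "x \<in> l2" "y \<in> l2"
  shows "cmod (l2inner x y) \<le> l2norm x * l2norm y"
proof -
  have "cmod (l2inner x y) \<le> (\<Sum>n. cmod (x n * cnj (y n)))"
    unfolding l2inner_def by (rule summable_norm) (use summable_l2inner[OF assms] in \<open>simp add: norm_mult\<close>)
  also have "\<dots> = (\<Sum>n. cmod (x n) * cmod (y n))" by (simp add: norm_mult)
  also have "\<dots> \<le> l2norm x * l2norm y"
  proof (rule suminf_le_const[OF summable_l2inner[OF assms]])
    fix N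
    have "(\<Sum>n<N. cmod (x n) * cmod (y n)) \<le> L2_set (\<lambda>n. cmod (x n)) {..<N} * L2_set (\<lambda>n. cmod (y n)) {..<N}"
      using L2_set_mult_ineq[of "\<lambda>n. cmod (x n)" "\<lambda>n. cmod (y n)" "{..<N}"] by simp
    also have "\<dots> \<le> l2norm x * l2norm y"
      by (intro mult_mono L2_set_le_l2norm assms l2norm_nonneg L2_set_nonneg) auto
    finally show "(\<Sum>n<N. cmod (x n) * cmod (y n)) \<le> l2norm x * l2norm y" .
  qed
  finally show ?thesis .
qed

lemma l2inner_lin_left:
  assumes "x \<in> l2" "y \<in> l2" "z \<in> l2"
  shows "l2inner (\<lambda>i. c * x i + y i) z = c * l2inner x z + l2inner y z"
proof -
  have "(\<Sum>n. c * (x n * cnj (z n)) + y n * cnj (z n)) = c * l2inner x z + l2inner y z"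
    unfolding l2inner_def
    using suminf_add[OF summable_mult[OF summable_l2inner'[OF assms(1,3)], of c] summable_l2inner'[OF assms(2,3)]]
      suminf_mult[OF summable_l2inner'[OF assms(1,3)], of c] by simp
  then show ?thesis by (simp add: l2inner_def algebra_simps)
qed

lemma l2inner_diff_left:
  assumes "x \<in> l2" "y \<in> l2" "z \<in> l2"
  shows "l2inner (\<lambda>i. x i - y i) z = l2inner x z - l2inner y z"
  using l2inner_lin_left[OF assms(2,1,3), of "-1"] by simp

lemma l2inner_cnj:
  assumes "x \<in> l2" "y \<in> l2"
  shows "l2inner y x = cnj (l2inner x y)"
proof -
  have "(\<lambda>n. cnj (x n * cnj (y n))) sums cnj (l2inner x y)"
    unfolding sums_cnj l2inner_def by (rule summable_sums[OF summable_l2inner'[OF assms]])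
  then have "(\<lambda>n. y n * cnj (x n)) sums cnj (l2inner x y)" by (simp add: mult.commute)
  then show ?thesis unfolding l2inner_def[of y x] by (simp add: sums_iff)
qed

lemma l2inner_self:
  assumes "x \<in> l2"
  shows "l2inner x x = of_real ((l2norm x)\<^sup>2)"
proof -
  have "(\<lambda>n. complex_of_real ((cmod (x n))\<^sup>2)) sums of_real ((l2norm x)\<^sup>2)"
    unfolding l2norm_power2[OF assms] using assms by (intro sums_of_real summable_sums) (simp add: l2_def)
  then have "(\<lambda>n. x n * cnj (x n)) sums of_real ((l2norm x)\<^sup>2)" unfolding complex_norm_square .
  then show ?thesis unfolding l2inner_def by (simp add: sums_iff)
qed

lemma l2norm_diff_power2:
  assumes "x \<in> l2" "y \<in> l2"
  shows "(l2norm (\<lambda>i. x i - y i))\<^sup>2 = (l2norm x)\<^sup>2 - 2 * Re (l2inner x y) + (l2norm y)\<^sup>2"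
proof -
  let ?d = "\<lambda>i. x i - y i"
  have "of_real ((l2norm ?d)\<^sup>2) = l2inner ?d ?d" using assms by (simp add: l2inner_self)
  also have "\<dots> = l2inner x ?d - l2inner y ?d" using assms by (intro l2inner_diff_left) auto
  also have "\<dots> = cnj (l2inner ?d x) - cnj (l2inner ?d y)"
    using assms l2inner_cnj[of ?d x] l2inner_cnj[of ?d y] by simp
  also have "\<dots> = cnj (l2inner x x - l2inner y x) - cnj (l2inner x y - l2inner y y)"
    using assms by (simp add: l2inner_diff_left)
  also have "\<dots> = of_real ((l2norm x)\<^sup>2 + (l2norm y)\<^sup>2) - (l2inner x y + cnj (l2inner x y))"
    using l2inner_cnj[OF assms] assms by (simp add: l2inner_self)
  also have "\<dots> = of_real ((l2norm x)\<^sup>2 - 2 * Re (l2inner x y) + (l2norm y)\<^sup>2)"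
    by (simp add: complex_add_cnj)
  finally show ?thesis using of_real_eq_iff by blast
qed

section \<open>Truncations and unit vectors\<close>

definition trunc :: "nat \<Rightarrow> sq \<Rightarrow> sq" where
  "trunc N x = (\<lambda>i. if i < N then x i else 0)"

lemma trunc_sum: "(\<Sum>n<M. (cmod (trunc N x n))\<^sup>2) \<le> (\<Sum>n<N. (cmod (x n))\<^sup>2)"
proof -
  have "(\<Sum>n<M. (cmod (trunc N x n))\<^sup>2) = (\<Sum>n\<in>{..<M} \<inter> {..<N}. (cmod (x n))\<^sup>2)"
    unfolding sum.inter_restrict[OF finite_lessThan] by (rule sum.cong) (auto simp: trunc_def)
  also have "\<dots> \<le> (\<Sum>n<N. (cmod (x n))\<^sup>2)" by (rule sum_mono2) auto
  finally show ?thesis .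
qed

lemma trunc_l2 [simp]: "trunc N x \<in> l2"
  using l2_bound(1)[of "trunc N x" "sqrt (\<Sum>n<N. (cmod (x n))\<^sup>2)"] trunc_sum[of N x]
  by (simp add: sum_nonneg)

lemma l2norm_trunc: "(l2norm (trunc N x))\<^sup>2 = (\<Sum>n<N. (cmod (x n))\<^sup>2)"
  unfolding l2norm_power2[OF trunc_l2]
  by (subst suminf_finite[of "{..<N}"]) (auto simp: trunc_def)

text \<open>Pythagoras: truncation is an orthogonal projection, so the squared distance is the tail
  of a convergent series.\<close>

lemma l2dist_trunc_tendsto:
  assumes "x \<in> l2"
  shows "(\<lambda>N. l2dist (trunc N x) x) \<longlonglongrightarrow> 0"
proof -
  have eq: "l2dist (trunc N x) x = sqrt ((l2norm x)\<^sup>2 - (\<Sum>n<N. (cmod (x n))\<^sup>2))" for N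
  proof -
    have "l2inner (trunc N x) x = l2inner (trunc N x) (trunc N x)"
      unfolding l2inner_def by (rule suminf_cong) (auto simp: trunc_def)
    then have "(l2dist (trunc N x) x)\<^sup>2 = (l2norm x)\<^sup>2 - (\<Sum>n<N. (cmod (x n))\<^sup>2)"
      unfolding l2dist_def using l2norm_diff_power2[OF trunc_l2 assms, of N x]
      by (simp add: l2inner_self l2norm_trunc)
    then show ?thesis using l2dist_nonneg[OF trunc_l2 assms, of N x] by (metis real_sqrt_unique)
  qed
  have "(\<lambda>N. \<Sum>n<N. (cmod (x n))\<^sup>2) \<longlonglongrightarrow> (l2norm x)\<^sup>2"
    unfolding l2norm_power2[OF assms] using assms by (intro summable_LIMSEQ) (simp add: l2_def)
  then have "(\<lambda>N. sqrt ((l2norm x)\<^sup>2 - (\<Sum>n<N. (cmod (x n))\<^sup>2))) \<longlonglongrightarrow> sqrt ((l2norm x)\<^sup>2 - (l2norm x)\<^sup>2)"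
    by (intro tendsto_intros)
  then show ?thesis by (simp add: eq)
qed

definition ebasis :: "nat \<Rightarrow> sq" where
  "ebasis k = (\<lambda>i. if i = k then 1 else 0)"

lemma ebasis_l2 [simp]: "ebasis k \<in> l2"
  unfolding ebasis_def l2_def mem_Collect_eq by (rule summable_finite[of "{k}"]) auto

lemma l2norm_ebasis [simp]: "l2norm (ebasis k) = 1"
  unfolding ebasis_def l2norm_def by (subst suminf_finite[of "{k}"]) auto

lemma l2inner_ebasis: "l2inner x (ebasis k) = x k"
  unfolding ebasis_def l2inner_def by (subst suminf_finite[of "{k}"]) auto

section \<open>Analytic Toeplitz operators on coefficient sequences\<close>

text \<open>An analytic Toeplitz operator depends on its symbol only through the Taylor
  coefficients, so from here on a symbol is a sequence; \<open>Pin_eq\<close> makes the link to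
  \<open>atoep\<close>.\<close>

definition conv :: "sq \<Rightarrow> sq \<Rightarrow> sq" where
  "conv c x = (\<lambda>i. \<Sum>j\<le>i. c (i - j) * x j)"

definition convadj :: "sq \<Rightarrow> sq \<Rightarrow> sq" where
  "convadj c x = (\<lambda>i. \<Sum>j. cnj (c j) * x (i + j))"

text \<open>\<open>contr c\<close> puts the function with coefficients \<open>c\<close> into the
  unit ball of H^infinity, and \<open>isom c\<close> makes it inner. Stating this through the
  multiplication operator avoids boundary values on the circle.\<close>

definition contr :: "sq \<Rightarrow> bool" where
  "contr c \<longleftrightarrow> (\<forall>x\<in>l2. conv c x \<in> l2 \<and> l2norm (conv c x) \<le> l2norm x)"

definition isom :: "sq \<Rightarrow> bool" where
  "isom c \<longleftrightarrow> (\<forall>x\<in>l2. conv c x \<in> l2 \<and> l2norm (conv c x) = l2norm x)"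

lemma contrD: "contr c \<Longrightarrow> x \<in> l2 \<Longrightarrow> conv c x \<in> l2" "contr c \<Longrightarrow> x \<in> l2 \<Longrightarrow> l2norm (conv c x) \<le> l2norm x"
  by (auto simp: contr_def)

lemma isom_contr: "isom c \<Longrightarrow> contr c"
  by (auto simp: contr_def isom_def)

lemma isomD: "isom c \<Longrightarrow> x \<in> l2 \<Longrightarrow> l2norm (conv c x) = l2norm x"
  by (auto simp: isom_def)

text \<open>Convolution is the product of formal power series, which hands over associativity,
  commutativity and the absence of zero divisors.\<close>

lemma conv_fps: "conv c x = fps_nth (Abs_fps c * Abs_fps x)"
proof
  fix i show "conv c x i = fps_nth (Abs_fps c * Abs_fps x) i"
    unfolding mult.commute[of "Abs_fps c"] fps_mult_nth
    by (simp add: conv_def atLeast0AtMost mult.commute)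
qed

lemma Abs_fps_conv: "Abs_fps (conv c x) = Abs_fps c * Abs_fps x"
  by (simp add: conv_fps fps_nth_inverse)

lemma Abs_fps_eq_iff: "Abs_fps c = Abs_fps d \<longleftrightarrow> c = d"
  by (auto simp: fps_eq_iff)

lemma conv_assoc: "conv (conv c d) x = conv c (conv d x)"
  by (simp add: Abs_fps_eq_iff[symmetric] Abs_fps_conv mult.assoc)

lemma conv_commute: "conv c d = conv d c"
  by (simp add: Abs_fps_eq_iff[symmetric] Abs_fps_conv mult.commute)

lemma Abs_fps_ebasis: "Abs_fps (ebasis 0) = 1" "Abs_fps (ebasis 1) = fps_X"
  by (auto simp: fps_eq_iff ebasis_def)

lemma conv_ebasis_0: "conv c (ebasis 0) = c"
  by (simp add: Abs_fps_eq_iff[symmetric] Abs_fps_conv Abs_fps_ebasis)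

lemma conv_eq_0_iff: "conv c x = (\<lambda>i. 0) \<longleftrightarrow> c = (\<lambda>i. 0) \<or> x = (\<lambda>i. 0)"
proof -
  have z: "Abs_fps (\<lambda>i. 0) = (0 :: complex fps)" by (simp add: fps_eq_iff)
  show ?thesis unfolding Abs_fps_eq_iff[symmetric] Abs_fps_conv z by simp
qed

lemma conv_lin: "conv c (\<lambda>i. a * x i + y i) = (\<lambda>i. a * conv c x i + conv c y i)"
  unfolding conv_def by (simp add: sum_distrib_left sum.distrib[symmetric] algebra_simps)

lemma conv_diff: "conv c (\<lambda>i. x i - y i) = (\<lambda>i. conv c x i - conv c y i)"
  using conv_lin[of c "-1" y x] by simp

lemma conv_zero [simp]: "conv c (\<lambda>i. 0) = (\<lambda>i. 0)"
  by (simp add: conv_def)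

lemma contr_l2: "contr c \<Longrightarrow> c \<in> l2"
  using contrD(1)[of c "ebasis 0"] by (simp add: conv_ebasis_0)

lemma isom_l2norm: "isom c \<Longrightarrow> l2norm c = 1"
  using isomD[of c "ebasis 0"] by (simp add: conv_ebasis_0)

lemma isom_nonzero: "isom c \<Longrightarrow> c \<noteq> (\<lambda>i. 0)"
  using isom_l2norm[of c] by auto

lemma contr_conv: "contr c \<Longrightarrow> contr d \<Longrightarrow> contr (conv c d)"
  unfolding contr_def conv_assoc by (metis order_trans)

lemma isom_conv: "isom c \<Longrightarrow> isom d \<Longrightarrow> isom (conv c d)"
  unfolding isom_def conv_assoc by metis

section \<open>Adjoints of convolution operators\<close>

lemma l2_shift: "x \<in> l2 \<Longrightarrow> (\<lambda>j. x (i + j)) \<in> l2"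
  unfolding l2_def mem_Collect_eq add.commute[of i]
  using summable_iff_shift[of "\<lambda>n. (cmod (x n))\<^sup>2" i] by simp

lemma convadj_summable:
  assumes "c \<in> l2" "x \<in> l2"
  shows "summable (\<lambda>j. cnj (c j) * x (i + j))"
  using summable_l2inner'[OF l2_shift[OF assms(2)] assms(1), of i] by (simp add: mult.commute)

lemma convadj_lin:
  assumes "c \<in> l2" "x \<in> l2" "y \<in> l2"
  shows "convadj c (\<lambda>i. a * x i + y i) = (\<lambda>i. a * convadj c x i + convadj c y i)"
proof
  fix i
  have "convadj c z i = l2inner (\<lambda>j. z (i + j)) c" for z
    by (simp add: convadj_def l2inner_def mult.commute)
  then show "convadj c (\<lambda>i. a * x i + y i) i = a * convadj c x i + convadj c y i"
    using l2inner_lin_left[OF l2_shift[OF assms(2)] l2_shift[OF assms(3)] assms(1), of a i i] by simp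
qed

lemma convadj_diff:
  assumes "c \<in> l2" "x \<in> l2" "y \<in> l2"
  shows "convadj c (\<lambda>i. x i - y i) = (\<lambda>i. convadj c x i - convadj c y i)"
  using convadj_lin[OF assms(1,3,2), of "-1"] by simp

lemma convadj_zero [simp]: "convadj c (\<lambda>i. 0) = (\<lambda>i. 0)"
  by (simp add: convadj_def)

lemma conv_ebasis: "conv c (ebasis i) k = (if i \<le> k then c (k - i) else 0)"
proof -
  have "conv c (ebasis i) k = (\<Sum>j\<le>k. if j = i then c (k - j) else 0)"
    unfolding conv_def ebasis_def by (rule sum.cong) auto
  also have "\<dots> = (if i \<le> k then c (k - i) else 0)" by (subst sum.delta) auto
  finally show ?thesis .
qed

text \<open>The two series agree once the first \<open>i\<close> vanishing entries of the shifted
  sequence \<open>c\<close> are dropped. Basis vectors come first because \<open>convadj c y\<close>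
  is not yet known to lie in \<open>l2\<close>.\<close>

lemma l2inner_conv_ebasis:
  assumes "contr c" "y \<in> l2"
  shows "l2inner (conv c (ebasis i)) y = cnj (convadj c y i)"
proof -
  have s: "summable (\<lambda>k. conv c (ebasis i) k * cnj (y k))"
    using assms by (intro summable_l2inner' contrD) auto
  have "l2inner (conv c (ebasis i)) y = (\<Sum>j. conv c (ebasis i) (j + i) * cnj (y (j + i)))"
    unfolding l2inner_def by (subst suminf_split_initial_segment[OF s, of i]) (simp add: conv_ebasis)
  also have "\<dots> = (\<Sum>j. cnj (cnj (c j) * y (i + j)))"
    by (simp add: conv_ebasis add.commute)
  also have "\<dots> = cnj (convadj c y i)"
    unfolding convadj_def
    using summable_sums[OF convadj_summable[OF contr_l2[OF assms(1)] assms(2), of i]]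
    by (subst (asm) sums_cnj[symmetric]) (simp add: sums_iff)
  finally show ?thesis .
qed

lemma trunc_Suc: "trunc (Suc N) x = (\<lambda>i. x N * ebasis N i + trunc N x i)"
  by (auto simp: trunc_def ebasis_def fun_eq_iff less_Suc_eq)

lemma l2inner_conv_trunc:
  assumes "contr c" "y \<in> l2"
  shows "l2inner (conv c (trunc N x)) y = (\<Sum>i<N. x i * cnj (convadj c y i))"
proof (induction N)
  case 0
  have "trunc 0 x = (\<lambda>i. 0)" by (simp add: trunc_def)
  then show ?case by (simp add: l2inner_def)
next
  case (Suc N)
  show ?case
    unfolding trunc_Suc conv_lin
    using assms Suc by (subst l2inner_lin_left) (auto simp: l2inner_conv_ebasis contrD)
qed

text \<open>Test the adjoint against its own truncation t: |t|^2 is the inner product of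
  \<open>conv c t\<close> with y, hence at most |t| |y|. Truncating makes |t| finite before
  membership in \<open>l2\<close> is known.\<close>

lemma
  assumes "contr c" "y \<in> l2"
  shows convadj_l2: "convadj c y \<in> l2"
    and convadj_le: "l2norm (convadj c y) \<le> l2norm y"
proof -
  have "(\<Sum>i<N. (cmod (convadj c y i))\<^sup>2) \<le> (l2norm y)\<^sup>2" for N
  proof -
    let ?t = "trunc N (convadj c y)"
    have "complex_of_real ((l2norm ?t)\<^sup>2) = l2inner (conv c ?t) y"
      unfolding l2norm_trunc l2inner_conv_trunc[OF assms] of_real_sum by (simp only: complex_norm_square)
    then have "(l2norm ?t)\<^sup>2 = cmod (l2inner (conv c ?t) y)"
      by (metis abs_power2 norm_of_real)
    also have "\<dots> \<le> l2norm (conv c ?t) * l2norm y"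
      using assms by (intro cmod_l2inner_le contrD) auto
    also have "\<dots> \<le> l2norm ?t * l2norm y"
      using assms by (intro mult_right_mono contrD l2norm_nonneg) auto
    finally have "l2norm ?t \<le> l2norm y"
      using l2norm_nonneg[OF trunc_l2, of N "convadj c y"] l2norm_nonneg[OF assms(2)]
      by (simp add: power2_eq_square mult_le_cancel_left) (metis order_le_less)
    then have "(l2norm ?t)\<^sup>2 \<le> (l2norm y)\<^sup>2" by (intro power_mono l2norm_nonneg) auto
    then show ?thesis by (simp add: l2norm_trunc)
  qed
  from l2_bound[OF this l2norm_nonneg[OF assms(2)]]
  show "convadj c y \<in> l2" "l2norm (convadj c y) \<le> l2norm y" .
qed

text \<open>Both sides are continuous in \<open>x\<close>, and finitely supported \<open>x\<close>
  are covered by \<open>l2inner_conv_trunc\<close>.\<close>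

lemma l2inner_conv:
  assumes "contr c" "x \<in> l2" "y \<in> l2"
  shows "l2inner (conv c x) y = l2inner x (convadj c y)"
proof (rule LIMSEQ_unique)
  show "(\<lambda>N. l2inner (conv c (trunc N x)) y) \<longlonglongrightarrow> l2inner x (convadj c y)"
    unfolding l2inner_conv_trunc[OF assms(1,3)] unfolding l2inner_def
    by (intro summable_LIMSEQ summable_l2inner' assms convadj_l2)
  have "(\<lambda>N. l2inner (conv c (trunc N x)) y - l2inner (conv c x) y) \<longlonglongrightarrow> 0"
  proof (rule Lim_null_comparison)
    show "(\<lambda>N. l2dist (trunc N x) x * l2norm y) \<longlonglongrightarrow> 0"
      using tendsto_mult_right[OF l2dist_trunc_tendsto[OF assms(2)], of "l2norm y"] by simp
    have "cmod (l2inner (conv c (trunc N x)) y - l2inner (conv c x) y) \<le> l2dist (trunc N x) x * l2norm y" for N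
    proof -
      have "l2inner (conv c (trunc N x)) y - l2inner (conv c x) y
          = l2inner (conv c (\<lambda>i. trunc N x i - x i)) y"
        unfolding conv_diff using assms by (intro l2inner_diff_left[symmetric] contrD) auto
      also have "cmod \<dots> \<le> l2norm (conv c (\<lambda>i. trunc N x i - x i)) * l2norm y"
        using assms by (intro cmod_l2inner_le contrD) auto
      also have "\<dots> \<le> l2dist (trunc N x) x * l2norm y"
        unfolding l2dist_def using assms by (intro mult_right_mono contrD l2norm_nonneg) auto
      finally show ?thesis .
    qed
    then show "\<forall>\<^sub>F N in sequentially. norm (l2inner (conv c (trunc N x)) y - l2inner (conv c x) y)
        \<le> l2dist (trunc N x) x * l2norm y" by simp
  qed
  then show "(\<lambda>N. l2inner (conv c (trunc N x)) y) \<longlonglongrightarrow> l2inner (conv c x) y"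
    by (rule LIM_zero_cancel)
qed

text \<open>Write y for the left side. As the operator is isometric, the inner product of x and y is
  |x|^2, so |x - y|^2 = |y|^2 - |x|^2, and this is not positive because the adjoint is a
  contraction.\<close>

lemma convadj_conv:
  assumes "isom c" "x \<in> l2"
  shows "convadj c (conv c x) = x"
proof -
  let ?y = "convadj c (conv c x)"
  have c: "contr c" using assms isom_contr by auto
  have l: "conv c x \<in> l2" "?y \<in> l2" using c assms by (auto intro: convadj_l2 contrD)
  have "l2inner x ?y = of_real ((l2norm x)\<^sup>2)"
    unfolding l2inner_conv[OF c assms(2) l(1), symmetric] l2inner_self[OF l(1)]
    using isomD[OF assms] by simp
  then have "(l2norm (\<lambda>i. x i - ?y i))\<^sup>2 = (l2norm ?y)\<^sup>2 - (l2norm x)\<^sup>2"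
    using l2norm_diff_power2[OF assms(2) l(2)] by simp
  moreover have "(l2norm ?y)\<^sup>2 \<le> (l2norm x)\<^sup>2"
    using convadj_le[OF c l(1)] isomD[OF assms] l2norm_nonneg[OF l(2)] by (intro power_mono) auto
  ultimately have "l2norm (\<lambda>i. x i - ?y i) = 0"
    using zero_le_power2[of "l2norm (\<lambda>i. x i - ?y i)"] by auto
  then have "(\<lambda>i. x i - ?y i) = (\<lambda>i. 0)" using l2norm_eq_0_iff[OF l2_diff[OF assms(2) l(2)]] by simp
  then show ?thesis by (auto simp: fun_eq_iff)
qed

lemma convadj_comp:
  assumes "contr c" "contr d" "y \<in> l2"
  shows "convadj (conv c d) y = convadj d (convadj c y)"
proof
  fix i
  have "cnj (convadj (conv c d) y i) = l2inner (conv c (conv d (ebasis i))) y"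
    using l2inner_conv_ebasis[OF contr_conv[OF assms(1,2)] assms(3), of i] by (simp add: conv_assoc)
  also have "\<dots> = l2inner (conv d (ebasis i)) (convadj c y)"
    using assms by (intro l2inner_conv contrD) auto
  also have "\<dots> = cnj (convadj d (convadj c y) i)"
    using assms by (intro l2inner_conv_ebasis convadj_l2) auto
  finally show "convadj (conv c d) y i = convadj d (convadj c y) i" by simp
qed

lemma convadj_trunc: "convadj c (trunc N x) i = (\<Sum>j<N. cnj (c j) * trunc N x (i + j))"
  unfolding convadj_def by (rule suminf_finite) (auto simp: trunc_def)

text \<open>The adjoint only moves entries to lower indices, so support below \<open>N\<close> is
  preserved and norms become finite sums.\<close>

lemma convadj_trunc_support: "convadj c (trunc N x) = trunc N (convadj c (trunc N x))"
proof
  fix i show "convadj c (trunc N x) i = trunc N (convadj c (trunc N x)) i"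
    unfolding trunc_def[of N "convadj c (trunc N x)"] convadj_trunc by (auto simp: trunc_def)
qed

text \<open>On finitely supported sequences the adjoint only involves finitely many coefficients,
  so coefficientwise convergence of contractive symbols is enough.\<close>

lemma convadj_strong_limit:
  assumes c: "contr c" and d: "\<And>n. contr (d n)" and lim: "\<And>k. (\<lambda>n. d n k) \<longlonglongrightarrow> c k" and x: "x \<in> l2"
  shows "(\<lambda>n. l2dist (convadj (d n) x) (convadj c x)) \<longlonglongrightarrow> 0"
proof (rule LIMSEQ_I)
  fix e :: real assume e: "0 < e"
  have "\<forall>\<^sub>F N in sequentially. l2dist (trunc N x) x < e / 3"
    using l2dist_trunc_tendsto[OF x] e by (intro order_tendstoD) auto
  then obtain N where N: "l2dist (trunc N x) x < e / 3" by (auto simp: eventually_sequentially)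
  let ?t = "trunc N x"
  have fin: "(\<lambda>n. l2dist (convadj (d n) ?t) (convadj c ?t)) \<longlonglongrightarrow> 0"
  proof -
    have eq: "l2dist (convadj (d n) ?t) (convadj c ?t)
        = sqrt (\<Sum>i<N. (cmod (convadj (d n) ?t i - convadj c ?t i))\<^sup>2)" for n
    proof -
      have "(\<lambda>i. convadj (d n) ?t i - convadj c ?t i) = trunc N (\<lambda>i. convadj (d n) ?t i - convadj c ?t i)"
        by (subst (1 2) convadj_trunc_support) (auto simp: trunc_def)
      then have "(l2dist (convadj (d n) ?t) (convadj c ?t))\<^sup>2
          = (\<Sum>i<N. (cmod (convadj (d n) ?t i - convadj c ?t i))\<^sup>2)"
        unfolding l2dist_def by (metis l2norm_trunc)
      moreover have "0 \<le> l2dist (convadj (d n) ?t) (convadj c ?t)"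
        using c d by (intro l2dist_nonneg convadj_l2) auto
      ultimately show ?thesis by (metis real_sqrt_unique)
    qed
    have "(\<lambda>n. convadj (d n) ?t i) \<longlonglongrightarrow> convadj c ?t i" for i
      unfolding convadj_trunc by (intro tendsto_intros lim)
    then have "(\<lambda>n. sqrt (\<Sum>i<N. (cmod (convadj (d n) ?t i - convadj c ?t i))\<^sup>2))
        \<longlonglongrightarrow> sqrt (\<Sum>i<N. (cmod (convadj c ?t i - convadj c ?t i))\<^sup>2)"
      by (intro tendsto_intros)
    then show ?thesis by (simp add: eq)
  qed
  then have "\<forall>\<^sub>F n in sequentially. l2dist (convadj (d n) ?t) (convadj c ?t) < e / 3"
    using e by (intro order_tendstoD) auto
  then obtain M where M: "\<And>n. n \<ge> M \<Longrightarrow> l2dist (convadj (d n) ?t) (convadj c ?t) < e / 3"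
    by (auto simp: eventually_sequentially)
  have close: "l2dist (convadj b x) (convadj b ?t) < e / 3" if "contr b" for b
  proof -
    have "l2dist (convadj b x) (convadj b ?t) = l2norm (convadj b (\<lambda>i. x i - ?t i))"
      unfolding l2dist_def using that x contr_l2[OF that] by (subst convadj_diff) auto
    also have "\<dots> \<le> l2dist x ?t" unfolding l2dist_def using that x by (intro convadj_le) auto
    finally show ?thesis using N by (simp add: l2dist_commute)
  qed
  show "\<exists>M. \<forall>n\<ge>M. norm (l2dist (convadj (d n) x) (convadj c x) - 0) < e"
  proof (intro exI[of _ M] allI impI)
    fix n assume "M \<le> n"
    have mem: "convadj (d n) x \<in> l2" "convadj (d n) ?t \<in> l2" "convadj c x \<in> l2" "convadj c ?t \<in> l2"
      using c d x by (auto intro: convadj_l2)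
    have "l2dist (convadj (d n) x) (convadj c x) < e"
      using l2dist_triangle[OF mem(1,2,3)] l2dist_triangle[OF mem(2,4,3)]
        close[OF d[of n]] close[OF c] M[OF \<open>M \<le> n\<close>] by (simp add: l2dist_commute[of "convadj c ?t"])
    then show "norm (l2dist (convadj (d n) x) (convadj c x) - 0) < e"
      using l2dist_nonneg[OF mem(1,3)] by simp
  qed
qed

text \<open>Each coordinate of \<open>conv c x\<close> involves finitely many coefficients of
  \<open>c\<close>, so every partial sum of the squared norm converges and keeps its bound. An
  isometry need not survive: the powers of z tend to 0 coefficientwise.\<close>

lemma contr_limit:
  assumes d: "\<And>n. contr (d n)" and lim: "\<And>k. (\<lambda>n. d n k) \<longlonglongrightarrow> c k"
  shows "contr c"
  unfolding contr_def
proof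
  fix x assume x: "x \<in> l2"
  have "(\<Sum>i<N. (cmod (conv c x i))\<^sup>2) \<le> (l2norm x)\<^sup>2" for N
  proof (rule LIMSEQ_le_const2)
    show "(\<lambda>n. \<Sum>i<N. (cmod (conv (d n) x i))\<^sup>2) \<longlonglongrightarrow> (\<Sum>i<N. (cmod (conv c x i))\<^sup>2)"
      unfolding conv_def by (intro tendsto_intros lim)
    have "(\<Sum>i<N. (cmod (conv (d n) x i))\<^sup>2) \<le> (l2norm x)\<^sup>2" for n
      using sum_le_l2norm[OF contrD(1)[OF d x], of "{..<N}" n]
        power_mono[OF contrD(2)[OF d[of n] x] l2norm_nonneg[OF contrD(1)[OF d x]], of 2]
      by (meson finite_lessThan order_trans)
    then show "\<exists>K. \<forall>n\<ge>K. (\<Sum>i<N. (cmod (conv (d n) x i))\<^sup>2) \<le> (l2norm x)\<^sup>2" by blast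
  qed
  from l2_bound[OF this l2norm_nonneg[OF x]] show "conv c x \<in> l2 \<and> l2norm (conv c x) \<le> l2norm x" by simp
qed

text \<open>With W = x / (1 - cnj l X) the two quadratic forms differ by a telescoping sum.\<close>

lemma isom_blaschke:
  fixes l z :: complex
  assumes l: "cmod l < 1" and z: "cmod z = 1"
    and eq: "Abs_fps c * (1 - fps_const (cnj l) * fps_X) = fps_const z * (fps_const l - fps_X)"
  shows "isom c"
  unfolding isom_def
proof
  fix x assume x: "x \<in> l2"
  define y where "y = conv c x"
  define W where "W = Abs_fps x * inverse (1 - fps_const (cnj l) * fps_X)"
  define w where "w = fps_nth W"
  have inv: "inverse (1 - fps_const (cnj l) * fps_X) * (1 - fps_const (cnj l) * fps_X) = 1"
    by (rule inverse_mult_eq_1) simp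
  have X: "Abs_fps x = W * (1 - fps_const (cnj l) * fps_X)"
    unfolding W_def mult.assoc inv by simp
  have Y: "Abs_fps y = fps_const z * (fps_const l - fps_X) * W"
    unfolding y_def Abs_fps_conv X eq[symmetric] by (simp only: mult_ac)
  have xw: "x i = w i - cnj l * (if i = 0 then 0 else w (i - 1))" for i
  proof -
    have "x i = fps_nth (W - fps_const (cnj l) * (fps_X * W)) i"
      using arg_cong[OF X, of "\<lambda>f. fps_nth f i"] by (simp add: algebra_simps)
    then show ?thesis by (simp add: w_def)
  qed
  have yw: "y i = z * (l * w i - (if i = 0 then 0 else w (i - 1)))" for i
  proof -
    have "y i = fps_nth (fps_const z * (fps_const l * W - fps_X * W)) i"
      using arg_cong[OF Y, of "\<lambda>f. fps_nth f i"] by (simp add: algebra_simps)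
    then show ?thesis by (simp add: w_def)
  qed
  \<comment> \<open>The defect of the Blaschke factor: with \<open>w i\<close> and
    \<open>w (i - 1)\<close> for \<open>a\<close> and \<open>b\<close>, the correction is a
    difference of consecutive terms.\<close>
  have quad: "(cmod (l * a - b))\<^sup>2 = (cmod (a - cnj l * b))\<^sup>2 - (1 - (cmod l)\<^sup>2) * ((cmod a)\<^sup>2 - (cmod b)\<^sup>2)"
    for a b
    unfolding cmod_power2 by (simp add: power2_eq_square algebra_simps)
  have tele: "(\<Sum>i<Suc N. (cmod (y i))\<^sup>2) = (\<Sum>i<Suc N. (cmod (x i))\<^sup>2) - (1 - (cmod l)\<^sup>2) * (cmod (w N))\<^sup>2" for N
  proof (induction N)
    case 0
    show ?case using xw[of 0] yw[of 0] z by (simp add: norm_mult power_mult_distrib algebra_simps)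
  next
    case (Suc N)
    have "(cmod (y (Suc N)))\<^sup>2 = (cmod (x (Suc N)))\<^sup>2 - (1 - (cmod l)\<^sup>2) * ((cmod (w (Suc N)))\<^sup>2 - (cmod (w N))\<^sup>2)"
      using quad[of "w (Suc N)" "w N"] z unfolding xw[of "Suc N"] yw[of "Suc N"] norm_mult by simp
    then show ?case
      unfolding sum.lessThan_Suc[of _ "Suc N"] Suc.IH by (simp add: algebra_simps)
  qed
  \<comment> \<open>The telescoped sum leaves the boundary term \<open>w N\<close>, which must tend
    to 0. The recursion w_i = x_i + cnj l * w_(i-1) gives |w| <= |x| + |l| |w| on every initial
    segment, whence the bound |x| / (1 - |l|).\<close>
  have "w \<in> l2"
  proof (rule l2_bound)
    have nx: "0 \<le> l2norm x" using x by (rule l2norm_nonneg)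
    then show "0 \<le> l2norm x / (1 - cmod l)" using l by simp
    fix N
    let ?s = "\<lambda>i. if i = 0 then 0 else w (i - 1)"
    have sw: "L2_set (\<lambda>i. cmod (?s i)) {..<N} \<le> L2_set (\<lambda>i. cmod (w i)) {..<N}"
    proof (cases N)
      case (Suc M)
      then have "(\<Sum>i<N. (cmod (?s i))\<^sup>2) = (\<Sum>i<M. (cmod (w i))\<^sup>2)"
        by (simp add: sum.lessThan_Suc_shift del: sum.lessThan_Suc)
      also have "\<dots> \<le> (\<Sum>i<N. (cmod (w i))\<^sup>2)" using Suc by simp
      finally show ?thesis unfolding L2_set_def by simp
    qed simp
    have "L2_set (\<lambda>i. cmod (w i)) {..<N} \<le> L2_set (\<lambda>i. cmod (x i) + cmod l * cmod (?s i)) {..<N}"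
    proof (rule L2_set_mono)
      fix i
      have "w i = x i + cnj l * ?s i" by (simp add: xw)
      then show "cmod (w i) \<le> cmod (x i) + cmod l * cmod (?s i)"
        by (metis norm_triangle_ineq norm_mult complex_mod_cnj)
    qed simp
    also have "\<dots> \<le> L2_set (\<lambda>i. cmod (x i)) {..<N} + L2_set (\<lambda>i. cmod l * cmod (?s i)) {..<N}"
      by (rule L2_set_triangle_ineq)
    also have "L2_set (\<lambda>i. cmod l * cmod (?s i)) {..<N} = cmod l * L2_set (\<lambda>i. cmod (?s i)) {..<N}"
      by (rule L2_set_right_distrib[symmetric]) simp
    also have "L2_set (\<lambda>i. cmod (x i)) {..<N} \<le> l2norm x" using x by (intro L2_set_le_l2norm) auto
    finally have "L2_set (\<lambda>i. cmod (w i)) {..<N} * (1 - cmod l) \<le> l2norm x"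
      using mult_left_mono[OF sw norm_ge_zero[of l]] by (simp add: algebra_simps)
    then have "L2_set (\<lambda>i. cmod (w i)) {..<N} \<le> l2norm x / (1 - cmod l)"
      using l by (simp add: pos_le_divide_eq)
    then have "(L2_set (\<lambda>i. cmod (w i)) {..<N})\<^sup>2 \<le> (l2norm x / (1 - cmod l))\<^sup>2"
      by (rule power_mono) (rule L2_set_nonneg)
    then show "(\<Sum>i<N. (cmod (w i))\<^sup>2) \<le> (l2norm x / (1 - cmod l))\<^sup>2" by (simp add: L2_set_power2)
  qed
  then have "(\<lambda>N. (cmod (w N))\<^sup>2) \<longlonglongrightarrow> 0" unfolding l2_def mem_Collect_eq by (rule summable_LIMSEQ_zero)
  moreover have "(\<lambda>N. \<Sum>i<Suc N. (cmod (x i))\<^sup>2) \<longlonglongrightarrow> (l2norm x)\<^sup>2"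
    unfolding l2norm_power2[OF x]
    by (rule LIMSEQ_Suc, rule summable_LIMSEQ) (use x in \<open>simp add: l2_def\<close>)
  ultimately have "(\<lambda>N. (\<Sum>i<Suc N. (cmod (x i))\<^sup>2) - (1 - (cmod l)\<^sup>2) * (cmod (w N))\<^sup>2)
      \<longlonglongrightarrow> (l2norm x)\<^sup>2 - (1 - (cmod l)\<^sup>2) * 0" by (intro tendsto_intros)
  then have "(\<lambda>N. \<Sum>i<Suc N. (cmod (y i))\<^sup>2) \<longlonglongrightarrow> (l2norm x)\<^sup>2" unfolding tele by simp
  then have s: "(\<lambda>i. (cmod (y i))\<^sup>2) sums (l2norm x)\<^sup>2"
    unfolding sums_def by (rule LIMSEQ_imp_Suc)
  then have "y \<in> l2" by (auto simp: l2_def sums_iff)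
  moreover have "l2norm y = l2norm x"
    using s l2norm_nonneg[OF x] by (simp add: l2norm_def sums_iff)
  ultimately show "conv c x \<in> l2 \<and> l2norm (conv c x) = l2norm x" by (simp add: y_def)
qed

abbreviation sh :: "sq \<Rightarrow> sq" where
  "sh \<equiv> conv (ebasis 1)"

text \<open>The shift is multiplication by z, which is the Blaschke factor -1 * (0 - z).\<close>

lemma isom_sh: "isom (ebasis 1)"
  by (rule isom_blaschke[of 0 "-1"]) (simp_all add: Abs_fps_ebasis[unfolded One_nat_def] fps_const_neg[symmetric])

lemma sh_apply: "sh x i = (if i = 0 then 0 else x (i - 1))"
  unfolding conv_fps Abs_fps_ebasis by simp

section \<open>Projections onto model spaces\<close>

definition Pc :: "sq \<Rightarrow> sq \<Rightarrow> sq" where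
  "Pc c x = (\<lambda>i. x i - conv c (convadj c x) i)"

lemma Pin_eq: "Pin v = Pc (tcoef v)"
  by (simp add: fun_eq_iff Pin_def Pc_def conv_def convadj_def atoep_def atoep_adj_def)

lemma Pc_l2: "contr c \<Longrightarrow> x \<in> l2 \<Longrightarrow> Pc c x \<in> l2"
  unfolding Pc_def by (intro l2_diff contrD convadj_l2)

text \<open>The triangle inequality for two contractions. What matters later is that the constant is
  the same for all symbols.\<close>

lemma Pc_le:
  assumes "contr c" "x \<in> l2"
  shows "l2norm (Pc c x) \<le> 2 * l2norm x"
proof -
  have "l2norm (Pc c x) \<le> l2norm x + l2norm (conv c (convadj c x))"
    unfolding Pc_def using assms by (intro l2norm_triangle_diff contrD convadj_l2)
  also have "l2norm (conv c (convadj c x)) \<le> l2norm (convadj c x)"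
    using assms by (intro contrD convadj_l2)
  also have "l2norm (convadj c x) \<le> l2norm x" using assms by (rule convadj_le)
  finally show ?thesis by simp
qed

lemma Pc_lin:
  assumes "contr c" "x \<in> l2" "y \<in> l2"
  shows "Pc c (\<lambda>i. a * x i + y i) = (\<lambda>i. a * Pc c x i + Pc c y i)"
  unfolding Pc_def convadj_lin[OF contr_l2[OF assms(1)] assms(2,3)] conv_lin
  by (simp add: algebra_simps)

lemma Pc_diff:
  assumes "contr c" "x \<in> l2" "y \<in> l2"
  shows "Pc c (\<lambda>i. x i - y i) = (\<lambda>i. Pc c x i - Pc c y i)"
  using Pc_lin[OF assms(1,3,2), of "-1"] by simp

text \<open>Multiplication by a nonzero power series is injective, so the subtracted term vanishes
  only where the adjoint does. This applies to the infinite product as soon as its coefficients are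
  not all 0.\<close>

lemma Pc_fix_iff:
  assumes "c \<noteq> (\<lambda>i. 0)"
  shows "Pc c x = x \<longleftrightarrow> convadj c x = (\<lambda>i. 0)"
proof -
  have "Pc c x = x \<longleftrightarrow> conv c (convadj c x) = (\<lambda>i. 0)" by (auto simp: Pc_def fun_eq_iff)
  then show ?thesis using assms by (simp add: conv_eq_0_iff)
qed

lemma convadj_Pc:
  assumes "isom c" "x \<in> l2"
  shows "convadj c (Pc c x) = (\<lambda>i. 0)"
proof -
  have c: "contr c" using assms isom_contr by auto
  have "convadj c (Pc c x) = (\<lambda>i. convadj c x i - convadj c (conv c (convadj c x)) i)"
    unfolding Pc_def using assms c contr_l2[OF c] by (intro convadj_diff contrD convadj_l2)
  then show ?thesis using assms c by (simp add: convadj_conv convadj_l2)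
qed

lemma Pc_conv: "isom c \<Longrightarrow> x \<in> l2 \<Longrightarrow> Pc c (conv c x) = (\<lambda>i. 0)"
  by (simp add: Pc_def convadj_conv)

text \<open>The difference of \<open>x\<close> and \<open>Pc (conv c d) x\<close> is a multiple of
  \<open>c\<close>, and \<open>Pc c\<close> kills these. The factor \<open>d\<close> is merely
  contractive as it will be the tail of an infinite product.\<close>

lemma Pc_Pc_conv:
  assumes "isom c" "contr d" "x \<in> l2"
  shows "Pc c (Pc (conv c d) x) = Pc c x"
proof -
  have c: "contr c" using assms isom_contr by auto
  have e: "contr (conv c d)" using c assms by (intro contr_conv)
  let ?g = "convadj (conv c d) x"
  have g: "?g \<in> l2" using e assms by (intro convadj_l2)
  have "Pc c (Pc (conv c d) x) = (\<lambda>i. Pc c x i - Pc c (conv (conv c d) ?g) i)"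
    unfolding Pc_def[of "conv c d"] using assms c e g by (intro Pc_diff contrD)
  also have "Pc c (conv (conv c d) ?g) = (\<lambda>i. 0)"
    unfolding conv_assoc using assms g by (intro Pc_conv contrD)
  finally show ?thesis by simp
qed

lemma convadj_conv_eq_0:
  assumes "contr c" "contr d" "x \<in> l2" "convadj c x = (\<lambda>i. 0)"
  shows "convadj (conv c d) x = (\<lambda>i. 0)"
  using convadj_comp[OF assms(1-3)] assms(4) by simp

lemma convadj_ebasis_0: "convadj w (ebasis 0) = (\<lambda>i. cnj (w 0) * ebasis 0 i)"
proof
  fix i show "convadj w (ebasis 0) i = cnj (w 0) * ebasis 0 i"
    unfolding convadj_def by (subst suminf_finite[of "{0}"]) (auto simp: ebasis_def)
qed

text \<open>The projection of \<open>c\<close> is \<open>c\<close> times 1 - cnj (w 0) * w, the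
  reproducing kernel at 0 of the model space of \<open>w\<close>. The squared norm of that kernel is
  its value at 0.\<close>

lemma Pc_conv_self:
  assumes "isom c" "isom w"
  shows "(l2norm (Pc (conv c w) c))\<^sup>2 = 1 - (cmod (w 0))\<^sup>2"
proof -
  have cw: "contr c" "contr w" using assms isom_contr by auto
  let ?d = "\<lambda>i. ebasis 0 i - cnj (w 0) * w i"
  have "convadj (conv c w) c = convadj w (convadj c c)"
    using cw contr_l2 by (intro convadj_comp) auto
  also have "convadj c c = ebasis 0"
    using convadj_conv[OF assms(1), of "ebasis 0"] by (simp add: conv_ebasis_0)
  finally have "Pc (conv c w) c = (\<lambda>i. c i - conv c (conv w (\<lambda>i. cnj (w 0) * ebasis 0 i)) i)"
    by (simp add: Pc_def conv_assoc convadj_ebasis_0)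
  also have "conv w (\<lambda>i. cnj (w 0) * ebasis 0 i) = (\<lambda>i. cnj (w 0) * w i)"
    using conv_lin[of w "cnj (w 0)" "ebasis 0" "\<lambda>i. 0"] by (simp add: conv_ebasis_0)
  also have "(\<lambda>i. c i - conv c (\<lambda>i. cnj (w 0) * w i) i) = conv c ?d"
    unfolding conv_diff conv_ebasis_0 ..
  finally have "Pc (conv c w) c = conv c ?d" .
  then have "(l2norm (Pc (conv c w) c))\<^sup>2 = (l2norm ?d)\<^sup>2"
    using isomD[OF assms(1), of ?d] contr_l2[OF cw(2)] by auto
  also have "\<dots> = 1 - 2 * Re (l2inner (ebasis 0) (\<lambda>i. cnj (w 0) * w i)) + (cmod (w 0))\<^sup>2"
    using l2norm_diff_power2[of "ebasis 0" "\<lambda>i. cnj (w 0) * w i"] contr_l2[OF cw(2)]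
    by (simp add: l2norm_scale isom_l2norm[OF assms(2)])
  also have "l2inner (ebasis 0) (\<lambda>i. cnj (w 0) * w i) = of_real ((cmod (w 0))\<^sup>2)"
    using l2inner_cnj[of "\<lambda>i. cnj (w 0) * w i" "ebasis 0"] contr_l2[OF cw(2)]
    unfolding complex_norm_square by (simp add: l2inner_ebasis)
  finally show ?thesis by simp
qed

section \<open>Coefficients of Blaschke products\<close>

lemma tcoef_eqI: "f has_fps_expansion F \<Longrightarrow> Abs_fps (tcoef f) = F"
  by (simp add: fps_eq_iff tcoef_def fps_nth_fps_expansion)

text \<open>\<open>z\<close> is the unimodular normalisation |l| / l, or -1 for l = 0. The identity
  is cleared of its denominator to have the form that \<open>isom_blaschke\<close> and the
  coefficient recursion ask for.\<close>

lemma bfac_fps: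
  assumes "cmod l < 1"
  obtains F z where "bfac l has_fps_expansion F" "cmod z = 1"
    "F * (1 - fps_const (cnj l) * fps_X) = fps_const z * (fps_const l - fps_X)"
proof (cases "l = 0")
  case True
  have "bfac l has_fps_expansion fps_X"
    unfolding bfac_def[abs_def] True by (simp add: has_fps_expansion_fps_X)
  moreover have "fps_const (-1) = (-1 :: complex fps)" by (simp only: fps_const_neg[symmetric] fps_const_1_eq_1)
  then have "fps_X * (1 - fps_const (cnj l) * fps_X) = fps_const (-1) * (fps_const l - fps_X)"
    unfolding True by simp
  ultimately show thesis by (intro that[of fps_X "-1"]) simp_all
next
  case False
  let ?z = "complex_of_real (cmod l) / l"
  let ?D = "1 - fps_const (cnj l) * fps_X :: complex fps"
  let ?F = "(fps_const l - fps_X) * inverse ?D * fps_const ?z"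
  have "(\<lambda>z. (l - z) * inverse (1 - cnj l * z) * ?z) has_fps_expansion ?F"
    by (intro has_fps_expansion_mult has_fps_expansion_inverse has_fps_expansion_diff
        has_fps_expansion_const has_fps_expansion_fps_X has_fps_expansion_1) simp
  then have "bfac l has_fps_expansion ?F" by (simp add: bfac_def[abs_def] False divide_inverse)
  moreover have "cmod ?z = 1" using False by (simp add: norm_divide)
  moreover have "?F * ?D = fps_const ?z * (fps_const l - fps_X)"
  proof -
    have "inverse ?D * ?D = 1" by (rule inverse_mult_eq_1) simp
    then have "(fps_const l - fps_X) * fps_const ?z * (inverse ?D * ?D) = (fps_const l - fps_X) * fps_const ?z"
      by (simp only: mult_1_right)
    then show ?thesis by (simp only: mult_ac)
  qed
  ultimately show thesis by (rule that)
qed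

lemma isom_bfac:
  assumes "cmod l < 1"
  shows "isom (tcoef (bfac l))"
proof -
  obtain F z where F: "bfac l has_fps_expansion F" "cmod z = 1"
      "F * (1 - fps_const (cnj l) * fps_X) = fps_const z * (fps_const l - fps_X)"
    using bfac_fps[OF assms] .
  then show ?thesis using isom_blaschke[OF assms F(2)] tcoef_eqI[OF F(1)] by simp
qed

text \<open>The model space of one Blaschke factor is the line through the Szego kernel 1 / (1 - cnj
  l * z). The inclusion in this line is the source of the dimension bounds.\<close>

lemma convadj_bfac_eq_0:
  assumes l: "cmod l < 1" and g: "g \<in> l2" and eq: "convadj (tcoef (bfac l)) g = (\<lambda>i. 0)"
  shows "g = (\<lambda>i. g 0 * cnj l ^ i)"
proof -
  obtain F z where F: "bfac l has_fps_expansion F" "cmod z = 1"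
      "F * (1 - fps_const (cnj l) * fps_X) = fps_const z * (fps_const l - fps_X)"
    using bfac_fps[OF l] .
  define b where "b = tcoef (bfac l)"
  have b2: "b \<in> l2" unfolding b_def using isom_bfac[OF l] isom_contr contr_l2 by blast
  have eq': "(\<lambda>j. cnj (b j) * g (i + j)) sums 0" for i
    using summable_sums[OF convadj_summable[OF b2 g, of i]] fun_cong[OF eq, of i]
    by (simp add: convadj_def b_def)
  have Fb: "fps_nth F j = b j" for j
    using tcoef_eqI[OF F(1)] unfolding b_def by (metis fps_nth_Abs_fps)
  have coef: "fps_nth (F - fps_const (cnj l) * (fps_X * F)) j = fps_nth (fps_const z * (fps_const l - fps_X)) j" for j
    unfolding F(3)[symmetric] by (simp add: algebra_simps)
  have b0: "b 0 = z * l" using coef[of 0] by (simp add: Fb)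
  have bS: "b (Suc j) = cnj l * b j - (if j = 0 then z else 0)" for j
    using coef[of "Suc j"] by (cases j) (simp_all add: Fb diff_eq_eq)
  \<comment> \<open>By the recursion \<open>bS\<close>, \<open>l\<close> times the equation with
    index \<open>i + 1\<close> is the equation with index \<open>i\<close> without its term at 0, up
    to a correction by \<open>z\<close>. Subtracting links \<open>g (Suc i)\<close> to
    \<open>g i\<close>.\<close>
  have "g (Suc i) = cnj l * g i" for i
  proof -
    have "(\<lambda>j. if j = 0 then cnj z * g (Suc i) else 0) sums (cnj z * g (Suc i))"
      using sums_single[of 0 "\<lambda>_. cnj z * g (Suc i)"] .
    then have "(\<lambda>j. l * (cnj (b j) * g (Suc i + j)) - (if j = 0 then cnj z * g (Suc i) else 0))
        sums (l * 0 - cnj z * g (Suc i))"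
      by (intro sums_diff sums_mult eq')
    also have "(\<lambda>j. l * (cnj (b j) * g (Suc i + j)) - (if j = 0 then cnj z * g (Suc i) else 0))
        = (\<lambda>j. cnj (b (Suc j)) * g (i + Suc j))"
      by (auto simp: bS fun_eq_iff algebra_simps)
    finally have "(\<lambda>j. cnj (b j) * g (i + j)) sums (- (cnj z * g (Suc i)) + cnj (b 0) * g i)"
      by (subst (asm) sums_Suc_iff) simp
    from sums_unique2[OF eq' this] have "cnj z * g (Suc i) = cnj z * (cnj l * g i)"
      by (auto simp: b0 mult.assoc)
    moreover have "cnj z \<noteq> 0" using F(2) by auto
    ultimately show ?thesis by simp
  qed
  then have "g i = g 0 * cnj l ^ i" for i
    by (induction i) (simp_all add: mult_ac)
  then show ?thesis by (rule ext)
qed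

section \<open>Finite partial products\<close>

definition ucoef :: "(nat \<Rightarrow> complex) \<Rightarrow> nat \<Rightarrow> sq" where
  "ucoef lam n = tcoef (bpart lam n)"

lemma Abs_fps_ucoef:
  assumes "\<And>k. cmod (lam k) < 1"
  shows "Abs_fps (ucoef lam n) = (\<Prod>k<n. Abs_fps (tcoef (bfac (lam k))))"
  unfolding ucoef_def
proof (rule tcoef_eqI)
  have "bfac (lam k) has_fps_expansion Abs_fps (tcoef (bfac (lam k)))" for k
  proof -
    obtain F where "bfac (lam k) has_fps_expansion F" using bfac_fps[OF assms[of k]] .
    then show ?thesis using tcoef_eqI by simp
  qed
  then show "bpart lam n has_fps_expansion (\<Prod>k<n. Abs_fps (tcoef (bfac (lam k))))"
    unfolding bpart_def[abs_def] by (intro has_fps_expansion_prod) auto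
qed

lemma ucoef_add:
  assumes "\<And>k. cmod (lam k) < 1"
  shows "ucoef lam (n + m) = conv (ucoef lam n) (ucoef (\<lambda>k. lam (k + n)) m)"
proof -
  let ?f = "\<lambda>k. Abs_fps (tcoef (bfac (lam k)))"
  have "(\<Prod>k<n + m. ?f k) = (\<Prod>k<n. ?f k) * (\<Prod>k<m. ?f (k + n))"
    by (induction m) (simp_all add: mult_ac add.commute)
  then show ?thesis
    using assms by (simp add: Abs_fps_eq_iff[symmetric] Abs_fps_conv Abs_fps_ucoef)
qed

lemma ucoef_Suc:
  assumes "\<And>k. cmod (lam k) < 1"
  shows "ucoef lam (Suc n) = conv (ucoef lam n) (tcoef (bfac (lam n)))"
  using assms by (simp add: Abs_fps_eq_iff[symmetric] Abs_fps_conv Abs_fps_ucoef)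

lemma ucoef_0: "ucoef lam 0 = ebasis 0"
proof -
  have "bpart lam 0 has_fps_expansion 1" by (simp add: bpart_def[abs_def])
  then have "Abs_fps (ucoef lam 0) = 1" unfolding ucoef_def by (rule tcoef_eqI)
  then show ?thesis by (simp add: Abs_fps_eq_iff[symmetric] Abs_fps_ebasis)
qed

lemma conv_one: "conv (ebasis 0) x = x"
  by (simp add: conv_commute[of "ebasis 0"] conv_ebasis_0)

lemma isom_ucoef:
  assumes "\<And>k. cmod (lam k) < 1"
  shows "isom (ucoef lam n)"
proof (induction n)
  case 0
  show ?case by (simp add: ucoef_0 isom_def conv_one)
next
  case (Suc n)
  then show ?case using assms by (simp add: ucoef_Suc isom_conv isom_bfac)
qed

text \<open>The factor |l| / l in \<open>bfac\<close> makes each factor equal to |l| at 0, so no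
  phases enter.\<close>

lemma ucoef_at_0: "ucoef lam n 0 = of_real (\<Prod>k<n. cmod (lam k))"
proof -
  have "bfac l 0 = of_real (cmod l)" for l by (simp add: bfac_def)
  then show ?thesis by (simp add: ucoef_def tcoef_def bpart_def)
qed

text \<open>For l nonzero, 1 - b_l(z) = (1 - |l|) (l + |l| z) / (l (1 - cnj l * z)). On |z| <= 1/2
  the factor l + |l| z is at most 3/2 |l| and the denominator at least |l| / 2, with quotient 3. For
  l = 0 the left side is at most 3/2.\<close>

lemma bfac_minus_1_le:
  assumes l: "cmod l < 1" and z: "cmod z \<le> 1 / 2"
  shows "cmod (bfac l z - 1) \<le> 3 * (1 - cmod l)"
proof (cases "l = 0")
  case True
  have "cmod (z - 1) \<le> cmod z + 1" by (metis norm_triangle_ineq4 norm_one)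
  then show ?thesis using True z by (simp add: bfac_def)
next
  case False
  have lz: "cmod (cnj l * z) \<le> 1 / 2"
    using mult_mono[of "cmod l" 1 "cmod z" "1/2"] l z by (simp add: norm_mult)
  have d: "1 / 2 \<le> cmod (1 - cnj l * z)"
    using norm_triangle_ineq2[of 1 "cnj l * z"] lz by simp
  then have nz: "1 - cnj l * z \<noteq> 0" by auto
  have ll: "l * cnj l = of_real (cmod l) * of_real (cmod l)"
    using complex_norm_square[of l] by (simp add: power2_eq_square)
  have "(bfac l z - 1) * (l * (1 - cnj l * z)) = (l - z) * of_real (cmod l) - l * (1 - cnj l * z)"
    using False nz by (simp add: bfac_def field_simps)
  also have "\<dots> = - (of_real (1 - cmod l) * (l + of_real (cmod l) * z))"
    using ll by (simp add: algebra_simps)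
  finally have "cmod (bfac l z - 1) * (cmod l * cmod (1 - cnj l * z)) = (1 - cmod l) * cmod (l + of_real (cmod l) * z)"
    using l by (metis abs_of_pos diff_gt_0_iff_gt norm_minus_cancel norm_mult norm_of_real)
  also have "cmod (l + of_real (cmod l) * z) \<le> cmod l * (3 / 2)"
  proof -
    have "cmod (l + of_real (cmod l) * z) \<le> cmod l + cmod l * cmod z"
      using norm_triangle_ineq[of l "of_real (cmod l) * z"] by (simp add: norm_mult)
    also have "\<dots> \<le> cmod l + cmod l * (1 / 2)" using z by (intro add_left_mono mult_left_mono) auto
    finally show ?thesis by simp
  qed
  finally have "cmod l * (cmod (bfac l z - 1) * cmod (1 - cnj l * z)) \<le> cmod l * ((1 - cmod l) * (3 / 2))"
    using l by (simp add: mult_left_mono mult_ac)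
  then have "cmod (bfac l z - 1) * cmod (1 - cnj l * z) \<le> (1 - cmod l) * (3 / 2)"
    using False by simp
  moreover have "cmod (bfac l z - 1) * (1 / 2) \<le> cmod (bfac l z - 1) * cmod (1 - cnj l * z)"
    using d by (intro mult_left_mono) auto
  ultimately show ?thesis by simp
qed

lemma bfac_holomorphic: "cmod l < 1 \<Longrightarrow> bfac l holomorphic_on ball 0 1"
proof (cases "l = 0")
  case False
  assume l: "cmod l < 1"
  have "1 - cnj l * z \<noteq> 0" if "z \<in> ball 0 1" for z
  proof
    assume "1 - cnj l * z = 0"
    then have "cmod l * cmod z = 1" by (metis complex_mod_cnj eq_iff_diff_eq_0 norm_mult norm_one)
    moreover have "cmod l * cmod z < 1 * 1" using l that by (intro mult_strict_mono') auto
    ultimately show False by simp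
  qed
  then show ?thesis using False unfolding bfac_def[abs_def] by (auto intro!: holomorphic_intros)
qed (simp add: bfac_def[abs_def])

section \<open>The infinite product and its tails\<close>

definition ulim :: "(nat \<Rightarrow> complex) \<Rightarrow> sq" where
  "ulim lam = tcoef (bprod lam)"

text \<open>Taylor coefficients at 0 depend on a neighbourhood of 0 only, so uniform convergence on
  the disc of radius 1/2 is enough. It follows from the M-test with the Blaschke sum, and the limit
  is \<open>bprod lam\<close> because that is the pointwise limit.\<close>

lemma ucoef_tendsto:
  assumes "infinite_blaschke lam"
  shows "(\<lambda>n. ucoef lam n k) \<longlonglongrightarrow> ulim lam k"
proof -
  have l: "cmod (lam k) < 1" for k using assms by (auto simp: infinite_blaschke_def)
  let ?A = "cball 0 (1/2) :: complex set"
  have sub: "?A \<subseteq> ball 0 1" by auto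
  have "uniformly_convergent_on ?A (\<lambda>N z. \<Prod>k<N. bfac (lam k) z)"
  proof (rule uniformly_convergent_on_prod')
    show "continuous_on ?A (bfac (lam k))" for k
      using holomorphic_on_imp_continuous_on[OF bfac_holomorphic[OF l]] sub continuous_on_subset by blast
    have "uniform_limit ?A (\<lambda>N z. \<Sum>k<N. cmod (bfac (lam k) z - 1)) (\<lambda>z. \<Sum>k. cmod (bfac (lam k) z - 1)) sequentially"
    proof (rule Weierstrass_m_test)
      show "summable (\<lambda>k. 3 * (1 - cmod (lam k)))"
        using assms by (intro summable_mult) (auto simp: infinite_blaschke_def)
      show "norm (cmod (bfac (lam k) z - 1)) \<le> 3 * (1 - cmod (lam k))" if "z \<in> ?A" for k z
        using bfac_minus_1_le[OF l, of z k] that by simp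
    qed
    then show "uniformly_convergent_on ?A (\<lambda>N z. \<Sum>k<N. norm (bfac (lam k) z - 1))"
      by (auto simp: uniformly_convergent_on_def)
  qed simp
  then have "uniform_limit ?A (bpart lam) (bprod lam) sequentially"
    unfolding uniformly_convergent_uniform_limit_iff bpart_def[abs_def] bprod_def[abs_def] .
  then have "uniform_limit (ball 0 (1/2)) (bpart lam) (bprod lam) sequentially"
    by (rule uniform_limit_on_subset) (rule ball_subset_cball)
  moreover have "bpart lam n holomorphic_on ball 0 (1/2)" for n
    unfolding bpart_def[abs_def]
    by (intro holomorphic_on_prod holomorphic_on_subset[OF bfac_holomorphic[OF l]] subset_ball) simp
  ultimately have "(\<lambda>n. (deriv ^^ k) (bpart lam n) 0) \<longlonglongrightarrow> (deriv ^^ k) (bprod lam) 0"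
    by (intro higher_deriv_complex_uniform_limit[where A = "ball 0 (1/2)"] always_eventually allI) simp_all
  then show ?thesis unfolding ucoef_def ulim_def tcoef_def by (intro tendsto_divide) auto
qed

lemma infinite_blaschke_shift:
  assumes "infinite_blaschke lam"
  shows "infinite_blaschke (\<lambda>k. lam (k + n))"
  using assms summable_ignore_initial_segment[of "\<lambda>k. 1 - cmod (lam k)" n]
  by (simp add: infinite_blaschke_def)

lemma infinite_blaschke_less_1: "infinite_blaschke lam \<Longrightarrow> cmod (lam k) < 1"
  by (simp add: infinite_blaschke_def)

lemma contr_ulim:
  assumes "infinite_blaschke lam"
  shows "contr (ulim lam)"
  by (rule contr_limit[OF _ ucoef_tendsto[OF assms]])
    (rule isom_contr[OF isom_ucoef], rule infinite_blaschke_less_1[OF assms])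

lemma ulim_split:
  assumes "infinite_blaschke lam"
  shows "ulim lam = conv (ucoef lam n) (ulim (\<lambda>k. lam (k + n)))"
proof
  fix i
  have "(\<lambda>m. ucoef lam (n + m) i) \<longlonglongrightarrow> ulim lam i"
    using LIMSEQ_ignore_initial_segment[OF ucoef_tendsto[OF assms], of n i] by (simp add: add.commute)
  moreover have "(\<lambda>m. ucoef lam (n + m) i) \<longlonglongrightarrow> conv (ucoef lam n) (ulim (\<lambda>k. lam (k + n))) i"
    unfolding ucoef_add[OF infinite_blaschke_less_1[OF assms]] conv_def
    by (intro tendsto_intros ucoef_tendsto infinite_blaschke_shift assms)
  ultimately show "ulim lam i = conv (ucoef lam n) (ulim (\<lambda>k. lam (k + n))) i"
    by (rule LIMSEQ_unique)
qed

text \<open>The product of the 1 - a_k is at least 1 minus the sum of the a_k, and late blocks of a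
  convergent series are small whatever their length \<open>n\<close>.\<close>

lemma prod_lower_bound:
  assumes "infinite_blaschke lam" "0 < e"
  shows "\<exists>N. \<forall>m\<ge>N. \<forall>n. 1 - e \<le> (\<Prod>k<n. cmod (lam (k + m)))"
proof -
  let ?f = "\<lambda>k. 1 - cmod (lam k)"
  have s: "summable ?f" using assms by (simp add: infinite_blaschke_def)
  obtain N where N: "\<And>m n. m \<ge> N \<Longrightarrow> norm (sum ?f {m..<n}) < e"
    using s assms(2) unfolding summable_Cauchy by blast
  have "1 - e \<le> (\<Prod>k<n. cmod (lam (k + m)))" if "N \<le> m" for m n
  proof -
    have "(\<Sum>k<n. ?f (k + m)) = sum ?f {m..<n + m}"
      using sum.shift_bounds_nat_ivl[of ?f 0 m n] by (simp add: atLeast0LessThan)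
    then have "(\<Sum>k<n. ?f (k + m)) < e" using N[OF that, of "n + m"] by simp
    moreover have "1 - (\<Sum>k<n. ?f (k + m)) \<le> (\<Prod>k<n. 1 - ?f (k + m))"
      using infinite_blaschke_less_1[OF assms(1)] by (intro Weierstrass_prod_ineq) (auto intro: less_imp_le)
    ultimately show ?thesis by simp
  qed
  then show ?thesis by blast
qed

text \<open>Coefficientwise limits of inner symbols may vanish; the Blaschke condition prevents it.
  A late enough tail has modulus at least 1/2 at 0, the finite head is nonzero, and power series
  have no zero divisors.\<close>

lemma ulim_nonzero:
  assumes "infinite_blaschke lam"
  shows "ulim lam \<noteq> (\<lambda>i. 0)"
proof -
  obtain N where N: "\<And>n. 1 - 1/2 \<le> (\<Prod>k<n. cmod (lam (k + N)))"
    using prod_lower_bound[OF assms, of "1/2"] by auto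
  let ?v = "ulim (\<lambda>k. lam (k + N))"
  have "1/2 \<le> cmod (?v 0)"
  proof (rule LIMSEQ_le_const)
    show "(\<lambda>n. cmod (ucoef (\<lambda>k. lam (k + N)) n 0)) \<longlonglongrightarrow> cmod (?v 0)"
      by (intro tendsto_norm ucoef_tendsto infinite_blaschke_shift assms)
    show "\<exists>M. \<forall>n\<ge>M. 1/2 \<le> cmod (ucoef (\<lambda>k. lam (k + N)) n 0)"
      using N by (auto simp: ucoef_at_0 prod_norm abs_of_nonneg prod_nonneg simp del: of_real_prod)
  qed
  then have "?v \<noteq> (\<lambda>i. 0)" by auto
  moreover have "ucoef lam N \<noteq> (\<lambda>i. 0)"
    using isom_nonzero[OF isom_ucoef] infinite_blaschke_less_1[OF assms] by blast
  ultimately show ?thesis using ulim_split[OF assms, of N] by (simp add: conv_eq_0_iff)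
qed

section \<open>The filtration of a model space\<close>

text \<open>Provides span and independence for the finite-dimensional step. Vector addition is the
  pointwise one for functions.\<close>

interpretation sqv: vector_space "\<lambda>(c::complex) (x::sq) i. c * x i"
  by unfold_locales (auto simp: fun_eq_iff algebra_simps)

context
  fixes lam :: "nat \<Rightarrow> complex"
  assumes ib: "infinite_blaschke lam"
begin

lemma isom_u: "isom (ucoef lam n)"
  by (rule isom_ucoef) (rule infinite_blaschke_less_1[OF ib])

lemma contr_u: "contr (ucoef lam n)"
  by (rule isom_contr[OF isom_u])

lemma Pn_eq: "Pn lam n = Pc (ucoef lam n)"
  by (simp add: Pn_def Pin_eq ucoef_def)

text \<open>As kernels of adjoints, the spaces \<open>Kn lam n\<close> and \<open>Ku lam\<close> are
  nested because the adjoint of a product is a composition of adjoints.\<close>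

lemma Ku_iff: "x \<in> Ku lam \<longleftrightarrow> x \<in> l2 \<and> convadj (ulim lam) x = (\<lambda>i. 0)"
  using Pc_fix_iff[OF ulim_nonzero[OF ib], of x] by (auto simp: Ku_def Kin_def Pin_eq ulim_def)

lemma Kn_iff: "x \<in> Kn lam n \<longleftrightarrow> x \<in> l2 \<and> convadj (ucoef lam n) x = (\<lambda>i. 0)"
  using Pc_fix_iff[OF isom_nonzero[OF isom_u], of n x] by (auto simp: Kn_def Kin_def Pin_eq ucoef_def)

lemma Pn_fix: "x \<in> Kn lam n \<Longrightarrow> Pn lam n x = x"
  by (simp add: Kn_def Kin_def Pn_def)

lemma Kn_l2: "x \<in> Kn lam n \<Longrightarrow> x \<in> l2"
  by (simp add: Kn_iff)

lemma Ku_l2: "x \<in> Ku lam \<Longrightarrow> x \<in> l2"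
  by (simp add: Ku_iff)

lemma Kn_Ku: "x \<in> Kn lam n \<Longrightarrow> x \<in> Ku lam"
  unfolding Kn_iff Ku_iff ulim_split[OF ib, of n]
  using convadj_conv_eq_0[OF contr_u contr_ulim[OF infinite_blaschke_shift[OF ib]]] by blast

lemma isom_ucoef_shift: "isom (ucoef (\<lambda>k. lam (k + n)) m)"
  by (rule isom_ucoef) (rule infinite_blaschke_less_1[OF ib])

lemma contr_ucoef_shift: "contr (ucoef (\<lambda>k. lam (k + n)) m)"
  by (rule isom_contr[OF isom_ucoef_shift])

lemma ucoef_split:
  assumes "m \<le> n"
  shows "ucoef lam n = conv (ucoef lam m) (ucoef (\<lambda>k. lam (k + m)) (n - m))"
  using ucoef_add[of lam m "n - m", OF infinite_blaschke_less_1[OF ib]] assms by simp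

lemma Kn_mono: "m \<le> n \<Longrightarrow> x \<in> Kn lam m \<Longrightarrow> x \<in> Kn lam n"
  unfolding Kn_iff ucoef_split using convadj_conv_eq_0[OF contr_u contr_ucoef_shift] by blast

lemma Pn_Kn: "x \<in> l2 \<Longrightarrow> Pn lam n x \<in> Kn lam n"
  by (simp add: Kn_iff Pn_eq convadj_Pc isom_u Pc_l2 contr_u)

lemma Pn_l2: "x \<in> l2 \<Longrightarrow> Pn lam n x \<in> l2"
  using Pn_Kn Kn_l2 by blast

lemma Pn_le: "x \<in> l2 \<Longrightarrow> l2norm (Pn lam n x) \<le> 2 * l2norm x"
  by (simp add: Pn_eq Pc_le contr_u)

lemma Pn_lin: "x \<in> l2 \<Longrightarrow> y \<in> l2 \<Longrightarrow> Pn lam n (\<lambda>i. a * x i + y i) = (\<lambda>i. a * Pn lam n x i + Pn lam n y i)"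
  unfolding Pn_eq by (rule Pc_lin[OF contr_u])

lemma Pn_add: "x \<in> l2 \<Longrightarrow> y \<in> l2 \<Longrightarrow> Pn lam n (\<lambda>i. x i + y i) = (\<lambda>i. Pn lam n x i + Pn lam n y i)"
  using Pn_lin[of x y n 1] by simp

lemma Pn_diff: "x \<in> l2 \<Longrightarrow> y \<in> l2 \<Longrightarrow> Pn lam n (\<lambda>i. x i - y i) = (\<lambda>i. Pn lam n x i - Pn lam n y i)"
  unfolding Pn_eq by (rule Pc_diff[OF contr_u])

lemma Pn_zero [simp]: "Pn lam n (\<lambda>i. 0) = (\<lambda>i. 0)"
  by (simp add: Pn_eq Pc_def)

lemma Pin_bprod_l2: "x \<in> l2 \<Longrightarrow> Pin (bprod lam) x \<in> l2"
  unfolding Pin_eq ulim_def[symmetric] by (rule Pc_l2[OF contr_ulim[OF ib]])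

text \<open>Compressing to \<open>Kn lam n\<close> hides the projection onto \<open>Ku lam\<close>,
  so the Toeplitz part of a generator becomes \<open>Pn lam n\<close> applied to a plain Toeplitz
  operator.\<close>

lemma Pn_Pin_bprod:
  assumes "x \<in> l2"
  shows "Pn lam n (Pin (bprod lam) x) = Pn lam n x"
  unfolding Pin_eq ulim_def[symmetric] Pn_eq
  by (subst ulim_split[OF ib, of n])
    (rule Pc_Pc_conv[OF isom_u contr_ulim[OF infinite_blaschke_shift[OF ib]] assms])

lemma Pn_Pm: "m \<le> n \<Longrightarrow> x \<in> l2 \<Longrightarrow> Pn lam n (Pn lam m x) = Pn lam m x"
  by (intro Pn_fix Kn_mono[of m n] Pn_Kn)

lemma Kn_lin: "x \<in> Kn lam n \<Longrightarrow> y \<in> Kn lam n \<Longrightarrow> (\<lambda>i. c * x i + y i) \<in> Kn lam n"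
  by (auto simp: Kn_iff convadj_lin[OF contr_l2[OF contr_u]])

lemma Ku_lin: "x \<in> Ku lam \<Longrightarrow> y \<in> Ku lam \<Longrightarrow> (\<lambda>i. c * x i + y i) \<in> Ku lam"
  by (auto simp: Ku_iff convadj_lin[OF contr_l2[OF contr_ulim[OF ib]]])

lemma zero_Kn [simp]: "(\<lambda>i. 0) \<in> Kn lam n"
  by (simp add: Kn_iff)

lemma zero_Ku [simp]: "(\<lambda>i. 0) \<in> Ku lam"
  by (simp add: Ku_iff)

text \<open>The difference x - Pn x is u_n g_n, where g_n is the adjoint of multiplication by u_n
  applied to x, and it has the norm of g_n. The g_n tend to the corresponding vector for u, which is
  0 as x is in \<open>Ku lam\<close>.\<close>

lemma Pn_tendsto:
  assumes "x \<in> Ku lam"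
  shows "(\<lambda>n. l2dist (Pn lam n x) x) \<longlonglongrightarrow> 0"
proof -
  have x: "x \<in> l2" and z: "convadj (ulim lam) x = (\<lambda>i. 0)" using assms by (auto simp: Ku_iff)
  have "l2dist (Pn lam n x) x = l2dist (convadj (ucoef lam n) x) (convadj (ulim lam) x)" for n
  proof -
    have "l2dist (Pn lam n x) x = l2dist x (Pn lam n x)" by (rule l2dist_commute)
    also have "\<dots> = l2norm (conv (ucoef lam n) (convadj (ucoef lam n) x))"
      by (simp add: l2dist_def Pn_eq Pc_def)
    also have "\<dots> = l2norm (convadj (ucoef lam n) x)"
      by (rule isomD[OF isom_u convadj_l2[OF contr_u x]])
    finally show ?thesis by (simp add: z l2dist_def)
  qed
  then show ?thesis
    using convadj_strong_limit[of "ulim lam" "ucoef lam", OF contr_ulim[OF ib] contr_u ucoef_tendsto[OF ib] x]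
    by simp
qed

lemma Ku_closed:
  assumes X: "\<And>n. X n \<in> Ku lam" and y: "y \<in> l2" and lim: "(\<lambda>n. l2dist (X n) y) \<longlonglongrightarrow> 0"
  shows "y \<in> Ku lam"
proof -
  let ?u = "ulim lam"
  have c: "contr ?u" by (rule contr_ulim[OF ib])
  have le: "l2norm (convadj ?u y) \<le> l2dist (X n) y" for n
  proof -
    have Xn: "X n \<in> l2" "convadj ?u (X n) = (\<lambda>i. 0)" using X by (auto simp: Ku_iff)
    have "convadj ?u (\<lambda>i. y i - X n i) = convadj ?u y"
      using convadj_diff[OF contr_l2[OF c] y Xn(1)] Xn(2) by simp
    then have "l2norm (convadj ?u y) \<le> l2norm (\<lambda>i. y i - X n i)"
      using convadj_le[OF c, of "\<lambda>i. y i - X n i"] y Xn by auto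
    then show ?thesis by (simp add: l2dist_def[symmetric] l2dist_commute)
  qed
  have "l2norm (convadj ?u y) \<le> 0"
    by (rule LIMSEQ_le_const[OF lim]) (use le in blast)
  then have "l2norm (convadj ?u y) = 0"
    using l2norm_nonneg[OF convadj_l2[OF c y]] by simp
  then show ?thesis using l2norm_eq_0_iff[OF convadj_l2[OF c y]] y by (simp add: Ku_iff)
qed

text \<open>A vector of the next space is its projection to \<open>Kn lam n\<close> plus u_n g,
  where g is annihilated by the adjoint of the next Blaschke factor and so lies on a line. Repeated
  zeros are covered.\<close>

lemma Kn_span: "\<exists>T. finite T \<and> Kn lam n \<subseteq> sqv.span T"
proof (induction n)
  case 0
  have "x = (\<lambda>i. 0)" if "x \<in> Kn lam 0" for x
  proof -
    have "x i = convadj (ebasis 0) x i" for i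
      unfolding convadj_def by (subst suminf_finite[of "{0}"]) (auto simp: ebasis_def)
    then show ?thesis using that by (simp add: Kn_iff ucoef_0 fun_eq_iff)
  qed
  then have "Kn lam 0 \<subseteq> sqv.span {}" by (auto simp: zero_fun_def)
  then show ?case by blast
next
  case (Suc n)
  then obtain T where T: "finite T" "Kn lam n \<subseteq> sqv.span T" by blast
  \<comment> \<open>The unnormalised Takenaka-Malmquist vector u_n / (1 - cnj (lam n) * z).\<close>
  let ?k = "conv (ucoef lam n) (\<lambda>i. cnj (lam n) ^ i)"
  have "x \<in> sqv.span (insert ?k T)" if "x \<in> Kn lam (Suc n)" for x
  proof -
    have x: "x \<in> l2" and z: "convadj (ucoef lam (Suc n)) x = (\<lambda>i. 0)" using that by (auto simp: Kn_iff)
    have l1: "cmod (lam n) < 1" by (rule infinite_blaschke_less_1[OF ib])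
    let ?g = "convadj (ucoef lam n) x"
    have "convadj (tcoef (bfac (lam n))) ?g = (\<lambda>i. 0)"
      using convadj_comp[OF contr_u isom_contr[OF isom_bfac[OF l1]] x, of n] z
      by (simp add: ucoef_Suc[OF infinite_blaschke_less_1[OF ib]])
    then have g: "?g = (\<lambda>i. ?g 0 * cnj (lam n) ^ i)"
      by (rule convadj_bfac_eq_0[OF l1 convadj_l2[OF contr_u x]])
    have "x = (\<lambda>i. conv (ucoef lam n) ?g i + Pn lam n x i)"
      by (simp add: Pn_eq Pc_def)
    also have "conv (ucoef lam n) ?g = (\<lambda>i. ?g 0 * ?k i)"
      by (subst g) (use conv_lin[of "ucoef lam n" "?g 0" "\<lambda>i. cnj (lam n) ^ i" "\<lambda>i. 0"] in simp)
    finally have "x = (\<lambda>i. ?g 0 * ?k i) + Pn lam n x" by (simp add: plus_fun_def)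
    moreover have "Pn lam n x \<in> sqv.span (insert ?k T)"
      using T(2) Pn_Kn[OF x, of n] sqv.span_mono[of T "insert ?k T"] by blast
    moreover have "(\<lambda>i. ?g 0 * ?k i) \<in> sqv.span (insert ?k T)"
      by (intro sqv.span_scale sqv.span_base) simp
    ultimately show ?thesis using sqv.span_add by metis
  qed
  then show ?case using T(1) by (intro exI[of _ "insert ?k T"]) auto
qed

text \<open>The part of x outside \<open>Kn lam n\<close> is a multiple of u_n; shifting keeps it
  one, and \<open>Pn\<close> removes it. Hence compressions of powers of the shift are powers of the
  compressed shift.\<close>

lemma Pn_sh_Pn:
  assumes "x \<in> l2"
  shows "Pn lam n (sh (Pn lam n x)) = Pn lam n (sh x)"
proof -
  let ?c = "ucoef lam n" and ?g = "convadj (ucoef lam n) x"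
  have g: "?g \<in> l2" using convadj_l2[OF contr_u assms] .
  have s: "contr (ebasis 1)" by (rule isom_contr[OF isom_sh])
  have "Pn lam n (sh (Pn lam n x)) = (\<lambda>i. Pn lam n (sh x) i - Pn lam n (sh (conv ?c ?g)) i)"
    unfolding Pn_eq[of n] Pc_def[of ?c x] conv_diff using s assms g
    by (intro Pc_diff contrD contr_u)
  also have "sh (conv ?c ?g) = conv ?c (sh ?g)"
    by (metis conv_assoc conv_commute)
  also have "Pn lam n (conv ?c (sh ?g)) = (\<lambda>i. 0)"
    unfolding Pn_eq using g s by (intro Pc_conv isom_u contrD)
  finally show ?thesis by simp
qed

text \<open>For \<open>x\<close> in the m-th space, \<open>sh x\<close> leaves it only in the direction of the partial product
  \<open>u_m\<close>, and the n-th space barely sees this direction, as \<open>u_n / u_m\<close> is almost unimodular at 0.\<close>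

lemma sh_estimate:
  assumes "0 < e"
  shows "\<exists>N. \<forall>m\<ge>N. \<forall>n\<ge>m. \<forall>x\<in>Kn lam m.
    l2norm (\<lambda>i. Pn lam n (sh x) i - Pn lam m (sh x) i) \<le> e * l2norm x"
proof -
  \<comment> \<open>Chosen so that the squared norm 1 - p^2 with p >= 1 - d is at most 2 * d <= e^2;
    d <= 1 keeps 1 - d nonnegative, so that squares can be compared.\<close>
  define d where "d = min 1 (e\<^sup>2 / 2)"
  have d: "0 < d" "d \<le> 1" "2 * d \<le> e\<^sup>2" using assms by (auto simp: d_def)
  obtain N where N: "\<And>m n. m \<ge> N \<Longrightarrow> 1 - d \<le> (\<Prod>k<n. cmod (lam (k + m)))"
    using prod_lower_bound[OF ib d(1)] by blast
  have "l2norm (\<lambda>i. Pn lam n (sh x) i - Pn lam m (sh x) i) \<le> e * l2norm x"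
    if m: "N \<le> m" and n: "m \<le> n" and x: "x \<in> Kn lam m" for m n x
  proof -
    let ?c = "ucoef lam m" and ?w = "ucoef (\<lambda>k. lam (k + m)) (n - m)"
    have xl: "x \<in> l2" and x0: "convadj ?c x = (\<lambda>i. 0)" using x by (auto simp: Kn_iff)
    have s: "contr (ebasis 1)" by (rule isom_contr[OF isom_sh])
    have y: "sh x \<in> l2" by (rule contrD(1)[OF s xl])
    let ?g = "convadj ?c (sh x)"
    \<comment> \<open>Removing the first entry undoes the shift, and the adjoint vanishes on x; only
      the entry at 0 can survive.\<close>
    have gS: "?g (Suc i) = 0" for i
    proof -
      have "?g (Suc i) = convadj ?c x i" unfolding convadj_def by (simp add: sh_apply[unfolded One_nat_def])
      then show ?thesis by (simp add: x0)
    qed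
    have g: "?g = (\<lambda>i. ?g 0 * ebasis 0 i)"
    proof
      fix i show "?g i = ?g 0 * ebasis 0 i" using gS by (cases i) (auto simp: ebasis_def)
    qed
    have cg: "conv ?c ?g = (\<lambda>i. ?g 0 * ?c i)"
      by (subst g) (use conv_lin[of ?c "?g 0" "ebasis 0" "\<lambda>i. 0"] in \<open>simp add: conv_ebasis_0\<close>)
    have gle: "cmod (?g 0) \<le> l2norm x"
      using cmod_le_l2norm[OF convadj_l2[OF contr_u y], of m 0] convadj_le[OF contr_u y, of m]
        isomD[OF isom_sh xl] by simp
    have c2: "?c \<in> l2" by (rule contr_l2[OF contr_u])
    have "(\<lambda>i. Pn lam n (sh x) i - Pn lam m (sh x) i) = Pn lam n (\<lambda>i. sh x i - Pn lam m (sh x) i)"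
      using Pn_diff[OF y Pn_l2[OF y], of n m] Pn_Pm[OF n y] by simp
    also have "(\<lambda>i. sh x i - Pn lam m (sh x) i) = (\<lambda>i. ?g 0 * ?c i)"
      unfolding Pn_eq Pc_def cg by simp
    also have "Pn lam n \<dots> = (\<lambda>i. ?g 0 * Pn lam n ?c i)"
      using Pn_lin[OF c2 l2_zero, of n "?g 0"] by simp
    finally have "l2norm (\<lambda>i. Pn lam n (sh x) i - Pn lam m (sh x) i) = cmod (?g 0) * l2norm (Pn lam n ?c)"
      using l2norm_scale[OF Pn_l2[OF c2]] by simp
    also have "\<dots> \<le> l2norm x * e"
    proof (rule mult_mono[OF gle])
      let ?p = "\<Prod>k<n - m. cmod (lam (k + m))"
      have p: "1 - d \<le> ?p" by (rule N[OF m])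
      have "(l2norm (Pn lam n ?c))\<^sup>2 = 1 - (cmod (?w 0))\<^sup>2"
        unfolding Pn_eq ucoef_split[OF n] by (rule Pc_conv_self[OF isom_u isom_ucoef_shift])
      also have "cmod (?w 0) = ?p" unfolding ucoef_at_0 norm_of_real by (simp add: prod_nonneg)
      also have "1 - ?p\<^sup>2 \<le> 1 - (1 - d)\<^sup>2" using p d(2) by (intro diff_left_mono power_mono) auto
      also have "\<dots> \<le> 2 * d" by (simp add: power2_eq_square algebra_simps)
      also have "\<dots> \<le> e\<^sup>2" by (rule d(3))
      finally show "l2norm (Pn lam n ?c) \<le> e" using assms by (auto intro: power2_le_imp_le)
    qed (use l2norm_nonneg[OF xl] l2norm_nonneg[OF Pn_l2[OF c2]] in auto)
    finally show ?thesis by (simp add: mult.commute)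
  qed
  then show ?thesis by blast
qed

text \<open>Strong convergence of uniformly bounded operators is uniform on relatively compact sets,
  here the image under \<open>K\<close> of the unit ball. The argument is by contradiction since
  \<open>cpt_op\<close> is given through sequences.\<close>

lemma cpt_estimate:
  assumes K: "cpt_op (Ku lam) K" and e: "0 < e"
  shows "\<exists>N. \<forall>m\<ge>N. \<forall>x\<in>Kn lam m. l2dist (Pn lam m (K x)) (K x) \<le> e * l2norm x"
proof (rule ccontr)
  assume "\<not> ?thesis"
  then have "\<forall>N. \<exists>m x. N \<le> m \<and> x \<in> Kn lam m \<and> e * l2norm x < l2dist (Pn lam m (K x)) (K x)"
    by (auto simp: not_le Bex_def)
  then obtain M Y where MY: "\<And>N. N \<le> M N" "\<And>N. Y N \<in> Kn lam (M N)"
      "\<And>N. e * l2norm (Y N) < l2dist (Pn lam (M N) (K (Y N))) (K (Y N))"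
    by metis
  have b: "bop (Ku lam) K" using K by (simp add: cpt_op_def)
  then have lin: "K (\<lambda>i. c * x i + y i) = (\<lambda>i. c * K x i + K y i)" if "x \<in> Ku lam" "y \<in> Ku lam" for x y c
    using that by (auto simp: bop_def)
  have Kl: "x \<in> Ku lam \<Longrightarrow> K x \<in> l2" for x using b Ku_l2 by (auto simp: bop_def)
  have K0: "K (\<lambda>i. 0) = (\<lambda>i. 0)"
    using lin[of "\<lambda>i. 0" "\<lambda>i. 0" "-1"] by (simp add: fun_eq_iff)
  have Yn0: "l2norm (Y N) > 0" for N
  proof (rule ccontr)
    assume "\<not> 0 < l2norm (Y N)"
    then have "Y N = (\<lambda>i. 0)"
      using l2norm_nonneg[OF Kn_l2[OF MY(2)], of N] l2norm_eq_0_iff[OF Kn_l2[OF MY(2)], of N] by auto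
    then show False using MY(3)[of N] by (simp add: K0 l2dist_def)
  qed
  define Z where "Z N = (\<lambda>i. of_real (1 / l2norm (Y N)) * Y N i)" for N
  have Zn: "l2norm (Z N) = 1" for N
    unfolding Z_def using l2norm_scale[OF Kn_l2[OF MY(2)], of "of_real (1 / l2norm (Y N))" N] Yn0[of N]
    by (simp add: norm_divide)
  have YK: "Y N \<in> Ku lam" for N by (rule Kn_Ku[OF MY(2)])
  have ZK: "Z N \<in> Ku lam" for N unfolding Z_def using Ku_lin[OF YK[of N] zero_Ku, of "of_real (1 / l2norm (Y N))"] by simp
  have Zbig: "e < l2dist (Pn lam (M N) (K (Z N))) (K (Z N))" for N
  proof -
    let ?a = "complex_of_real (1 / l2norm (Y N))"
    have KZ: "K (Z N) = (\<lambda>i. ?a * K (Y N) i)"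
      unfolding Z_def using lin[OF YK zero_Ku, of ?a] K0 by simp
    have "Pn lam (M N) (K (Z N)) = (\<lambda>i. ?a * Pn lam (M N) (K (Y N)) i)"
      unfolding KZ using Pn_lin[OF Kl[OF YK[of N]] l2_zero, of "M N" ?a] by simp
    then have "l2dist (Pn lam (M N) (K (Z N))) (K (Z N))
        = l2norm (\<lambda>i. ?a * (Pn lam (M N) (K (Y N)) i - K (Y N) i))"
      by (simp add: l2dist_def KZ algebra_simps)
    also have "\<dots> = cmod ?a * l2dist (Pn lam (M N) (K (Y N))) (K (Y N))"
      unfolding l2dist_def by (intro l2norm_scale l2_diff Pn_l2 Kl YK)
    also have "\<dots> = l2dist (Pn lam (M N) (K (Y N))) (K (Y N)) / l2norm (Y N)"
      using Yn0[of N] by (simp add: norm_divide)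
    finally show ?thesis using MY(3)[of N] Yn0[of N] by (simp add: pos_less_divide_eq)
  qed
  obtain r y where r: "strict_mono r" "y \<in> l2" "(\<lambda>n. l2dist (K (Z (r n))) y) \<longlonglongrightarrow> 0"
    using K ZK Zn unfolding cpt_op_def by (metis order_refl)
  have KZu: "K (Z N) \<in> Ku lam" for N using ZK b by (simp add: bop_def)
  then have yK: "y \<in> Ku lam" using Ku_closed[of "\<lambda>n. K (Z (r n))"] r by auto
  \<comment> \<open>The indices \<open>M (r n)\<close> need not increase, but they are at least
    \<open>r n\<close>, so the strong convergence can be evaluated along them.\<close>
  have Mlim: "filterlim (\<lambda>n. M (r n)) at_top sequentially"
  proof (rule filterlim_at_top_mono[OF filterlim_subseq[OF r(1)]])
    show "\<forall>\<^sub>F n in sequentially. r n \<le> M (r n)" using MY(1) by simp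
  qed
  have lim2: "(\<lambda>n. l2dist (Pn lam (M (r n)) y) y) \<longlonglongrightarrow> 0"
    using filterlim_compose[OF Pn_tendsto[OF yK] Mlim] .
  \<comment> \<open>The factor 3 is 2 from the bound on \<open>Pn\<close> plus 1 from the direct
    distance.\<close>
  have le: "l2dist (Pn lam (M (r n)) (K (Z (r n)))) (K (Z (r n)))
      \<le> 3 * l2dist (K (Z (r n))) y + l2dist (Pn lam (M (r n)) y) y" for n
  proof -
    let ?k = "K (Z (r n))" and ?P = "Pn lam (M (r n))"
    have k: "?k \<in> l2" by (rule Kl[OF ZK])
    have "l2dist (?P ?k) (?P y) = l2norm (?P (\<lambda>i. ?k i - y i))"
      unfolding l2dist_def using Pn_diff[OF k r(2)] by simp
    also have "\<dots> \<le> 2 * l2dist ?k y" unfolding l2dist_def using k r(2) by (intro Pn_le l2_diff)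
    finally show ?thesis
      using l2dist_triangle[OF Pn_l2[OF k] Pn_l2[OF r(2)] k, of "M (r n)" "M (r n)"]
        l2dist_triangle[OF Pn_l2[OF r(2)] r(2) k, of "M (r n)"] by (simp add: l2dist_commute[of y])
  qed
  have "(\<lambda>n. 3 * l2dist (K (Z (r n))) y + l2dist (Pn lam (M (r n)) y) y) \<longlonglongrightarrow> 3 * 0 + 0"
    by (intro tendsto_intros r lim2)
  moreover have "\<exists>N. \<forall>n\<ge>N. e \<le> 3 * l2dist (K (Z (r n))) y + l2dist (Pn lam (M (r n)) y) y"
    using le Zbig by (meson less_imp_le order_trans)
  ultimately have "e \<le> 3 * 0 + 0" by (rule LIMSEQ_le_const)
  then show False using e by simp
qed

end

section \<open>Toeplitz operators with continuous symbols\<close>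

definition csym :: "(complex \<Rightarrow> complex) \<Rightarrow> bool" where
  "csym a \<longleftrightarrow> continuous_on (sphere 0 1) a"

lemma csym_cis: "csym a \<Longrightarrow> continuous_on S (\<lambda>t. a (cis t))"
  unfolding csym_def
  by (erule continuous_on_compose2) (auto intro!: continuous_intros)

lemma fourier_has_integral:
  assumes "csym a"
  shows "((\<lambda>t. a (cis t) * cis (- (of_int k * t))) has_integral (2 * pi * fourier a k)) {0..2*pi}"
proof -
  have "(\<lambda>t. a (cis t) * cis (- (of_int k * t))) integrable_on {0..2*pi}"
    by (intro integrable_continuous_interval continuous_intros csym_cis assms)
  then show ?thesis by (simp add: fourier_def has_integral_integral)
qed

lemma integral_cis:
  "((\<lambda>t. cis (of_int m * t)) has_integral (if m = 0 then 2 * pi else 0)) {0..2*pi}"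
proof (cases "m = 0")
  case True
  then show ?thesis
    using has_integral_const_real[of "1 :: complex" 0 "2*pi"] by (simp add: scaleR_conv_of_real)
next
  case False
  let ?F = "\<lambda>t::real. exp (\<i> * of_int m * of_real t) / (\<i> * of_int m)"
  have "((\<lambda>t. exp (\<i> * of_int m * of_real t)) has_integral (?F (2*pi) - ?F 0)) {0..2*pi}"
  proof (rule fundamental_theorem_of_calculus)
    fix t :: real
    show "(?F has_vector_derivative exp (\<i> * of_int m * of_real t)) (at t within {0..2*pi})"
    proof (rule has_vector_derivative_real_field)
      show "((\<lambda>z. exp (\<i> * of_int m * z) / (\<i> * of_int m)) has_field_derivative exp (\<i> * of_int m * of_real t)) (at (of_real t))"
        using False by (auto intro!: derivative_eq_intros)
    qed
  qed simp
  then have I: "((\<lambda>t. exp (\<i> * of_int m * of_real t)) has_integral (?F (2*pi) - ?F 0)) {0..2*pi}" .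
  have e: "exp (\<i> * of_int m * of_real t) = cis (of_int m * t)" for t
    by (simp add: cis_conv_exp mult_ac)
  have "cis (of_int m * (2 * pi)) = 1"
    using cis_multiple_2pi[of "of_int m"] by (simp add: mult_ac)
  then have "?F (2*pi) - ?F 0 = 0" unfolding e by simp
  then show ?thesis using False I unfolding e by simp
qed

lemma fourier_powi: "fourier (\<lambda>z. z powi k) j = (if j = k then 1 else 0)"
proof -
  have "cis t powi k * cis (- (of_int j * t)) = cis (of_int (k - j) * t)" for t
    by (simp add: cis_power_int cis_mult algebra_simps)
  then have "integral {0..2*pi} (\<lambda>t. cis t powi k * cis (- (of_int j * t))) = (if k - j = 0 then 2 * pi else 0)"
    using integral_unique[OF integral_cis[of "k - j"]] by simp
  then show ?thesis by (simp add: fourier_def)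
qed

lemma csym_lin: "csym a \<Longrightarrow> csym b \<Longrightarrow> csym (\<lambda>z. c * a z + b z)"
  unfolding csym_def by (intro continuous_intros)

lemma csym_powi: "csym (\<lambda>z. z powi k)"
  unfolding csym_def by (intro continuous_intros) auto

lemma fourier_lin:
  assumes "csym a" "csym b"
  shows "fourier (\<lambda>z. c * a z + b z) k = c * fourier a k + fourier b k"
proof -
  have "((\<lambda>t. c * (a (cis t) * cis (- (of_int k * t))) + b (cis t) * cis (- (of_int k * t)))
      has_integral (c * (2 * pi * fourier a k) + 2 * pi * fourier b k)) {0..2*pi}"
    by (intro has_integral_add has_integral_mult_right fourier_has_integral assms)
  then have "((\<lambda>t. (c * a (cis t) + b (cis t)) * cis (- (of_int k * t)))
      has_integral (2 * pi * (c * fourier a k + fourier b k))) {0..2*pi}"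
    by (simp add: algebra_simps)
  from integral_unique[OF this] show ?thesis by (simp add: fourier_def)
qed

section \<open>Sections of Toeplitz matrices as integrals over the circle\<close>

definition trigsum :: "nat \<Rightarrow> sq \<Rightarrow> real \<Rightarrow> complex" where
  "trigsum N x t = (\<Sum>j<N. x j * cis (of_nat j * t))"

text \<open>Links matrix entries to values of the symbol: the form of a section is the integral of
  the symbol against two trigonometric polynomials, so the sup norm of \<open>a\<close> can control
  the matrix.\<close>

lemma form_has_integral:
  assumes "csym a"
  shows "((\<lambda>t. a (cis t) * (trigsum N x t * cnj (trigsum N y t))) has_integral
    (2 * pi * (\<Sum>i<N. \<Sum>j<N. fourier a (int i - int j) * x j * cnj (y i)))) {0..2*pi}"
proof -
  have "((\<lambda>t. \<Sum>i<N. \<Sum>j<N. a (cis t) * cis (- (of_int (int i - int j) * t)) * (x j * cnj (y i))) has_integral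
    (\<Sum>i<N. \<Sum>j<N. 2 * pi * fourier a (int i - int j) * (x j * cnj (y i)))) {0..2*pi}"
    by (intro has_integral_sum has_integral_mult_left fourier_has_integral assms finite_lessThan)
  also have "(\<lambda>t. \<Sum>i<N. \<Sum>j<N. a (cis t) * cis (- (of_int (int i - int j) * t)) * (x j * cnj (y i)))
      = (\<lambda>t. a (cis t) * (trigsum N x t * cnj (trigsum N y t)))"
  proof
    fix t
    have "cis (- (of_int (int i - int j) * t)) = cis (of_nat j * t) * cnj (cis (of_nat i * t))" for i j
      by (simp add: cis_cnj cis_mult algebra_simps)
    then have "(\<Sum>i<N. \<Sum>j<N. a (cis t) * cis (- (of_int (int i - int j) * t)) * (x j * cnj (y i)))
        = (\<Sum>i<N. \<Sum>j<N. a (cis t) * ((x j * cis (of_nat j * t)) * cnj (y i * cis (of_nat i * t))))"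
      by (simp only: complex_cnj_mult mult_ac)
    also have "\<dots> = (\<Sum>j<N. \<Sum>i<N. a (cis t) * ((x j * cis (of_nat j * t)) * cnj (y i * cis (of_nat i * t))))"
      by (rule sum.swap)
    also have "\<dots> = a (cis t) * (trigsum N x t * cnj (trigsum N y t))"
      unfolding trigsum_def cnj_sum sum_product unfolding sum_distrib_left ..
    finally show "(\<Sum>i<N. \<Sum>j<N. a (cis t) * cis (- (of_int (int i - int j) * t)) * (x j * cnj (y i)))
        = a (cis t) * (trigsum N x t * cnj (trigsum N y t))" .
  qed
  also have "(\<Sum>i<N. \<Sum>j<N. 2 * pi * fourier a (int i - int j) * (x j * cnj (y i)))
      = 2 * pi * (\<Sum>i<N. \<Sum>j<N. fourier a (int i - int j) * x j * cnj (y i))"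
    by (simp add: sum_distrib_left mult.assoc)
  finally show ?thesis .
qed

lemma parseval_trigsum:
  "((\<lambda>t. (cmod (trigsum N x t))\<^sup>2) has_integral (2 * pi * (\<Sum>j<N. (cmod (x j))\<^sup>2))) {0..2*pi}"
proof -
  have "fourier (\<lambda>z. 1) k = (if k = 0 then 1 else 0)" for k
    using fourier_powi[of 0 k] by simp
  then have "(\<Sum>i<N. \<Sum>j<N. fourier (\<lambda>z. 1) (int i - int j) * x j * cnj (x i))
      = (\<Sum>i<N. \<Sum>j<N. if j = i then x j * cnj (x i) else 0)"
    by (intro sum.cong) auto
  also have "\<dots> = (\<Sum>i<N. x i * cnj (x i))" by (intro sum.cong) auto
  also have "\<dots> = of_real (\<Sum>j<N. (cmod (x j))\<^sup>2)" by (simp only: of_real_sum complex_norm_square)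
  finally have eq: "(\<Sum>i<N. \<Sum>j<N. fourier (\<lambda>z. 1) (int i - int j) * x j * cnj (x i))
      = of_real (\<Sum>j<N. (cmod (x j))\<^sup>2)" .
  have "csym (\<lambda>z. 1)" by (simp add: csym_def)
  from form_has_integral[OF this, of N x x]
  have "((\<lambda>t. trigsum N x t * cnj (trigsum N x t)) has_integral of_real (2 * pi * (\<Sum>j<N. (cmod (x j))\<^sup>2))) {0..2*pi}"
    unfolding eq by simp
  from has_integral_linear[OF this bounded_linear_Re]
  show ?thesis unfolding o_def complex_norm_square[symmetric] Re_complex_of_real .
qed

text \<open>The pointwise inequality 2 |X| |Y| <= |X|^2 + |Y|^2 stands in for Cauchy-Schwarz. What
  is lost by adding the norms is recovered by the scaling of \<open>y\<close> in
  \<open>toeplitz_section_bound\<close>.\<close>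

lemma form_bound:
  assumes a: "csym a" and M: "\<And>z. z \<in> sphere 0 1 \<Longrightarrow> cmod (a z) \<le> M"
  shows "cmod (\<Sum>i<N. \<Sum>j<N. fourier a (int i - int j) * x j * cnj (y i))
    \<le> M / 2 * ((\<Sum>j<N. (cmod (x j))\<^sup>2) + (\<Sum>j<N. (cmod (y j))\<^sup>2))"
proof -
  let ?X = "trigsum N x" and ?Y = "trigsum N y"
  let ?S = "\<Sum>i<N. \<Sum>j<N. fourier a (int i - int j) * x j * cnj (y i)"
  have M0: "0 \<le> M" using order_trans[OF norm_ge_zero M[of 1]] by simp
  have g: "((\<lambda>t. M / 2 * ((cmod (?X t))\<^sup>2 + (cmod (?Y t))\<^sup>2)) has_integral
      M / 2 * (2 * pi * (\<Sum>j<N. (cmod (x j))\<^sup>2) + 2 * pi * (\<Sum>j<N. (cmod (y j))\<^sup>2))) {0..2*pi}"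
    by (intro has_integral_mult_right has_integral_add parseval_trigsum)
  note f = form_has_integral[OF a, of N x y]
  have "cmod (2 * pi * ?S) \<le> M / 2 * (2 * pi * (\<Sum>j<N. (cmod (x j))\<^sup>2) + 2 * pi * (\<Sum>j<N. (cmod (y j))\<^sup>2))"
    unfolding integral_unique[OF f, symmetric] integral_unique[OF g, symmetric]
  proof (rule integral_norm_bound_integral)
    fix t :: real
    have "cmod (a (cis t) * (?X t * cnj (?Y t))) \<le> M * (cmod (?X t) * cmod (?Y t))"
      unfolding norm_mult complex_mod_cnj by (intro mult_right_mono M) auto
    also have "\<dots> \<le> M * (((cmod (?X t))\<^sup>2 + (cmod (?Y t))\<^sup>2) / 2)"
      using sum_squares_bound[of "cmod (?X t)" "cmod (?Y t)"] M0 by (intro mult_left_mono) auto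
    finally show "norm (a (cis t) * (?X t * cnj (?Y t))) \<le> M / 2 * ((cmod (?X t))\<^sup>2 + (cmod (?Y t))\<^sup>2)"
      by simp
  qed (use f g in \<open>auto simp: integrable_on_def\<close>)
  then have "2 * pi * cmod ?S \<le> 2 * pi * (M / 2 * ((\<Sum>j<N. (cmod (x j))\<^sup>2) + (\<Sum>j<N. (cmod (y j))\<^sup>2)))"
    by (simp add: norm_mult algebra_simps)
  then show ?thesis by (simp only: mult_le_cancel_left_pos[OF mult_pos_pos[OF zero_less_numeral pi_gt_zero]])
qed

text \<open>Insert y = z / M, with z the image of x, into \<open>form_bound\<close>: S / M <= M / 2
  * (T + S / M^2) resolves to S <= M^2 * T. The columns form an arbitrary finite set so that
  \<open>toep_summable\<close> can estimate blocks of them.\<close>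

lemma toeplitz_section_bound:
  assumes a: "csym a" and M: "\<And>z. z \<in> sphere 0 1 \<Longrightarrow> cmod (a z) \<le> M" and M0: "0 < M" and J: "finite J"
  shows "(\<Sum>i<L. (cmod (\<Sum>j\<in>J. fourier a (int i - int j) * x j))\<^sup>2) \<le> M\<^sup>2 * (\<Sum>j\<in>J. (cmod (x j))\<^sup>2)"
proof -
  obtain N0 where "J \<subseteq> {..<N0}" using J finite_nat_iff_bounded by blast
  define N where "N = max L N0"
  have JN: "J \<subseteq> {..<N}" using \<open>J \<subseteq> {..<N0}\<close> by (force simp: N_def)
  define x' where "x' j = (if j \<in> J then x j else 0)" for j
  define z where "z i = (\<Sum>j\<in>J. fourier a (int i - int j) * x j)" for i
  have z: "(\<Sum>j<N. fourier a (int i - int j) * x' j) = z i" for i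
    unfolding z_def by (rule sum.mono_neutral_cong_right) (use JN in \<open>auto simp: x'_def\<close>)
  have x': "(\<Sum>j<N. (cmod (x' j))\<^sup>2) = (\<Sum>j\<in>J. (cmod (x j))\<^sup>2)"
    by (rule sum.mono_neutral_cong_right) (use JN in \<open>auto simp: x'_def\<close>)
  let ?S = "\<Sum>i<N. (cmod (z i))\<^sup>2" and ?T = "\<Sum>j\<in>J. (cmod (x j))\<^sup>2"
  have "(\<Sum>i<N. \<Sum>j<N. fourier a (int i - int j) * x' j * cnj (z i / M))
      = (\<Sum>i<N. z i * cnj (z i / M))"
    unfolding z[symmetric] by (simp only: sum_distrib_right)
  also have "\<dots> = (\<Sum>i<N. z i * cnj (z i)) / M"
    by (simp add: sum_divide_distrib)
  also have "\<dots> = of_real (?S / M)" by (simp only: of_real_divide of_real_sum complex_norm_square)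
  finally have "cmod (\<Sum>i<N. \<Sum>j<N. fourier a (int i - int j) * x' j * cnj (z i / M)) = ?S / M"
    using M0 by (simp only: norm_of_real) (simp add: sum_nonneg)
  moreover have "(\<Sum>i<N. (cmod (z i / M))\<^sup>2) = ?S / M\<^sup>2"
    using M0 by (simp add: norm_divide power_divide sum_divide_distrib)
  ultimately have "?S / M \<le> M / 2 * (?T + ?S / M\<^sup>2)"
    using form_bound[where N = N and x = x' and y = "\<lambda>i. z i / M", OF a M] x' by simp
  then have "?S \<le> M\<^sup>2 * ?T" using M0 by (simp add: field_simps power2_eq_square)
  moreover have "(\<Sum>i<L. (cmod (z i))\<^sup>2) \<le> ?S" by (rule sum_mono2) (auto simp: N_def)
  ultimately show ?thesis by (simp add: z_def)
qed

section \<open>Boundedness of Toeplitz operators\<close>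

lemma csym_bounded:
  assumes "csym a"
  shows "\<exists>M>0. \<forall>z\<in>sphere 0 1. cmod (a z) \<le> M"
proof -
  have "bounded (a ` sphere 0 1)"
    using assms unfolding csym_def by (intro compact_imp_bounded compact_continuous_image) auto
  then show ?thesis unfolding bounded_pos by blast
qed

text \<open>\<open>toep\<close> is a \<open>suminf\<close>, so its rows have to be shown convergent
  first. A late block of columns is small by the section bound, and row \<open>i\<close> is one of
  its rows.\<close>

lemma toep_summable:
  assumes a: "csym a" and x: "x \<in> l2"
  shows "summable (\<lambda>j. fourier a (int i - int j) * x j)"
proof -
  obtain M where M: "0 < M" "\<And>z. z \<in> sphere 0 1 \<Longrightarrow> cmod (a z) \<le> M"
    using csym_bounded[OF a] by blast
  show ?thesis
    unfolding summable_Cauchy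
  proof (intro allI impI)
    fix e :: real assume e: "0 < e"
    have "summable (\<lambda>j. (cmod (x j))\<^sup>2)" using x by (simp add: l2_def)
    then obtain N where N: "\<And>m n. m \<ge> N \<Longrightarrow> norm (\<Sum>j=m..<n. (cmod (x j))\<^sup>2) < (e / M)\<^sup>2"
      using e M(1) unfolding summable_Cauchy by (metis divide_pos_pos zero_less_power)
    have "norm (\<Sum>j=m..<n. fourier a (int i - int j) * x j) < e" if "N \<le> m" for m n
    proof -
      have "(cmod (\<Sum>j=m..<n. fourier a (int i - int j) * x j))\<^sup>2
          \<le> (\<Sum>k<Suc i. (cmod (\<Sum>j=m..<n. fourier a (int k - int j) * x j))\<^sup>2)"
        by (rule member_le_sum) auto
      also have "\<dots> \<le> M\<^sup>2 * (\<Sum>j=m..<n. (cmod (x j))\<^sup>2)"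
        by (rule toeplitz_section_bound[OF a M(2) M(1)]) auto
      also have "\<dots> < M\<^sup>2 * (e / M)\<^sup>2"
        using N[OF that, of n] M(1) by (intro mult_strict_left_mono) auto
      also have "\<dots> = e\<^sup>2" using M(1) by (simp add: power_divide)
      finally show ?thesis using e by (simp add: power_less_imp_less_base)
    qed
    then show "\<exists>N. \<forall>m\<ge>N. \<forall>n. norm (\<Sum>j=m..<n. fourier a (int i - int j) * x j) < e" by blast
  qed
qed

lemma
  assumes a: "csym a" and M: "\<And>z. z \<in> sphere 0 1 \<Longrightarrow> cmod (a z) \<le> M" "0 < M" and x: "x \<in> l2"
  shows toep_in_l2: "toep a x \<in> l2" and toep_le: "l2norm (toep a x) \<le> M * l2norm x"
proof -
  have "(\<Sum>i<L. (cmod (toep a x i))\<^sup>2) \<le> (M * l2norm x)\<^sup>2" for L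
  proof (rule LIMSEQ_le_const2)
    show "(\<lambda>n. \<Sum>i<L. (cmod (\<Sum>j<n. fourier a (int i - int j) * x j))\<^sup>2) \<longlonglongrightarrow> (\<Sum>i<L. (cmod (toep a x i))\<^sup>2)"
      unfolding toep_def by (intro tendsto_intros summable_LIMSEQ toep_summable a x)
    have "(\<Sum>i<L. (cmod (\<Sum>j<n. fourier a (int i - int j) * x j))\<^sup>2) \<le> (M * l2norm x)\<^sup>2" for n
    proof -
      have "(\<Sum>i<L. (cmod (\<Sum>j<n. fourier a (int i - int j) * x j))\<^sup>2) \<le> M\<^sup>2 * (\<Sum>j<n. (cmod (x j))\<^sup>2)"
        by (rule toeplitz_section_bound[OF a M]) auto
      also have "\<dots> \<le> M\<^sup>2 * (l2norm x)\<^sup>2" by (intro mult_left_mono sum_le_l2norm x) auto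
      finally show ?thesis by (simp add: power_mult_distrib)
    qed
    then show "\<exists>K. \<forall>n\<ge>K. (\<Sum>i<L. (cmod (\<Sum>j<n. fourier a (int i - int j) * x j))\<^sup>2) \<le> (M * l2norm x)\<^sup>2"
      by blast
  qed
  moreover have "0 \<le> M * l2norm x" using M(2) l2norm_nonneg[OF x] by simp
  ultimately show "toep a x \<in> l2" "l2norm (toep a x) \<le> M * l2norm x"
    by (rule l2_bound)+
qed

lemma toep_bounded:
  assumes "csym a"
  shows "\<exists>M>0. \<forall>x\<in>l2. toep a x \<in> l2 \<and> l2norm (toep a x) \<le> M * l2norm x"
proof -
  obtain M where M: "0 < M" "\<And>z. z \<in> sphere 0 1 \<Longrightarrow> cmod (a z) \<le> M"
    using csym_bounded[OF assms] by blast
  show ?thesis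
    using M(1) toep_in_l2[OF assms M(2,1)] toep_le[OF assms M(2,1)] by blast
qed

lemma toep_l2: "csym a \<Longrightarrow> x \<in> l2 \<Longrightarrow> toep a x \<in> l2"
  using toep_bounded[of a] by blast

lemma toep_lin:
  assumes "csym a" "x \<in> l2" "y \<in> l2"
  shows "toep a (\<lambda>i. c * x i + y i) = (\<lambda>i. c * toep a x i + toep a y i)"
proof
  fix i
  have "(\<lambda>j. c * (fourier a (int i - int j) * x j) + fourier a (int i - int j) * y j)
      sums (c * toep a x i + toep a y i)"
    unfolding toep_def by (intro sums_add sums_mult summable_sums toep_summable assms)
  then show "toep a (\<lambda>i. c * x i + y i) i = c * toep a x i + toep a y i"
    unfolding toep_def[of a "\<lambda>i. c * x i + y i"] by (simp add: sums_iff algebra_simps)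
qed

lemma toep_sym_lin:
  assumes "csym a" "csym b" "x \<in> l2"
  shows "toep (\<lambda>z. c * a z + b z) x = (\<lambda>i. c * toep a x i + toep b x i)"
proof
  fix i
  have "(\<lambda>j. c * (fourier a (int i - int j) * x j) + fourier b (int i - int j) * x j)
      sums (c * toep a x i + toep b x i)"
    unfolding toep_def by (intro sums_add sums_mult summable_sums toep_summable assms)
  then show "toep (\<lambda>z. c * a z + b z) x i = c * toep a x i + toep b x i"
    unfolding toep_def[of "\<lambda>z. c * a z + b z"] fourier_lin[OF assms(1,2)] by (simp add: sums_iff algebra_simps)
qed

lemma toep_powi: "toep (\<lambda>z. z powi k) x i = (if k \<le> int i then x (nat (int i - k)) else 0)"
proof -
  have "toep (\<lambda>z. z powi k) x i = (\<Sum>j\<in>(if k \<le> int i then {nat (int i - k)} else {}). fourier (\<lambda>z. z powi k) (int i - int j) * x j)"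
    unfolding toep_def by (rule suminf_finite) (auto simp: fourier_powi)
  then show ?thesis by (simp add: fourier_powi)
qed

section \<open>Approximation by trigonometric polynomials\<close>

inductive trigp :: "(complex \<Rightarrow> complex) \<Rightarrow> bool" where
  powi: "trigp (\<lambda>z. z powi k)"
| lin: "trigp f \<Longrightarrow> trigp g \<Longrightarrow> trigp (\<lambda>z. c * f z + g z)"

lemma trigp_csym: "trigp f \<Longrightarrow> csym f"
  by (induction rule: trigp.induct) (auto intro: csym_powi csym_lin)

text \<open>The laws behind products and conjugates hold on the circle but not everywhere:
  \<open>z powi (k + l) = z powi k * z powi l\<close> can fail at 0, and the conjugate of z is
  \<open>z powi (-1)\<close> when |z| = 1.\<close>

definition trigc :: "(complex \<Rightarrow> complex) \<Rightarrow> bool" where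
  "trigc f \<longleftrightarrow> (\<exists>g. trigp g \<and> (\<forall>z\<in>sphere 0 1. f z = g z))"

lemma trigc_trigp: "trigp f \<Longrightarrow> trigc f"
  by (auto simp: trigc_def)

lemma trigc_cong: "trigc f \<Longrightarrow> (\<And>z. z \<in> sphere 0 1 \<Longrightarrow> h z = f z) \<Longrightarrow> trigc h"
  by (auto simp: trigc_def)

lemma trigc_lin:
  assumes "trigc f" "trigc g"
  shows "trigc (\<lambda>z. c * f z + g z)"
proof -
  obtain f' g' where "trigp f'" "\<forall>z\<in>sphere 0 1. f z = f' z" "trigp g'" "\<forall>z\<in>sphere 0 1. g z = g' z"
    using assms by (auto simp: trigc_def)
  then show ?thesis unfolding trigc_def
    by (intro exI[of _ "\<lambda>z. c * f' z + g' z"]) (auto intro: trigp.lin)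
qed

lemma trigc_zero: "trigc (\<lambda>z. 0)"
  using trigc_trigp[OF trigp.lin[OF trigp.powi trigp.powi, of "-1" 0 0]] by simp

lemma trigc_scale: "trigc f \<Longrightarrow> trigc (\<lambda>z. c * f z)"
  using trigc_lin[OF _ trigc_zero, of f c] by simp

lemma trigc_powi_mult: "trigp g \<Longrightarrow> trigc (\<lambda>z. z powi k * g z)"
proof (induction rule: trigp.induct)
  case (powi l)
  show ?case
    by (rule trigc_cong[OF trigc_trigp[OF trigp.powi[of "k + l"]]]) (metis mem_sphere_0 norm_zero power_int_add zero_neq_one)
next
  case (lin f g c)
  show ?case
    by (rule trigc_cong[OF trigc_lin[OF lin.IH, of c]]) (simp add: algebra_simps)
qed

lemma trigp_mult: "trigp f \<Longrightarrow> trigp g \<Longrightarrow> trigc (\<lambda>z. f z * g z)"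
proof (induction rule: trigp.induct)
  case (powi k)
  then show ?case by (rule trigc_powi_mult)
next
  case (lin f h c)
  show ?case
    by (rule trigc_cong[OF trigc_lin[OF lin.IH(1)[OF lin.prems] lin.IH(2)[OF lin.prems], of c]])
      (simp add: algebra_simps)
qed

lemma trigc_mult:
  assumes "trigc f" "trigc g"
  shows "trigc (\<lambda>z. f z * g z)"
proof -
  obtain f' g' where "trigp f'" "\<forall>z\<in>sphere 0 1. f z = f' z" "trigp g'" "\<forall>z\<in>sphere 0 1. g z = g' z"
    using assms by (auto simp: trigc_def)
  then show ?thesis by (intro trigc_cong[OF trigp_mult[of f' g']]) auto
qed

lemma trigc_real_polynomial: "real_polynomial_function h \<Longrightarrow> trigc (\<lambda>z. of_real (h z))"
proof (induction rule: real_polynomial_function.induct)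
  case (linear h)
  \<comment> \<open>The coefficients of z and 1/z in Re z * h(1) + Im z * h(i), with Re z = (z +
    1/z) / 2 and Im z = (z - 1/z) / (2 i) on the circle.\<close>
  let ?p = "(complex_of_real (h 1) - \<i> * of_real (h \<i>)) / 2"
  let ?q = "(complex_of_real (h 1) + \<i> * of_real (h \<i>)) / 2"
  have "of_real (h z) = ?p * z powi 1 + ?q * z powi (-1)" if "z \<in> sphere 0 1" for z
  proof -
    have "z * cnj z = 1" using that complex_norm_square[of z] by simp
    then have inv: "inverse z = cnj z" using inverse_unique by blast
    have "z = Re z *\<^sub>R 1 + Im z *\<^sub>R \<i>" by (simp add: complex_eq_iff)
    then have "h z = h (Re z *\<^sub>R 1 + Im z *\<^sub>R \<i>)" by simp
    also have "\<dots> = Re z * h 1 + Im z * h \<i>"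
      using linear by (simp add: linear_simps)
    finally have "h z = Re z * h 1 + Im z * h \<i>" .
    moreover have "z powi 1 = z" "z powi (-1) = cnj z" using inv by (simp_all add: power_int_minus)
    moreover have "?p * z + ?q * cnj z = of_real (Re z * h 1 + Im z * h \<i>)"
      by (simp add: complex_eq_iff field_simps)
    ultimately show ?thesis by (simp only:)
  qed
  then show ?case
    by (rule trigc_cong[OF trigc_lin[OF trigc_trigp[OF trigp.powi] trigc_scale[OF trigc_trigp[OF trigp.powi]]]])
next
  case (const c)
  show ?case using trigc_scale[OF trigc_trigp[OF trigp.powi[of 0]], of "of_real c"] by simp
next
  case (add f g)
  then show ?case using trigc_lin[of "\<lambda>z. of_real (f z)" "\<lambda>z. of_real (g z)" 1] by simp
next
  case (mult f g)
  then show ?case using trigc_mult[of "\<lambda>z. of_real (f z)" "\<lambda>z. of_real (g z)"] by simp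
qed

text \<open>Stone-Weierstrass in the real plane gives polynomials in Re z and Im z; on the circle
  these are trigonometric polynomials.\<close>

lemma trigp_approx:
  assumes "csym a" "0 < e"
  obtains g where "trigp g" "\<And>z. z \<in> sphere 0 1 \<Longrightarrow> cmod (a z - g z) < e"
proof -
  obtain p where p: "polynomial_function p" "\<And>z. z \<in> sphere 0 1 \<Longrightarrow> cmod (a z - p z) < e"
    using Stone_Weierstrass_polynomial_function[of "sphere 0 1" a e] assms by (auto simp: csym_def)
  have "real_polynomial_function (Re \<circ> p)" "real_polynomial_function (Im \<circ> p)"
    using p(1) bounded_linear_Re bounded_linear_Im by (auto simp: polynomial_function_def)
  then have "trigc (\<lambda>z. \<i> * of_real ((Im \<circ> p) z) + of_real ((Re \<circ> p) z))"
    by (intro trigc_lin trigc_real_polynomial)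
  moreover have "\<i> * of_real ((Im \<circ> p) z) + of_real ((Re \<circ> p) z) = p z" for z
    by (simp add: complex_eq_iff)
  ultimately have "trigc p" by simp
  then show thesis using p(2) that by (auto simp: trigc_def)
qed

section \<open>Bounded operators on subspaces\<close>

definition subsp :: "sq set \<Rightarrow> bool" where
  "subsp V \<longleftrightarrow> V \<subseteq> l2 \<and> (\<lambda>i. 0) \<in> V \<and> (\<forall>x\<in>V. \<forall>y\<in>V. \<forall>c. (\<lambda>i. c * x i + y i) \<in> V)"

lemma subspD:
  assumes "subsp V"
  shows "x \<in> V \<Longrightarrow> x \<in> l2" "(\<lambda>i. 0) \<in> V" "x \<in> V \<Longrightarrow> y \<in> V \<Longrightarrow> (\<lambda>i. c * x i + y i) \<in> V"
  using assms by (auto simp: subsp_def)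

lemma subsp_diff: "subsp V \<Longrightarrow> x \<in> V \<Longrightarrow> y \<in> V \<Longrightarrow> (\<lambda>i. x i - y i) \<in> V"
  using subspD(3)[of V y x "-1"] by simp

lemma subsp_scale: "subsp V \<Longrightarrow> x \<in> V \<Longrightarrow> (\<lambda>i. c * x i) \<in> V"
  using subspD(3)[of V x "\<lambda>i. 0" c] subspD(2)[of V] by simp

lemma bopD:
  assumes "bop V A"
  shows "x \<in> V \<Longrightarrow> A x \<in> V"
    "x \<in> V \<Longrightarrow> y \<in> V \<Longrightarrow> A (\<lambda>i. c * x i + y i) = (\<lambda>i. c * A x i + A y i)"
  using assms by (auto simp: bop_def)

lemma bop_bounded: "bop V A \<Longrightarrow> \<exists>C. \<forall>x\<in>V. l2norm (A x) \<le> C * l2norm x"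
  by (simp add: bop_def)

lemma bopI:
  assumes "\<And>x. x \<in> V \<Longrightarrow> A x \<in> V"
    and "\<And>x y c. x \<in> V \<Longrightarrow> y \<in> V \<Longrightarrow> A (\<lambda>i. c * x i + y i) = (\<lambda>i. c * A x i + A y i)"
    and "\<And>x. x \<in> V \<Longrightarrow> l2norm (A x) \<le> C * l2norm x"
  shows "bop V A"
  using assms unfolding bop_def by blast

lemma bop_diff: "bop V A \<Longrightarrow> x \<in> V \<Longrightarrow> y \<in> V \<Longrightarrow> A (\<lambda>i. x i - y i) = (\<lambda>i. A x i - A y i)"
  using bopD(2)[of V A y x "-1"] by simp

lemma bop_zero: "subsp V \<Longrightarrow> bop V A \<Longrightarrow> A (\<lambda>i. 0) = (\<lambda>i. 0)"
  using bop_diff[of V A "\<lambda>i. 0" "\<lambda>i. 0"] subspD(2)[of V] by simp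

lemma bop_scale: "subsp V \<Longrightarrow> bop V A \<Longrightarrow> x \<in> V \<Longrightarrow> A (\<lambda>i. c * x i) = (\<lambda>i. c * A x i)"
  using bopD(2)[of V A x "\<lambda>i. 0" c] subspD(2)[of V] bop_zero[of V A] by simp

lemma bop_cong:
  assumes "subsp V" "bop V A" "\<And>x. x \<in> V \<Longrightarrow> B x = A x"
  shows "bop V B"
  using assms subspD(3)[OF assms(1)] unfolding bop_def by simp

section \<open>Operator norms, inverses and finite dimension\<close>

lemma opnorm_le:
  assumes "subsp V" "0 \<le> C" "\<And>x. x \<in> V \<Longrightarrow> l2norm (A x) \<le> C * l2norm x"
  shows "opnorm V A \<le> C"
  unfolding opnorm_def
proof (rule cSup_least)
  show "{l2norm (A x) |x. x \<in> V \<and> l2norm x \<le> 1} \<noteq> {}"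
    using subspD(2)[OF assms(1)] by (auto intro!: exI[of _ "\<lambda>i. 0"])
  fix r assume "r \<in> {l2norm (A x) |x. x \<in> V \<and> l2norm x \<le> 1}"
  then obtain x where x: "r = l2norm (A x)" "x \<in> V" "l2norm x \<le> 1" by blast
  have "r \<le> C * l2norm x" using x assms by simp
  also have "\<dots> \<le> C * 1" using x assms by (intro mult_left_mono)
  finally show "r \<le> C" by simp
qed

text \<open>\<open>opnorm\<close> is a \<open>Sup\<close> of reals, informative for bounded sets;
  the bound contained in \<open>bop\<close> provides this. The rest is scaling to a unit
  vector.\<close>

lemma le_opnorm:
  assumes V: "subsp V" and A: "bop V A" and x: "x \<in> V"
  shows "l2norm (A x) \<le> opnorm V A * l2norm x"
proof (cases "x = (\<lambda>i. 0)")
  case True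
  then show ?thesis using bop_zero[OF V A] by simp
next
  case False
  have xl: "x \<in> l2" using subspD(1)[OF V x] .
  have pos: "0 < l2norm x" using False l2norm_eq_0_iff[OF xl] l2norm_nonneg[OF xl] by simp
  obtain C where C: "\<And>x. x \<in> V \<Longrightarrow> l2norm (A x) \<le> C * l2norm x" using bop_bounded[OF A] by blast
  let ?c = "complex_of_real (1 / l2norm x)"
  let ?y = "\<lambda>i. ?c * x i"
  have c: "cmod ?c = 1 / l2norm x" using pos by (simp only: norm_of_real) simp
  have y: "?y \<in> V" by (rule subsp_scale[OF V x])
  have ny: "l2norm ?y = 1" unfolding l2norm_scale[OF xl] c using pos by simp
  have "l2norm (A ?y) \<le> opnorm V A"
    unfolding opnorm_def
  proof (rule cSup_upper)
    show "l2norm (A ?y) \<in> {l2norm (A x) |x. x \<in> V \<and> l2norm x \<le> 1}"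
      unfolding mem_Collect_eq by (intro exI[of _ ?y] conjI refl y) (simp only: ny order_refl)
    have "l2norm (A z) \<le> \<bar>C\<bar>" if "z \<in> V" "l2norm z \<le> 1" for z
    proof -
      have "l2norm (A z) \<le> C * l2norm z" by (rule C[OF that(1)])
      also have "\<dots> \<le> \<bar>C\<bar> * 1" using that l2norm_nonneg[OF subspD(1)[OF V that(1)]]
        by (intro mult_mono) auto
      finally show ?thesis by simp
    qed
    then show "bdd_above {l2norm (A x) |x. x \<in> V \<and> l2norm x \<le> 1}" by (auto intro!: bdd_aboveI[of _ "\<bar>C\<bar>"])
  qed
  moreover have "l2norm (A ?y) = l2norm (A x) / l2norm x"
    unfolding bop_scale[OF V A x] l2norm_scale[OF subspD(1)[OF V bopD(1)[OF A x]]] c by simp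
  ultimately show ?thesis using pos by (simp add: pos_divide_le_eq)
qed

text \<open>The inverse is picked by choice. Injectivity, a consequence of the lower bound, forces
  it to be linear, and the lower bound read backwards bounds it.\<close>

lemma bounded_below_inverse:
  assumes V: "subsp V" and A: "bop V A"
    and below: "\<And>x. x \<in> V \<Longrightarrow> l2norm x \<le> c * l2norm (A x)"
    and surj: "\<And>y. y \<in> V \<Longrightarrow> \<exists>x\<in>V. A x = y"
  shows "\<exists>B. bop V B \<and> (\<forall>x\<in>V. B (A x) = x \<and> A (B x) = x \<and> l2norm (B x) \<le> c * l2norm x)"
proof -
  obtain B where B: "\<And>y. y \<in> V \<Longrightarrow> B y \<in> V" "\<And>y. y \<in> V \<Longrightarrow> A (B y) = y"
    using surj by metis
  have inj: "x = y" if "x \<in> V" "y \<in> V" "A x = A y" for x y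
  proof -
    have d: "(\<lambda>i. x i - y i) \<in> V" using that by (intro subsp_diff[OF V])
    have "l2norm (\<lambda>i. x i - y i) \<le> 0"
      using below[OF d] bop_diff[OF A that(1,2)] that(3) by simp
    then have "(\<lambda>i. x i - y i) = (\<lambda>i. 0)"
      using l2norm_nonneg[OF subspD(1)[OF V d]] l2norm_eq_0_iff[OF subspD(1)[OF V d]] by simp
    then show ?thesis by (auto simp: fun_eq_iff)
  qed
  have Bb: "l2norm (B x) \<le> c * l2norm x" if "x \<in> V" for x
    using below[OF B(1)[OF that]] B(2)[OF that] by simp
  have bB: "bop V B"
  proof (rule bopI[OF B(1) _ Bb])
    fix x y k assume xy: "x \<in> V" "y \<in> V"
    note z = subspD(3)[OF V xy, of k]
    show "B (\<lambda>i. k * x i + y i) = (\<lambda>i. k * B x i + B y i)"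
    proof (rule inj[OF B(1)[OF z] subspD(3)[OF V B(1)[OF xy(1)] B(1)[OF xy(2)]]])
      show "A (B (\<lambda>i. k * x i + y i)) = A (\<lambda>i. k * B x i + B y i)"
        unfolding B(2)[OF z] bopD(2)[OF A B(1)[OF xy(1)] B(1)[OF xy(2)]] B(2)[OF xy(1)] B(2)[OF xy(2)] ..
    qed
  qed
  have BA: "B (A x) = x" if "x \<in> V" for x
    by (rule inj[OF B(1)[OF bopD(1)[OF A that]] that B(2)[OF bopD(1)[OF A that]]])
  show ?thesis using bB BA B(2) Bb by blast
qed

text \<open>\<open>A\<close> is linear on \<open>V\<close> only, so the image of a sum can be
  computed only while the partial sums stay in \<open>V\<close>; membership and value are therefore
  proved in one induction.\<close>

lemma lincomb:
  assumes V: "subsp V" and A: "bop V A" and "finite S" "S \<subseteq> V"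
  shows "(\<Sum>v\<in>S. (\<lambda>i. u v * v i)) \<in> V \<and> A (\<Sum>v\<in>S. (\<lambda>i. u v * v i)) = (\<Sum>v\<in>S. (\<lambda>i. u v * A v i))"
  using assms(3,4)
proof (induction S rule: finite_induct)
  case empty
  then show ?case using subspD(2)[OF V] bop_zero[OF V A] by (simp add: zero_fun_def)
next
  case (insert w S)
  let ?s = "\<Sum>v\<in>S. (\<lambda>i. u v * v i)"
  have s: "?s \<in> V" "A ?s = (\<Sum>v\<in>S. (\<lambda>i. u v * A v i))" and w: "w \<in> V" using insert by auto
  have "(\<Sum>v\<in>insert w S. (\<lambda>i. u v * v i)) = (\<lambda>i. u w * w i + ?s i)"
    using insert(1,2) by (simp add: plus_fun_def)
  moreover have "(\<Sum>v\<in>insert w S. (\<lambda>i. u v * A v i)) = (\<lambda>i. u w * A w i + A ?s i)"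
    using insert(1,2) s(2) by (simp add: plus_fun_def)
  ultimately show ?case using subspD(3)[OF V w s(1)] bopD(2)[OF A w s(1)] by simp
qed

text \<open>Dimension count: a basis of \<open>V\<close> is mapped to equally many independent
  vectors, so a \<open>y\<close> outside their span would give more independent vectors in
  \<open>V\<close> than the basis has.\<close>

lemma finite_dim_surj:
  assumes V: "subsp V" and A: "bop V A" and T: "finite T" "V \<subseteq> sqv.span T"
    and inj: "\<And>x. x \<in> V \<Longrightarrow> A x = (\<lambda>i. 0) \<Longrightarrow> x = (\<lambda>i. 0)" and y: "y \<in> V"
  shows "\<exists>x\<in>V. A x = y"
proof -
  obtain B where B: "B \<subseteq> V" "sqv.independent B" "V \<subseteq> sqv.span B"
    using sqv.maximal_independent_subset .
  have fin: "finite B" using sqv.independent_span_bound[OF T(1) B(2)] B(1) T(2) by blast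
  have inj_on: "inj_on A B"
  proof (rule inj_onI)
    fix v w assume vw: "v \<in> B" "w \<in> B" "A v = A w"
    have V': "v \<in> V" "w \<in> V" using B(1) vw by auto
    have "A (\<lambda>i. v i - w i) = (\<lambda>i. 0)" unfolding bop_diff[OF A V'] using vw(3) by simp
    then have "(\<lambda>i. v i - w i) = (\<lambda>i. 0)" by (rule inj[OF subsp_diff[OF V V']])
    then show "v = w" by (auto simp: fun_eq_iff)
  qed
  have sum_eq: "(\<Sum>v\<in>A ` B. (\<lambda>i. u v * v i)) = A (\<Sum>v\<in>B. (\<lambda>i. u (A v) * v i))" for u
    using lincomb[OF V A fin B(1), of "\<lambda>v. u (A v)"] by (simp add: sum.reindex[OF inj_on])
  have indep: "sqv.independent (A ` B)"
  proof
    assume "sqv.dependent (A ` B)"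
    then obtain u w where u: "w \<in> B" "u (A w) \<noteq> 0" "(\<Sum>v\<in>A ` B. (\<lambda>i. u v * v i)) = 0"
      using sqv.dependent_finite[of "A ` B"] fin by auto
    have "(\<Sum>v\<in>B. (\<lambda>i. u (A v) * v i)) = 0"
      unfolding zero_fun_def
      by (rule inj[OF conjunct1[OF lincomb[OF V A fin B(1)]]])
        (use u(3) in \<open>simp only: sum_eq zero_fun_def\<close>)
    then have "\<exists>u'. (\<exists>v\<in>B. u' v \<noteq> 0) \<and> (\<Sum>v\<in>B. (\<lambda>i. u' v * v i)) = 0"
      using u(1,2) by (intro exI[of _ "\<lambda>v. u (A v)"] conjI bexI[of _ w])
    then show False using B(2) sqv.dependent_finite[OF fin] by simp
  qed
  have "y \<in> sqv.span (A ` B)"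
  proof (rule ccontr)
    assume ny: "y \<notin> sqv.span (A ` B)"
    then have "sqv.independent (insert y (A ` B))" using indep by (rule sqv.independent_insertI)
    moreover have "insert y (A ` B) \<subseteq> V"
    proof (intro insert_subsetI y image_subsetI)
      fix b assume "b \<in> B"
      then show "A b \<in> V" by (intro bopD(1)[OF A] subsetD[OF B(1)])
    qed
    then have "insert y (A ` B) \<subseteq> sqv.span B" using B(3) by (rule order_trans)
    ultimately have "card (insert y (A ` B)) \<le> card B"
      by (rule conjunct2[OF sqv.independent_span_bound[OF fin]])
    moreover have "y \<notin> A ` B" using ny sqv.span_base[of y "A ` B"] by metis
    ultimately show False using fin card_image[OF inj_on] by simp
  qed
  then obtain u where "y = (\<Sum>v\<in>A ` B. (\<lambda>i. u v * v i))"
    using sqv.span_finite[of "A ` B"] fin by auto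
  then show ?thesis using sum_eq[of u] lincomb[OF V A fin B(1), of "\<lambda>v. u (A v)"] by auto
qed

section \<open>Asymptotically constant sequences\<close>

text \<open>Only vectors of the smaller space are tested; nestedness makes both operators act on
  them. The uniform bound is included because products and the strong limit use it.\<close>

definition asym_const :: "(nat \<Rightarrow> complex) \<Rightarrow> (nat \<Rightarrow> sq \<Rightarrow> sq) \<Rightarrow> bool" where
  "asym_const lam A \<longleftrightarrow> (\<forall>n. bop (Kn lam n) (A n))
    \<and> (\<exists>C>0. \<forall>n. \<forall>x\<in>Kn lam n. l2norm (A n x) \<le> C * l2norm x)
    \<and> (\<forall>e>0. \<exists>N. \<forall>m\<ge>N. \<forall>n\<ge>m. \<forall>x\<in>Kn lam m. l2dist (A n x) (A m x) \<le> e * l2norm x)"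

lemma asym_constD:
  assumes "asym_const lam A"
  shows "bop (Kn lam n) (A n)"
    and "\<exists>C>0. \<forall>n. \<forall>x\<in>Kn lam n. l2norm (A n x) \<le> C * l2norm x"
    and "0 < e \<Longrightarrow> \<exists>N. \<forall>m\<ge>N. \<forall>n\<ge>m. \<forall>x\<in>Kn lam m. l2dist (A n x) (A m x) \<le> e * l2norm x"
  using assms by (auto simp: asym_const_def)

context
  fixes lam :: "nat \<Rightarrow> complex"
  assumes ib: "infinite_blaschke lam"
begin

lemmas Kmono = Kn_mono[OF ib] and Kl2 = Kn_l2[OF ib] and KKu = Kn_Ku[OF ib]

lemma subsp_Kn: "subsp (Kn lam n)"
  using Kn_l2[OF ib] zero_Kn[OF ib] Kn_lin[OF ib] by (auto simp: subsp_def)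

lemma subsp_Ku: "subsp (Ku lam)"
  using Ku_l2[OF ib] zero_Ku[OF ib] Ku_lin[OF ib] by (auto simp: subsp_def)

lemma Knorm: "x \<in> Kn lam n \<Longrightarrow> 0 \<le> l2norm x"
  using Kl2 l2norm_nonneg by blast

lemma bop_Kn_l2: "bop (Kn lam n) A \<Longrightarrow> x \<in> Kn lam n \<Longrightarrow> A x \<in> l2"
  by (rule Kl2[OF bopD(1)])

lemma asym_const_l2: "asym_const lam A \<Longrightarrow> m \<le> n \<Longrightarrow> x \<in> Kn lam m \<Longrightarrow> A n x \<in> l2"
  by (rule bop_Kn_l2[OF asym_constD(1) Kmono])

text \<open>Values of an operator outside its space are arbitrary, so sequences must be exchangeable
  if they agree on the spaces.\<close>

lemma asym_const_cong:
  assumes "asym_const lam A" and eq: "\<And>n x. x \<in> Kn lam n \<Longrightarrow> B n x = A n x"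
  shows "asym_const lam B"
proof -
  have "bop (Kn lam n) (B n)" for n
    by (rule bop_cong[OF subsp_Kn asym_constD(1)[OF assms(1)] eq])
  moreover have "l2dist (B n x) (B m x) = l2dist (A n x) (A m x)" if "m \<le> n" "x \<in> Kn lam m" for m n x
    using eq[OF that(2)] eq[OF Kmono[OF that]] by simp
  ultimately show ?thesis using asym_constD(2,3)[OF assms(1)] eq unfolding asym_const_def by simp
qed

lemma asym_const_lin:
  assumes A: "asym_const lam A" and B: "asym_const lam B"
  shows "asym_const lam (\<lambda>n x i. c * A n x i + B n x i)"
proof -
  obtain C D where C: "C > 0" "\<And>n x. x \<in> Kn lam n \<Longrightarrow> l2norm (A n x) \<le> C * l2norm x"
    and D: "D > 0" "\<And>n x. x \<in> Kn lam n \<Longrightarrow> l2norm (B n x) \<le> D * l2norm x"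
    using asym_constD(2)[OF A] asym_constD(2)[OF B] by blast
  let ?E = "cmod c * C + D"
  have E: "l2norm (\<lambda>i. c * A n x i + B n x i) \<le> ?E * l2norm x" if "x \<in> Kn lam n" for n x
  proof -
    have l: "A n x \<in> l2" "B n x \<in> l2" using that bop_Kn_l2 asym_constD(1) A B by blast+
    have "l2norm (\<lambda>i. c * A n x i + B n x i) \<le> cmod c * l2norm (A n x) + l2norm (B n x)"
      using l2norm_triangle[OF l2_scale[OF l(1), of c] l(2)] l2norm_scale[OF l(1), of c] by simp
    also have "\<dots> \<le> cmod c * (C * l2norm x) + D * l2norm x"
      using C D that by (intro add_mono mult_left_mono) auto
    finally show ?thesis by (simp add: algebra_simps)
  qed
  have "bop (Kn lam n) (\<lambda>x i. c * A n x i + B n x i)" for n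
  proof (rule bopI[OF _ _ E])
    note b = asym_constD(1)[OF A, of n] asym_constD(1)[OF B, of n]
    show "(\<lambda>i. c * A n x i + B n x i) \<in> Kn lam n" if "x \<in> Kn lam n" for x
      using subspD(3)[OF subsp_Kn bopD(1)[OF b(1) that] bopD(1)[OF b(2) that]] .
    show "(\<lambda>i. c * A n (\<lambda>i. k * x i + y i) i + B n (\<lambda>i. k * x i + y i) i)
        = (\<lambda>i. k * (c * A n x i + B n x i) + (c * A n y i + B n y i))"
      if "x \<in> Kn lam n" "y \<in> Kn lam n" for x y k
      unfolding bopD(2)[OF b(1) that] bopD(2)[OF b(2) that] by (simp add: algebra_simps)
  qed
  moreover have "\<exists>N. \<forall>m\<ge>N. \<forall>n\<ge>m. \<forall>x\<in>Kn lam m.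
      l2dist (\<lambda>i. c * A n x i + B n x i) (\<lambda>i. c * A m x i + B m x i) \<le> e * l2norm x" if e: "0 < e" for e
  proof -
    let ?d = "e / (2 * (cmod c + 1))"
    have c1: "0 < cmod c + 1" by (rule add_nonneg_pos) auto
    have d: "0 < ?d" using e c1 by simp
    obtain N1 where N1: "\<And>m n x. m \<ge> N1 \<Longrightarrow> n \<ge> m \<Longrightarrow> x \<in> Kn lam m \<Longrightarrow> l2dist (A n x) (A m x) \<le> ?d * l2norm x"
      using asym_constD(3)[OF A d] by blast
    obtain N2 where N2: "\<And>m n x. m \<ge> N2 \<Longrightarrow> n \<ge> m \<Longrightarrow> x \<in> Kn lam m \<Longrightarrow> l2dist (B n x) (B m x) \<le> e / 2 * l2norm x"
      proof -
        have "0 < e/2" using e by simp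
        from asym_constD(3)[OF B this] show ?thesis using that by blast
      qed
    have "l2dist (\<lambda>i. c * A n x i + B n x i) (\<lambda>i. c * A m x i + B m x i) \<le> e * l2norm x"
      if m: "max N1 N2 \<le> m" "m \<le> n" and x: "x \<in> Kn lam m" for m n x
    proof -
      have l: "A n x \<in> l2" "A m x \<in> l2" "B n x \<in> l2" "B m x \<in> l2"
        using asym_const_l2[OF A _ x] asym_const_l2[OF B _ x] m by auto
      have "(\<lambda>i. (c * A n x i + B n x i) - (c * A m x i + B m x i))
          = (\<lambda>i. c * (A n x i - A m x i) + (B n x i - B m x i))" by (simp add: algebra_simps)
      then have "l2dist (\<lambda>i. c * A n x i + B n x i) (\<lambda>i. c * A m x i + B m x i)
          \<le> l2norm (\<lambda>i. c * (A n x i - A m x i)) + l2dist (B n x) (B m x)"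
        unfolding l2dist_def using l by (simp add: l2norm_triangle)
      also have "l2norm (\<lambda>i. c * (A n x i - A m x i)) = cmod c * l2dist (A n x) (A m x)"
        unfolding l2dist_def using l by (intro l2norm_scale l2_diff)
      also have "\<dots> \<le> (cmod c + 1) * (?d * l2norm x)"
        using N1[of m n x] m x l by (intro mult_mono l2dist_nonneg) auto
      also have "(cmod c + 1) * (?d * l2norm x) = e / 2 * l2norm x"
        using c1 by (simp add: field_simps)
      also have "l2dist (B n x) (B m x) \<le> e / 2 * l2norm x" using N2[of m n x] m x by auto
      finally show ?thesis by simp
    qed
    then show ?thesis by blast
  qed
  moreover have "?E > 0" using C D by (intro add_nonneg_pos) auto
  ultimately show ?thesis using E unfolding asym_const_def by blast
qed

lemma asym_const_add: "asym_const lam A \<Longrightarrow> asym_const lam B \<Longrightarrow> asym_const lam (\<lambda>n x i. A n x i + B n x i)"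
  using asym_const_lin[of A B 1] by simp

text \<open>Written as (c - 1) A + A, so that \<open>asym_const_lin\<close> applies without a zero
  sequence.\<close>

lemma asym_const_scale:
  assumes "asym_const lam A"
  shows "asym_const lam (\<lambda>n x i. c * A n x i)"
  using asym_const_lin[OF assms assms, of "c - 1"] by (simp add: algebra_simps)

text \<open>A_n B_n x - A_m B_m x = A_n (B_n x - B_m x) + (A_n - A_m) B_m x. The first term uses the
  uniform bound on A; the second can be estimated because B_m x stays in
  \<open>Kn lam m\<close>.\<close>

lemma asym_const_mult:
  assumes A: "asym_const lam A" and B: "asym_const lam B"
  shows "asym_const lam (\<lambda>n x. A n (B n x))"
proof -
  obtain C D where C: "C > 0" "\<And>n x. x \<in> Kn lam n \<Longrightarrow> l2norm (A n x) \<le> C * l2norm x"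
    and D: "D > 0" "\<And>n x. x \<in> Kn lam n \<Longrightarrow> l2norm (B n x) \<le> D * l2norm x"
    using asym_constD(2)[OF A] asym_constD(2)[OF B] by blast
  note bA = asym_constD(1)[OF A] and bB = asym_constD(1)[OF B]
  have E: "l2norm (A n (B n x)) \<le> (C * D) * l2norm x" if "x \<in> Kn lam n" for n x
  proof -
    have "l2norm (A n (B n x)) \<le> C * l2norm (B n x)" by (rule C(2)[OF bopD(1)[OF bB that]])
    also have "\<dots> \<le> C * (D * l2norm x)" using C(1) D(2)[OF that] by (intro mult_left_mono) auto
    finally show ?thesis by simp
  qed
  have "bop (Kn lam n) (\<lambda>x. A n (B n x))" for n
    by (rule bopI[OF _ _ E]) (simp_all add: bopD[OF bA] bopD[OF bB])
  moreover have "\<exists>N. \<forall>m\<ge>N. \<forall>n\<ge>m. \<forall>x\<in>Kn lam m. l2dist (A n (B n x)) (A m (B m x)) \<le> e * l2norm x" if e: "0 < e" for e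
  proof -
    obtain N1 where N1: "\<And>m n x. m \<ge> N1 \<Longrightarrow> n \<ge> m \<Longrightarrow> x \<in> Kn lam m \<Longrightarrow> l2dist (A n x) (A m x) \<le> e / (2 * D) * l2norm x"
      proof -
        have "0 < e / (2 * D)" using e D by simp
        from asym_constD(3)[OF A this] show ?thesis using that by blast
      qed
    obtain N2 where N2: "\<And>m n x. m \<ge> N2 \<Longrightarrow> n \<ge> m \<Longrightarrow> x \<in> Kn lam m \<Longrightarrow> l2dist (B n x) (B m x) \<le> e / (2 * C) * l2norm x"
      proof -
        have "0 < e / (2 * C)" using e C by simp
        from asym_constD(3)[OF B this] show ?thesis using that by blast
      qed
    have "l2dist (A n (B n x)) (A m (B m x)) \<le> e * l2norm x"
      if m: "max N1 N2 \<le> m" "m \<le> n" and x: "x \<in> Kn lam m" for m n x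
    proof -
      have K: "B m x \<in> Kn lam m" "B m x \<in> Kn lam n" "B n x \<in> Kn lam n"
        using bopD(1)[OF bB] Kmono[OF m(2)] x by blast+
      have l: "A n (B n x) \<in> l2" "A n (B m x) \<in> l2" "A m (B m x) \<in> l2"
        using K bop_Kn_l2[OF bA] by blast+
      have "l2dist (A n (B n x)) (A n (B m x)) = l2norm (A n (\<lambda>i. B n x i - B m x i))"
        unfolding l2dist_def bop_diff[OF bA K(3,2)] ..
      also have "\<dots> \<le> C * l2dist (B n x) (B m x)"
        unfolding l2dist_def by (rule C(2)[OF subsp_diff[OF subsp_Kn K(3,2)]])
      also have "\<dots> \<le> C * (e / (2 * C) * l2norm x)" using N2[of m n x] m x C(1) by (intro mult_left_mono) auto
      finally have 1: "l2dist (A n (B n x)) (A n (B m x)) \<le> e / 2 * l2norm x" using C(1) by simp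
      have "l2dist (A n (B m x)) (A m (B m x)) \<le> e / (2 * D) * l2norm (B m x)" using N1[of m n "B m x"] m K by auto
      also have "\<dots> \<le> e / (2 * D) * (D * l2norm x)" using D e x by (intro mult_left_mono) auto
      finally have 2: "l2dist (A n (B m x)) (A m (B m x)) \<le> e / 2 * l2norm x" using D(1) by simp
      show ?thesis using l2dist_triangle[OF l] 1 2 by simp
    qed
    then show ?thesis by blast
  qed
  moreover have "0 < C * D" using C D by simp
  ultimately show ?thesis using E unfolding asym_const_def by blast
qed

text \<open>An e/3 argument. Closeness is expressed on vectors rather than by
  \<open>supdist\<close>, so the lemma serves both the closure of the algebra and the approximation
  of continuous symbols.\<close>

lemma asym_const_limit:
  assumes bA: "\<And>n. bop (Kn lam n) (A n)"
    and approx: "\<And>e. 0 < e \<Longrightarrow> \<exists>B. asym_const lam B \<and> (\<forall>n. \<forall>x\<in>Kn lam n. l2dist (A n x) (B n x) \<le> e * l2norm x)"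
  shows "asym_const lam A"
proof -
  obtain B where B: "asym_const lam B" "\<And>n x. x \<in> Kn lam n \<Longrightarrow> l2dist (A n x) (B n x) \<le> l2norm x"
    using approx[of 1] by auto
  obtain C where C: "C > 0" "\<And>n x. x \<in> Kn lam n \<Longrightarrow> l2norm (B n x) \<le> C * l2norm x"
    using asym_constD(2)[OF B(1)] by blast
  have "l2norm (A n x) \<le> (C + 1) * l2norm x" if x: "x \<in> Kn lam n" for n x
    using l2norm_le_l2dist[OF bop_Kn_l2[OF bA x] bop_Kn_l2[OF asym_constD(1)[OF B(1)] x]] B(2)[OF x] C(2)[OF x]
    by (simp add: algebra_simps)
  moreover have "0 < C + 1" using C by simp
  moreover have "\<exists>N. \<forall>m\<ge>N. \<forall>n\<ge>m. \<forall>x\<in>Kn lam m. l2dist (A n x) (A m x) \<le> e * l2norm x" if e: "0 < e" for e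
  proof -
    obtain B where B: "asym_const lam B" "\<And>n x. x \<in> Kn lam n \<Longrightarrow> l2dist (A n x) (B n x) \<le> e / 3 * l2norm x"
      using approx[of "e/3"] e by auto
    obtain N where N: "\<And>m n x. m \<ge> N \<Longrightarrow> n \<ge> m \<Longrightarrow> x \<in> Kn lam m \<Longrightarrow> l2dist (B n x) (B m x) \<le> e / 3 * l2norm x"
      proof -
        have "0 < e/3" using e by simp
        from asym_constD(3)[OF B(1) this] show ?thesis using that by blast
      qed
    have "l2dist (A n x) (A m x) \<le> e * l2norm x" if m: "N \<le> m" "m \<le> n" and x: "x \<in> Kn lam m" for m n x
    proof -
      have xn: "x \<in> Kn lam n" by (rule Kmono[OF m(2) x])
      have l: "A n x \<in> l2" "A m x \<in> l2" "B n x \<in> l2" "B m x \<in> l2"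
        using bop_Kn_l2[OF bA] bop_Kn_l2[OF asym_constD(1)[OF B(1)]] x xn by blast+
      show ?thesis
        using l2dist_triangle[OF l(1,3,2)] l2dist_triangle[OF l(3,4,2)] B(2)[OF xn] B(2)[OF x] N[OF m x]
        by (simp add: l2dist_commute[of "B m x"])
    qed
    then show ?thesis by blast
  qed
  ultimately show ?thesis using bA unfolding asym_const_def by blast
qed

section \<open>Generators of the algebra\<close>

lemma Pn_bound:
  assumes "y \<in> l2" "l2norm y \<le> C * l2norm x"
  shows "l2norm (Pn lam n y) \<le> (2 * C) * l2norm x"
  using Pn_le[OF ib assms(1), of n] assms(2) by simp

lemma bop_Pn_toep:
  assumes "csym a"
  shows "bop (Kn lam n) (\<lambda>x. Pn lam n (toep a x))"
proof -
  obtain M where M: "0 < M" "\<And>x. x \<in> l2 \<Longrightarrow> l2norm (toep a x) \<le> M * l2norm x"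
    using toep_bounded[OF assms] by blast
  show ?thesis
  proof (rule bopI[OF _ _ Pn_bound])
    show "Pn lam n (toep a x) \<in> Kn lam n" if "x \<in> Kn lam n" for x
      by (intro Pn_Kn[OF ib] toep_l2[OF assms] Kl2[OF that])
    show "Pn lam n (toep a (\<lambda>i. c * x i + y i)) = (\<lambda>i. c * Pn lam n (toep a x) i + Pn lam n (toep a y) i)"
      if "x \<in> Kn lam n" "y \<in> Kn lam n" for x y c
      unfolding toep_lin[OF assms Kl2[OF that(1)] Kl2[OF that(2)]]
      by (rule Pn_lin[OF ib toep_l2[OF assms Kl2[OF that(1)]] toep_l2[OF assms Kl2[OF that(2)]]])
    show "toep a x \<in> l2" if "x \<in> Kn lam n" for x by (intro toep_l2[OF assms] Kl2[OF that])
    show "l2norm (toep a x) \<le> M * l2norm x" if "x \<in> Kn lam n" for x by (rule M(2)[OF Kl2[OF that]])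
  qed
qed

lemma asym_const_toepI:
  assumes "csym a"
    and "\<And>e. 0 < e \<Longrightarrow> \<exists>N. \<forall>m\<ge>N. \<forall>n\<ge>m. \<forall>x\<in>Kn lam m.
      l2dist (Pn lam n (toep a x)) (Pn lam m (toep a x)) \<le> e * l2norm x"
  shows "asym_const lam (\<lambda>n x. Pn lam n (toep a x))"
proof -
  obtain M where M: "0 < M" "\<And>x. x \<in> l2 \<Longrightarrow> l2norm (toep a x) \<le> M * l2norm x"
    using toep_bounded[OF assms(1)] by blast
  have "l2norm (Pn lam n (toep a x)) \<le> (2 * M) * l2norm x" if "x \<in> Kn lam n" for n x
    using M(2)[OF Kl2[OF that]] by (intro Pn_bound toep_l2[OF assms(1)] Kl2[OF that])
  moreover have "0 < 2 * M" using M(1) by simp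
  ultimately show ?thesis using bop_Pn_toep[OF assms(1)] assms(2) unfolding asym_const_def by blast
qed

lemma toep_powi_Suc: "toep (\<lambda>z. z powi int (Suc k)) x = sh (toep (\<lambda>z. z powi int k) x)"
proof
  fix i show "toep (\<lambda>z. z powi int (Suc k)) x i = sh (toep (\<lambda>z. z powi int k) x) i"
    unfolding sh_apply toep_powi
    by (cases i) (auto simp: nat_diff_distrib' of_nat_diff intro!: arg_cong[of _ _ x])
qed

text \<open>By \<open>Pn_sh_Pn\<close> each compressed power is the compressed z times the previous
  compressed power, so the product lemma carries the induction. For k = 0 all operators are
  restrictions of the identity.\<close>

lemma asym_const_powi_nat: "asym_const lam (\<lambda>n x. Pn lam n (toep (\<lambda>z. z powi int k) x))"
proof (induction k)
  case 0
  have "toep (\<lambda>z. z powi int 0) x = x" for x using toep_powi[of 0 x] by auto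
  then show ?case
  proof (intro asym_const_toepI[OF csym_powi])
    fix e :: real assume "0 < e"
    then have "l2dist (Pn lam n (toep (\<lambda>z. z powi int 0) x)) (Pn lam m (toep (\<lambda>z. z powi int 0) x)) \<le> e * l2norm x"
      if "m \<le> n" "x \<in> Kn lam m" for m n x
      using Pn_fix[OF ib that(2)] Pn_fix[OF ib Kmono[OF that]] Knorm[OF that(2)]
        \<open>\<And>x. toep (\<lambda>z. z powi int 0) x = x\<close> by (simp add: l2dist_def)
    then show "\<exists>N. \<forall>m\<ge>N. \<forall>n\<ge>m. \<forall>x\<in>Kn lam m. l2dist (Pn lam n (toep (\<lambda>z. z powi int 0) x))
        (Pn lam m (toep (\<lambda>z. z powi int 0) x)) \<le> e * l2norm x" by blast
  qed
next
  case (Suc k)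
  have "toep (\<lambda>z. z powi int 0) x = x" for x using toep_powi[of 0 x] by auto
  then have 1: "toep (\<lambda>z. z powi int 1) x = sh x" for x using toep_powi_Suc[of 0 x] by simp
  have "asym_const lam (\<lambda>n x. Pn lam n (toep (\<lambda>z. z powi int 1) x))"
    by (rule asym_const_toepI[OF csym_powi]) (use sh_estimate[OF ib] in \<open>simp only: 1 l2dist_def\<close>)
  from asym_const_mult[OF this Suc.IH] show ?case
  proof (rule asym_const_cong)
    fix n x assume "x \<in> Kn lam n"
    then have "toep (\<lambda>z. z powi int k) x \<in> l2" by (intro toep_l2 csym_powi Kl2)
    then show "Pn lam n (toep (\<lambda>z. z powi int (Suc k)) x)
        = Pn lam n (toep (\<lambda>z. z powi int 1) (Pn lam n (toep (\<lambda>z. z powi int k) x)))"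
      unfolding 1 toep_powi_Suc by (simp only: Pn_sh_Pn[OF ib])
  qed
qed

text \<open>The spaces are invariant under the backward shift, so negative powers contribute nothing.\<close>

lemma asym_const_powi_neg:
  assumes "k \<le> 0"
  shows "asym_const lam (\<lambda>n x. Pn lam n (toep (\<lambda>z. z powi k) x))"
proof (rule asym_const_toepI[OF csym_powi])
  fix e :: real assume "0 < e"
  have "l2dist (Pn lam n (toep (\<lambda>z. z powi k) x)) (Pn lam m (toep (\<lambda>z. z powi k) x)) \<le> e * l2norm x"
    if "m \<le> n" and x: "x \<in> Kn lam m" for m n x
  proof -
    have t: "toep (\<lambda>z. z powi k) x = (\<lambda>i. x (i + nat (- k)))"
      using assms by (auto simp: toep_powi fun_eq_iff nat_diff_distrib' intro!: arg_cong[of _ _ x])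
    have "convadj (ucoef lam m) (toep (\<lambda>z. z powi k) x) = (\<lambda>i. convadj (ucoef lam m) x (i + nat (- k)))"
      unfolding t convadj_def by (simp add: add_ac)
    then have "toep (\<lambda>z. z powi k) x \<in> Kn lam m"
      using x toep_l2[OF csym_powi Kl2[OF x], of k] unfolding Kn_iff[OF ib] by simp
    then have "Pn lam n (toep (\<lambda>z. z powi k) x) = Pn lam m (toep (\<lambda>z. z powi k) x)"
      using Pn_fix[OF ib] Kmono[OF \<open>m \<le> n\<close>] by metis
    then show ?thesis using \<open>0 < e\<close> Knorm[OF x] by (simp add: l2dist_def)
  qed
  then show "\<exists>N. \<forall>m\<ge>N. \<forall>n\<ge>m. \<forall>x\<in>Kn lam m.
      l2dist (Pn lam n (toep (\<lambda>z. z powi k) x)) (Pn lam m (toep (\<lambda>z. z powi k) x)) \<le> e * l2norm x" by blast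
qed

lemma asym_const_trigp: "trigp g \<Longrightarrow> asym_const lam (\<lambda>n x. Pn lam n (toep g x))"
proof (induction rule: trigp.induct)
  case (powi k)
  show ?case
  proof (cases "k \<le> 0")
    case False
    then show ?thesis using asym_const_powi_nat[of "nat k"] by simp
  qed (rule asym_const_powi_neg)
next
  case (lin f g c)
  from asym_const_lin[OF lin.IH, of c] show ?case
  proof (rule asym_const_cong)
    fix n x assume "x \<in> Kn lam n"
    then show "Pn lam n (toep (\<lambda>z. c * f z + g z) x)
        = (\<lambda>i. c * Pn lam n (toep f x) i + Pn lam n (toep g x) i)"
      using lin.hyps trigp_csym Kl2 by (simp add: toep_sym_lin Pn_lin[OF ib] toep_l2)
  qed
qed

lemma asym_const_toep:
  assumes a: "csym a"
  shows "asym_const lam (\<lambda>n x. Pn lam n (toep a x))"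
proof (rule asym_const_limit)
  show "bop (Kn lam n) (\<lambda>x. Pn lam n (toep a x))" for n by (rule bop_Pn_toep[OF a])
  fix e :: real assume e: "0 < e"
  \<comment> \<open>Half of \<open>e\<close>, since \<open>Pn_bound\<close> doubles the bound for
    the symbol a - g.\<close>
  then obtain g where g: "trigp g" "\<And>z. z \<in> sphere 0 1 \<Longrightarrow> cmod (a z - g z) < e / 2"
    using trigp_approx[OF a, of "e/2"] by auto
  have cg: "csym g" by (rule trigp_csym[OF g(1)])
  let ?h = "\<lambda>z. (-1) * g z + a z"
  have ch: "csym ?h" by (rule csym_lin[OF cg a])
  have hb: "cmod (?h z) \<le> e / 2" if "z \<in> sphere 0 1" for z using g(2)[OF that] by simp
  have "l2dist (Pn lam n (toep a x)) (Pn lam n (toep g x)) \<le> e * l2norm x" if x: "x \<in> Kn lam n" for n x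
  proof -
    have l: "toep a x \<in> l2" "toep g x \<in> l2" using toep_l2 a cg Kl2[OF x] by auto
    have "(\<lambda>i. toep a x i - toep g x i) = toep ?h x"
      unfolding toep_sym_lin[OF cg a Kl2[OF x]] by simp
    then have "l2dist (Pn lam n (toep a x)) (Pn lam n (toep g x)) = l2norm (Pn lam n (toep ?h x))"
      unfolding l2dist_def Pn_diff[OF ib l, symmetric] by simp
    also have "\<dots> \<le> (2 * (e / 2)) * l2norm x"
      using toep_in_l2[OF ch hb _ Kl2[OF x]] toep_le[OF ch hb _ Kl2[OF x]] e by (intro Pn_bound) auto
    finally show ?thesis by simp
  qed
  then show "\<exists>B. asym_const lam B \<and> (\<forall>n. \<forall>x\<in>Kn lam n. l2dist (Pn lam n (toep a x)) (B n x) \<le> e * l2norm x)"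
    using asym_const_trigp[OF g(1)] by blast
qed

lemma asym_const_cpt:
  assumes K: "cpt_op (Ku lam) K"
  shows "asym_const lam (\<lambda>n x. Pn lam n (K x))"
proof -
  have b: "bop (Ku lam) K" using K by (simp add: cpt_op_def)
  obtain C0 where C0: "\<And>x. x \<in> Ku lam \<Longrightarrow> l2norm (K x) \<le> C0 * l2norm x" using bop_bounded[OF b] by blast
  define C where "C = \<bar>C0\<bar> + 1"
  have Kx: "K x \<in> l2" if "x \<in> Kn lam n" for x n
    by (rule Ku_l2[OF ib bopD(1)[OF b KKu[OF that]]])
  have KC: "l2norm (K x) \<le> C * l2norm x" if "x \<in> Kn lam n" for x n
  proof -
    have "C0 * l2norm x \<le> C * l2norm x" using Knorm[OF that] by (intro mult_right_mono) (auto simp: C_def)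
    then show ?thesis using C0[OF KKu[OF that]] by simp
  qed
  have PC: "l2norm (Pn lam n (K x)) \<le> (2 * C) * l2norm x" if "x \<in> Kn lam n" for x n
    by (rule Pn_bound[OF Kx[OF that] KC[OF that]])
  have "bop (Kn lam n) (\<lambda>x. Pn lam n (K x))" for n
  proof (rule bopI[OF _ _ PC])
    show "Pn lam n (K x) \<in> Kn lam n" if "x \<in> Kn lam n" for x by (rule Pn_Kn[OF ib Kx[OF that]])
    show "Pn lam n (K (\<lambda>i. c * x i + y i)) = (\<lambda>i. c * Pn lam n (K x) i + Pn lam n (K y) i)"
      if "x \<in> Kn lam n" "y \<in> Kn lam n" for x y c
      unfolding bopD(2)[OF b KKu[OF that(1)] KKu[OF that(2)]]
      by (rule Pn_lin[OF ib Kx[OF that(1)] Kx[OF that(2)]])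
  qed
  moreover have "0 < 2 * C" by (simp add: C_def)
  moreover have "\<exists>N. \<forall>m\<ge>N. \<forall>n\<ge>m. \<forall>x\<in>Kn lam m. l2dist (Pn lam n (K x)) (Pn lam m (K x)) \<le> e * l2norm x" if e: "0 < e" for e
  proof -
    obtain N where N: "\<And>m x. N \<le> m \<Longrightarrow> x \<in> Kn lam m \<Longrightarrow> l2dist (Pn lam m (K x)) (K x) \<le> e / 2 * l2norm x"
      using cpt_estimate[OF ib K, of "e/2"] e by auto
    \<comment> \<open>\<open>x\<close> lies in \<open>Kn lam m\<close> and in
      \<open>Kn lam n\<close>, so both projections are within e/2 * |x| of
      \<open>K x\<close>.\<close>
    have "l2dist (Pn lam n (K x)) (Pn lam m (K x)) \<le> e * l2norm x" if m: "N \<le> m" "m \<le> n" and x: "x \<in> Kn lam m" for m n x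
      using l2dist_triangle[OF Pn_l2[OF ib Kx[OF x]] Kx[OF x] Pn_l2[OF ib Kx[OF x]], of n m]
        N[OF m(1) x] N[OF _ Kmono[OF m(2) x]] m by (simp add: l2dist_commute[of "K x"])
    then show ?thesis by blast
  qed
  ultimately show ?thesis using PC unfolding asym_const_def by blast
qed

lemma Salg_asym_const: "A \<in> Salg lam \<Longrightarrow> asym_const lam A"
proof (induction rule: Salg.induct)
  case (gen a K)
  then have a: "csym a" by (simp add: csym_def)
  have K: "x \<in> Kn lam n \<Longrightarrow> K x \<in> l2" for x n
    using gen(2) Ku_l2[OF ib] KKu by (auto simp: cpt_op_def bop_def)
  from asym_const_add[OF asym_const_toep[OF a] asym_const_cpt[OF gen(2)]] show ?case
  proof (rule asym_const_cong)
    fix n x assume x: "x \<in> Kn lam n"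
    have t: "toep a x \<in> l2" by (rule toep_l2[OF a Kl2[OF x]])
    show "Pn lam n (\<lambda>i. ttoep (bprod lam) a (Pn lam n x) i + K (Pn lam n x) i)
        = (\<lambda>i. Pn lam n (toep a x) i + Pn lam n (K x) i)"
      unfolding Pn_fix[OF ib x] ttoep_def
      by (simp only: Pn_add[OF ib Pin_bprod_l2[OF ib t] K[OF x]] Pn_Pin_bprod[OF ib t])
  qed
next
  case (add A B)
  show ?case by (rule asym_const_add[OF add.IH])
next
  case (smult A c)
  show ?case by (rule asym_const_scale[OF smult.IH])
next
  case (mult A B)
  show ?case by (rule asym_const_mult[OF mult.IH])
next
  case (lim B A)
  have bA: "bop (Kn lam n) (A n)" for n using lim(2) by (simp add: Falg_def)
  obtain CA where CA: "\<And>n. opnorm (Kn lam n) (A n) \<le> CA" using lim(2) by (auto simp: Falg_def)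
  have AC: "l2norm (A n x) \<le> CA * l2norm x" if "x \<in> Kn lam n" for n x
    using le_opnorm[OF subsp_Kn bA that] mult_right_mono[OF CA[of n] Knorm[OF that]] by simp
  have Bk: "asym_const lam (B k)" for k by (rule lim.IH)
  show ?case
  proof (rule asym_const_limit[OF bA])
    fix e :: real assume e: "0 < e"
    then have "\<forall>\<^sub>F k in sequentially. supdist lam (B k) A < e"
      using lim(3) by (intro order_tendstoD) auto
    then obtain k where k: "supdist lam (B k) A < e" by (auto simp: eventually_sequentially)
    obtain C where C: "C > 0" "\<And>n x. x \<in> Kn lam n \<Longrightarrow> l2norm (B k n x) \<le> C * l2norm x"
      using asym_constD(2)[OF Bk] by blast
    note bB = asym_constD(1)[OF Bk[of k]]
    have E: "l2norm (\<lambda>i. B k n x i - A n x i) \<le> (C + \<bar>CA\<bar>) * l2norm x" if "x \<in> Kn lam n" for n x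
    proof -
      have "CA * l2norm x \<le> \<bar>CA\<bar> * l2norm x" using Knorm[OF that] by (intro mult_right_mono) auto
      then show ?thesis
        using l2norm_triangle_diff[OF bop_Kn_l2[OF bB that] bop_Kn_l2[OF bA that]] C(2)[OF that] AC[OF that]
        by (simp add: algebra_simps)
    qed
    let ?D = "\<lambda>n x i. B k n x i - A n x i"
    have bD: "bop (Kn lam n) (?D n)" for n
    proof (rule bopI[OF _ _ E])
      show "?D n x \<in> Kn lam n" if "x \<in> Kn lam n" for x
        by (rule subsp_diff[OF subsp_Kn bopD(1)[OF bB that] bopD(1)[OF bA that]])
      show "?D n (\<lambda>i. c * x i + y i) = (\<lambda>i. c * ?D n x i + ?D n y i)"
        if "x \<in> Kn lam n" "y \<in> Kn lam n" for x y c
        unfolding bopD(2)[OF bA that] bopD(2)[OF bB that] by (simp add: algebra_simps)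
    qed
    \<comment> \<open>A supremum of reals dominates its terms if the family is bounded. The bound
      combines asymptotic constancy of \<open>B k\<close> with the uniform bound that
      \<open>Falg\<close> grants \<open>A\<close>.\<close>
    have "opnorm (Kn lam n) (?D n) \<le> C + \<bar>CA\<bar>" for n
      using E C(1) by (intro opnorm_le[OF subsp_Kn]) auto
    then have bdd: "bdd_above (range (\<lambda>n. opnorm (Kn lam n) (?D n)))" unfolding bdd_above_def by blast
    have "l2dist (A n x) (B k n x) \<le> e * l2norm x" if x: "x \<in> Kn lam n" for n x
    proof -
      have "opnorm (Kn lam n) (?D n) \<le> supdist lam (B k) A"
        unfolding supdist_def fun_diff_def by (rule cSUP_upper[OF UNIV_I bdd])
      then have "opnorm (Kn lam n) (?D n) \<le> e" using k by simp
      then have "l2norm (?D n x) \<le> e * l2norm x"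
        using le_opnorm[OF subsp_Kn bD x] mult_right_mono[OF _ Knorm[OF x]] by fastforce
      then show ?thesis by (simp add: l2dist_def[symmetric] l2dist_commute)
    qed
    then show "\<exists>B. asym_const lam B \<and> (\<forall>n. \<forall>x\<in>Kn lam n. l2dist (A n x) (B n x) \<le> e * l2norm x)"
      using Bk by blast
  qed
qed

section \<open>The strong limit and stability\<close>

context
  fixes A :: "nat \<Rightarrow> sq \<Rightarrow> sq"
  assumes A: "asym_const lam A"
begin

lemma APn_Kn: "x \<in> l2 \<Longrightarrow> A n (Pn lam n x) \<in> Kn lam n"
  by (rule bopD(1)[OF asym_constD(1)[OF A] Pn_Kn[OF ib]])

lemma APn_l2: "x \<in> l2 \<Longrightarrow> A n (Pn lam n x) \<in> l2"
  by (rule Kl2[OF APn_Kn])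

text \<open>A_n P_n x - A_m P_m x splits into A_n (P_n x - P_m x), small by strong convergence of
  the projections, and (A_n - A_m) P_m x, small by asymptotic constancy. Completeness supplies the
  limit, and closedness keeps it in \<open>Ku lam\<close>.\<close>

lemma strong_limit_exists:
  assumes x: "x \<in> Ku lam"
  shows "\<exists>y\<in>Ku lam. (\<lambda>n. l2dist (A n (Pn lam n x)) y) \<longlonglongrightarrow> 0"
proof -
  have xl: "x \<in> l2" by (rule Ku_l2[OF ib x])
  obtain C where C: "C > 0" "\<And>n x. x \<in> Kn lam n \<Longrightarrow> l2norm (A n x) \<le> C * l2norm x"
    using asym_constD(2)[OF A] by blast
  note bA = asym_constD(1)[OF A]
  let ?P = "\<lambda>n. Pn lam n x"
  obtain y where y: "y \<in> l2" "(\<lambda>n. l2dist (A n (?P n)) y) \<longlonglongrightarrow> 0"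
  proof (rule l2_complete[of "\<lambda>n. A n (?P n)"])
    show "A n (?P n) \<in> l2" for n by (rule APn_l2[OF xl])
    fix e :: real assume e: "0 < e"
    \<comment> \<open>A bound for the norms of all \<open>Pn lam n x\<close>, raised by 1 to permit
      division.\<close>
    define q where "q = 2 * l2norm x + 1"
    define d where "d = e / (2 * q)"
    have nx: "0 < q" using l2norm_nonneg[OF xl] by (simp add: q_def)
    have d: "0 < d" using e nx by (simp add: d_def)
    obtain N1 where N1: "\<And>m n x. m \<ge> N1 \<Longrightarrow> n \<ge> m \<Longrightarrow> x \<in> Kn lam m \<Longrightarrow> l2dist (A n x) (A m x) \<le> d * l2norm x"
      using asym_constD(3)[OF A d] by blast
    have "\<forall>\<^sub>F n in sequentially. l2dist (?P n) x < e / (4 * C)"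
      using Pn_tendsto[OF ib x] e C(1) by (intro order_tendstoD) auto
    then obtain N2 where N2: "\<And>n. n \<ge> N2 \<Longrightarrow> l2dist (?P n) x < e / (4 * C)"
      by (auto simp: eventually_sequentially)
    have "l2dist (A n (?P n)) (A m (?P m)) \<le> e" if m: "max N1 N2 \<le> m" "m \<le> n" for m n
    proof -
      have K: "?P n \<in> Kn lam n" "?P m \<in> Kn lam m" "?P m \<in> Kn lam n"
        using Pn_Kn[OF ib xl] Kmono[OF m(2)] by blast+
      have pl: "?P n \<in> l2" "?P m \<in> l2" by (rule Pn_l2[OF ib xl])+
      have l: "A n (?P n) \<in> l2" "A n (?P m) \<in> l2" "A m (?P m) \<in> l2" using K bop_Kn_l2[OF bA] by blast+
      have "l2dist (A n (?P n)) (A n (?P m)) = l2norm (A n (\<lambda>i. ?P n i - ?P m i))"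
        unfolding l2dist_def bop_diff[OF bA K(1,3)] ..
      also have "\<dots> \<le> C * l2dist (?P n) (?P m)"
        unfolding l2dist_def by (rule C(2)[OF subsp_diff[OF subsp_Kn K(1,3)]])
      also have "\<dots> \<le> C * (e / (2 * C))"
        using l2dist_triangle[OF pl(1) xl pl(2)] N2[of n] N2[of m] m C(1)
        by (intro mult_left_mono) (auto simp: l2dist_commute[of x])
      finally have 1: "l2dist (A n (?P n)) (A n (?P m)) \<le> e / 2" using C(1) by simp
      have "l2dist (A n (?P m)) (A m (?P m)) \<le> d * l2norm (?P m)" using N1[of m n "?P m"] m K by auto
      also have "\<dots> \<le> d * q" using Pn_le[OF ib xl, of m] d by (intro mult_left_mono) (auto simp: q_def)
      also have "\<dots> = e / 2" using nx by (simp add: d_def)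
      finally show ?thesis using l2dist_triangle[OF l] 1 by simp
    qed
    then show "\<exists>N. \<forall>m\<ge>N. \<forall>n\<ge>m. l2dist (A n (?P n)) (A m (?P m)) \<le> e" by blast
  qed blast
  have "y \<in> Ku lam"
    by (rule Ku_closed[OF ib _ y]) (rule KKu[OF APn_Kn[OF xl]])
  then show ?thesis using y by blast
qed

lemma Wlim_eq:
  assumes x: "x \<in> Ku lam"
  shows "Wlim lam A x \<in> Ku lam" and "(\<lambda>n. l2dist (A n (Pn lam n x)) (Wlim lam A x)) \<longlonglongrightarrow> 0"
proof -
  obtain y where y: "y \<in> Ku lam" "(\<lambda>n. l2dist (A n (Pn lam n x)) y) \<longlonglongrightarrow> 0"
    using strong_limit_exists[OF x] by blast
  have "Wlim lam A x = y"
    unfolding Wlim_def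
  proof (rule the_equality)
    show "y \<in> l2 \<and> (\<lambda>n. l2dist (A n (Pn lam n x)) y) \<longlonglongrightarrow> 0" using y Ku_l2[OF ib] by blast
    show "z = y" if "z \<in> l2 \<and> (\<lambda>n. l2dist (A n (Pn lam n x)) z) \<longlonglongrightarrow> 0" for z
      using l2_limit_unique[OF APn_l2[OF Ku_l2[OF ib x]] _ Ku_l2[OF ib y(1)] _ y(2)] that by blast
  qed
  then show "Wlim lam A x \<in> Ku lam" "(\<lambda>n. l2dist (A n (Pn lam n x)) (Wlim lam A x)) \<longlonglongrightarrow> 0"
    using y by auto
qed

lemma Wlim_l2: "x \<in> Ku lam \<Longrightarrow> Wlim lam A x \<in> l2"
  by (rule Ku_l2[OF ib Wlim_eq(1)])

lemma bop_Wlim: "bop (Ku lam) (Wlim lam A)"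
proof -
  obtain C where C: "C > 0" "\<And>n x. x \<in> Kn lam n \<Longrightarrow> l2norm (A n x) \<le> C * l2norm x"
    using asym_constD(2)[OF A] by blast
  note bA = asym_constD(1)[OF A]
  show ?thesis
  proof (rule bopI[OF Wlim_eq(1)])
    fix x y :: sq and c assume x: "x \<in> Ku lam" and y: "y \<in> Ku lam"
    note xl = Ku_l2[OF ib x] and yl = Ku_l2[OF ib y] and z = Ku_lin[OF ib x y, of c]
    let ?z = "\<lambda>i. c * x i + y i" and ?w = "\<lambda>i. c * Wlim lam A x i + Wlim lam A y i"
    let ?X = "\<lambda>n. A n (Pn lam n x)" and ?Y = "\<lambda>n. A n (Pn lam n y)"
    have Z: "A n (Pn lam n ?z) = (\<lambda>i. c * ?X n i + ?Y n i)" for n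
      unfolding Pn_lin[OF ib xl yl] by (rule bopD(2)[OF bA Pn_Kn[OF ib xl] Pn_Kn[OF ib yl]])
    have "(\<lambda>n. l2dist (A n (Pn lam n ?z)) ?w) \<longlonglongrightarrow> 0"
    proof (rule Lim_null_comparison)
      show "(\<lambda>n. cmod c * l2dist (?X n) (Wlim lam A x) + l2dist (?Y n) (Wlim lam A y)) \<longlonglongrightarrow> 0"
        using tendsto_add[OF tendsto_mult_left[OF Wlim_eq(2)[OF x], of "cmod c"] Wlim_eq(2)[OF y]] by simp
      have "norm (l2dist (A n (Pn lam n ?z)) ?w)
          \<le> cmod c * l2dist (?X n) (Wlim lam A x) + l2dist (?Y n) (Wlim lam A y)" for n
      proof -
        have l: "?X n \<in> l2" "?Y n \<in> l2" "Wlim lam A x \<in> l2" "Wlim lam A y \<in> l2"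
          using APn_l2 xl yl Wlim_l2 x y by blast+
        have "l2dist (A n (Pn lam n ?z)) ?w
            = l2norm (\<lambda>i. c * (?X n i - Wlim lam A x i) + (?Y n i - Wlim lam A y i))"
          unfolding Z l2dist_def by (simp add: algebra_simps)
        also have "\<dots> \<le> l2norm (\<lambda>i. c * (?X n i - Wlim lam A x i)) + l2dist (?Y n) (Wlim lam A y)"
          unfolding l2dist_def using l by (intro l2norm_triangle) auto
        also have "l2norm (\<lambda>i. c * (?X n i - Wlim lam A x i)) = cmod c * l2dist (?X n) (Wlim lam A x)"
          unfolding l2dist_def using l by (intro l2norm_scale) auto
        finally show ?thesis
          using l2dist_nonneg[of "A n (Pn lam n ?z)" ?w] l Z[of n] by auto
      qed
      then show "\<forall>\<^sub>F n in sequentially. norm (l2dist (A n (Pn lam n ?z)) ?w)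
          \<le> cmod c * l2dist (?X n) (Wlim lam A x) + l2dist (?Y n) (Wlim lam A y)" by simp
    qed
    moreover have "?w \<in> l2" by (intro l2_add l2_scale Wlim_l2 x y)
    ultimately show "Wlim lam A ?z = ?w"
      using l2_limit_unique[OF APn_l2[OF Ku_l2[OF ib z]] Wlim_l2[OF z] _ Wlim_eq(2)[OF z]] by blast
  next
    fix x assume x: "x \<in> Ku lam"
    note xl = Ku_l2[OF ib x]
    have "l2norm (A n (Pn lam n x)) \<le> (2 * C) * l2norm x" for n
    proof -
      have "l2norm (A n (Pn lam n x)) \<le> C * l2norm (Pn lam n x)" by (rule C(2)[OF Pn_Kn[OF ib xl]])
      also have "\<dots> \<le> C * (2 * l2norm x)" using C(1) Pn_le[OF ib xl] by (intro mult_left_mono) auto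
      finally show ?thesis by simp
    qed
    then show "l2norm (Wlim lam A x) \<le> (2 * C) * l2norm x"
      by (intro LIMSEQ_le_const2[OF tendsto_l2norm[OF APn_l2[OF xl] Wlim_l2[OF x] Wlim_eq(2)[OF x]]]) auto
  qed
qed

text \<open>For x in \<open>Kn lam m\<close> the projections with n >= m fix x, so letting n tend to
  infinity in the comparison of \<open>A n x\<close> with \<open>A m x\<close> replaces
  \<open>A n x\<close> by the limit.\<close>

lemma Wlim_estimate:
  assumes "0 < e"
  shows "\<exists>N. \<forall>m\<ge>N. \<forall>x\<in>Kn lam m. l2dist (Wlim lam A x) (A m x) \<le> e * l2norm x"
proof -
  obtain N where N: "\<And>m n x. m \<ge> N \<Longrightarrow> n \<ge> m \<Longrightarrow> x \<in> Kn lam m \<Longrightarrow> l2dist (A n x) (A m x) \<le> e * l2norm x"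
    using asym_constD(3)[OF A assms] by blast
  have "l2dist (Wlim lam A x) (A m x) \<le> e * l2norm x" if m: "N \<le> m" and x: "x \<in> Kn lam m" for m x
  proof -
    note xu = KKu[OF x]
    have Ax: "A m x \<in> l2" using asym_const_l2[OF A _ x] by simp
    have "(\<lambda>n. l2norm (\<lambda>i. A n (Pn lam n x) i - A m x i)) \<longlonglongrightarrow> l2norm (\<lambda>i. Wlim lam A x i - A m x i)"
      using APn_l2[OF Kl2[OF x]] Wlim_l2[OF xu] Ax Wlim_eq(2)[OF xu]
      by (intro tendsto_l2norm) (auto simp: l2dist_def)
    moreover have "l2norm (\<lambda>i. A n (Pn lam n x) i - A m x i) \<le> e * l2norm x" if "m \<le> n" for n
      using N[OF m that x] Pn_fix[OF ib Kmono[OF that x]] by (simp add: l2dist_def)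
    ultimately show ?thesis unfolding l2dist_def by (intro LIMSEQ_le_const2) auto
  qed
  then show ?thesis by blast
qed

lemma invertible_imp_stable:
  assumes "invertible_on (Ku lam) (Wlim lam A)"
  shows "stable lam A"
proof -
  obtain B where B: "bop (Ku lam) B" "\<And>x. x \<in> Ku lam \<Longrightarrow> B (Wlim lam A x) = x"
    using assms by (auto simp: invertible_on_def)
  obtain c0 where c0: "\<And>x. x \<in> Ku lam \<Longrightarrow> l2norm (B x) \<le> c0 * l2norm x" using bop_bounded[OF B(1)] by blast
  define c where "c = \<bar>c0\<bar> + 1"
  have c: "0 < c" by (simp add: c_def)
  have below: "l2norm x \<le> c * l2norm (Wlim lam A x)" if "x \<in> Ku lam" for x
  proof -
    have "l2norm x \<le> c0 * l2norm (Wlim lam A x)" using c0[OF Wlim_eq(1)[OF that]] B(2)[OF that] by simp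
    also have "\<dots> \<le> c * l2norm (Wlim lam A x)"
      using l2norm_nonneg[OF Wlim_l2[OF that]] by (intro mult_right_mono) (auto simp: c_def)
    finally show ?thesis .
  qed
  \<comment> \<open>With this error, |x| <= c |W x| <= c |A_m x| + |x| / 2, so \<open>A m\<close> is
    bounded below with constant 2 * c.\<close>
  obtain N where N: "\<And>m x. N \<le> m \<Longrightarrow> x \<in> Kn lam m \<Longrightarrow> l2dist (Wlim lam A x) (A m x) \<le> 1 / (2 * c) * l2norm x"
    using Wlim_estimate[of "1 / (2 * c)"] c by auto
  have "\<exists>B. bop (Kn lam n) B \<and> (\<forall>x\<in>Kn lam n. B (A n x) = x \<and> A n (B x) = x) \<and> opnorm (Kn lam n) B \<le> 2 * c"
    if n: "N \<le> n" for n
  proof -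
    note bA = asym_constD(1)[OF A, of n]
    have Ab: "l2norm x \<le> (2 * c) * l2norm (A n x)" if x: "x \<in> Kn lam n" for x
    proof -
      have "l2norm x \<le> c * l2norm (Wlim lam A x)" by (rule below[OF KKu[OF x]])
      also have "\<dots> \<le> c * (l2norm (A n x) + 1 / (2 * c) * l2norm x)"
        using l2norm_le_l2dist[OF Wlim_l2[OF KKu[OF x]] bop_Kn_l2[OF bA x]] N[OF n x] c
        by (intro mult_left_mono) auto
      also have "\<dots> = c * l2norm (A n x) + l2norm x / 2" using c by (simp add: field_simps)
      finally show ?thesis by simp
    qed
    obtain T where T: "finite T" "Kn lam n \<subseteq> sqv.span T" using Kn_span[OF ib] by blast
    have inj: "x = (\<lambda>i. 0)" if "x \<in> Kn lam n" "A n x = (\<lambda>i. 0)" for x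
      using Ab[OF that(1)] that(2) Knorm[OF that(1)] l2norm_eq_0_iff[OF Kl2[OF that(1)]] by simp
    have surj: "\<exists>x\<in>Kn lam n. A n x = y" if "y \<in> Kn lam n" for y
      by (rule finite_dim_surj[OF subsp_Kn bA T inj that])
    obtain B where B: "bop (Kn lam n) B" "\<And>x. x \<in> Kn lam n \<Longrightarrow> B (A n x) = x"
        "\<And>x. x \<in> Kn lam n \<Longrightarrow> A n (B x) = x" "\<And>x. x \<in> Kn lam n \<Longrightarrow> l2norm (B x) \<le> (2 * c) * l2norm x"
      using bounded_below_inverse[OF subsp_Kn bA Ab surj] by blast
    have "opnorm (Kn lam n) B \<le> 2 * c" using c B(4) by (intro opnorm_le[OF subsp_Kn]) auto
    then show ?thesis using B(1-3) by blast
  qed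
  then show ?thesis unfolding stable_def by blast
qed

lemma stable_imp_invertible:
  assumes "stable lam A"
  shows "invertible_on (Ku lam) (Wlim lam A)"
proof -
  obtain n0 C0 where st: "\<And>n. n \<ge> n0 \<Longrightarrow> \<exists>B. bop (Kn lam n) B \<and>
       (\<forall>x\<in>Kn lam n. B (A n x) = x \<and> A n (B x) = x) \<and> opnorm (Kn lam n) B \<le> C0"
    using assms unfolding stable_def by blast
  define C where "C = \<bar>C0\<bar> + 1"
  have C: "0 < C" by (simp add: C_def)
  note bA = asym_constD(1)[OF A]
  have inv: "\<exists>B. (\<forall>x\<in>Kn lam n. B x \<in> Kn lam n \<and> B (A n x) = x \<and> A n (B x) = x \<and> l2norm (B x) \<le> C * l2norm x)"
    if n: "n \<ge> n0" for n
  proof -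
    obtain B where B: "bop (Kn lam n) B" "\<And>x. x \<in> Kn lam n \<Longrightarrow> B (A n x) = x \<and> A n (B x) = x"
        "opnorm (Kn lam n) B \<le> C0"
      using st[OF n] by blast
    have "l2norm (B x) \<le> C * l2norm x" if "x \<in> Kn lam n" for x
    proof -
      have "l2norm (B x) \<le> opnorm (Kn lam n) B * l2norm x" by (rule le_opnorm[OF subsp_Kn B(1) that])
      also have "\<dots> \<le> C * l2norm x" using B(3) Knorm[OF that] by (intro mult_right_mono) (auto simp: C_def)
      finally show ?thesis .
    qed
    then show ?thesis using B bopD(1)[OF B(1)] by blast
  qed
  then obtain B where B: "\<And>n x. n \<ge> n0 \<Longrightarrow> x \<in> Kn lam n \<Longrightarrow>
      B n x \<in> Kn lam n \<and> B n (A n x) = x \<and> A n (B n x) = x \<and> l2norm (B n x) \<le> C * l2norm x"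
    by metis
  \<comment> \<open>The bound |P_n x| <= C |A_n P_n x| holds for n >= n0 and passes to the
    limit.\<close>
  have below: "l2norm x \<le> C * l2norm (Wlim lam A x)" if x: "x \<in> Ku lam" for x
  proof (rule LIMSEQ_le)
    note xl = Ku_l2[OF ib x]
    show "(\<lambda>n. l2norm (Pn lam n x)) \<longlonglongrightarrow> l2norm x"
      by (rule tendsto_l2norm[OF Pn_l2[OF ib xl] xl Pn_tendsto[OF ib x]])
    show "(\<lambda>n. C * l2norm (A n (Pn lam n x))) \<longlonglongrightarrow> C * l2norm (Wlim lam A x)"
      by (intro tendsto_mult_left tendsto_l2norm[OF APn_l2[OF xl] Wlim_l2[OF x] Wlim_eq(2)[OF x]])
    show "\<exists>N. \<forall>n\<ge>N. l2norm (Pn lam n x) \<le> C * l2norm (A n (Pn lam n x))"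
      using B[OF _ APn_Kn[OF xl]] B[OF _ Pn_Kn[OF ib xl]] by metis
  qed
  have surj: "\<exists>x\<in>Ku lam. Wlim lam A x = y" if y: "y \<in> Ku lam" for y
  proof -
    note yl = Ku_l2[OF ib y]
    \<comment> \<open>Exact solutions of the projected equations, indexed from \<open>n0\<close> on,
      where the inverses exist. Stability bounds them.\<close>
    define X where "X n = B (n + n0) (Pn lam (n + n0) y)" for n
    have XK: "X n \<in> Kn lam (n + n0)" and AX: "A (n + n0) (X n) = Pn lam (n + n0) y"
      and Xb: "l2norm (X n) \<le> 2 * C * l2norm y" for n
    proof -
      have K: "Pn lam (n + n0) y \<in> Kn lam (n + n0)" by (rule Pn_Kn[OF ib yl])
      show "X n \<in> Kn lam (n + n0)" "A (n + n0) (X n) = Pn lam (n + n0) y"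
        using B[OF _ K] by (auto simp: X_def)
      have "l2norm (X n) \<le> C * l2norm (Pn lam (n + n0) y)" using B[OF _ K] by (auto simp: X_def)
      also have "\<dots> \<le> C * (2 * l2norm y)" using C Pn_le[OF ib yl] by (intro mult_left_mono) auto
      finally show "l2norm (X n) \<le> 2 * C * l2norm y" by simp
    qed
    have Xu: "X n \<in> Ku lam" for n by (rule KKu[OF XK])
    have Xl: "X n \<in> l2" for n by (rule Kl2[OF XK])
    \<comment> \<open>W X_n - y is the sum of (W - A) X_n, small because the X_n are bounded, and P
      y - y, where \<open>A\<close> and \<open>P\<close> have index n + n0.\<close>
    have WX: "(\<lambda>n. l2dist (Wlim lam A (X n)) y) \<longlonglongrightarrow> 0"
    proof (rule LIMSEQ_I)
      fix e :: real assume e: "0 < e"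
      define q where "q = 2 * C * l2norm y + 1"
      define d where "d = e / (2 * q)"
      have ny: "0 < q" using C l2norm_nonneg[OF yl] by (simp add: q_def add_nonneg_pos)
      have d: "0 < d" using e ny by (simp add: d_def)
      obtain N1 where N1: "\<And>m x. N1 \<le> m \<Longrightarrow> x \<in> Kn lam m \<Longrightarrow> l2dist (Wlim lam A x) (A m x) \<le> d * l2norm x"
        using Wlim_estimate[OF d] by blast
      have "\<forall>\<^sub>F n in sequentially. l2dist (Pn lam n y) y < e / 2"
        using Pn_tendsto[OF ib y] e by (intro order_tendstoD) auto
      then obtain N2 where N2: "\<And>n. n \<ge> N2 \<Longrightarrow> l2dist (Pn lam n y) y < e / 2"
        by (auto simp: eventually_sequentially)
      have "norm (l2dist (Wlim lam A (X n)) y - 0) < e" if n: "max N1 N2 \<le> n" for n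
      proof -
        have "l2dist (Wlim lam A (X n)) (Pn lam (n + n0) y) \<le> d * l2norm (X n)"
          using N1[OF _ XK[of n]] n AX[of n] by simp
        also have "\<dots> \<le> d * q" using d Xb[of n] by (intro mult_left_mono) (auto simp: q_def)
        also have "\<dots> = e / 2" using ny by (simp add: d_def)
        finally have "l2dist (Wlim lam A (X n)) y < e"
          using l2dist_triangle[OF Wlim_l2[OF Xu] Pn_l2[OF ib yl] yl, of n "n + n0"] N2[of "n + n0"] n by simp
        then show ?thesis using l2dist_nonneg[OF Wlim_l2[OF Xu] yl, of n] by simp
      qed
      then show "\<exists>N. \<forall>n\<ge>N. norm (l2dist (Wlim lam A (X n)) y - 0) < e" by blast
    qed
    \<comment> \<open>As the images under W converge, the lower bound for W makes the X_n themselves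
      a Cauchy sequence.\<close>
    obtain x where x: "x \<in> l2" "(\<lambda>n. l2dist (X n) x) \<longlonglongrightarrow> 0"
    proof (rule l2_complete[OF Xl])
      fix e :: real assume e: "0 < e"
      have "\<forall>\<^sub>F n in sequentially. l2dist (Wlim lam A (X n)) y < e / (2 * C)"
        using WX e C by (intro order_tendstoD) auto
      then obtain N where N: "\<And>n. n \<ge> N \<Longrightarrow> l2dist (Wlim lam A (X n)) y < e / (2 * C)"
        by (auto simp: eventually_sequentially)
      have "l2dist (X n) (X m) \<le> e" if "N \<le> m" "m \<le> n" for m n
      proof -
        have "l2dist (X n) (X m) \<le> C * l2dist (Wlim lam A (X n)) (Wlim lam A (X m))"
          using below[OF subsp_diff[OF subsp_Ku Xu Xu], of n m] unfolding bop_diff[OF bop_Wlim Xu Xu] l2dist_def .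
        also have "\<dots> \<le> C * (e / (2 * C) + e / (2 * C))"
          using l2dist_triangle[OF Wlim_l2[OF Xu] yl Wlim_l2[OF Xu], of n m] N[of n] N[of m] that C
          by (intro mult_left_mono) (auto simp: l2dist_commute[of y])
        also have "\<dots> = e" using C by (simp add: field_simps)
        finally show ?thesis .
      qed
      then show "\<exists>N. \<forall>m\<ge>N. \<forall>n\<ge>m. l2dist (X n) (X m) \<le> e" by blast
    qed blast
    have xu: "x \<in> Ku lam" by (rule Ku_closed[OF ib Xu x])
    obtain D where D: "\<And>x. x \<in> Ku lam \<Longrightarrow> l2norm (Wlim lam A x) \<le> D * l2norm x"
      using bop_bounded[OF bop_Wlim] by blast
    have "(\<lambda>n. l2dist (Wlim lam A (X n)) (Wlim lam A x)) \<longlonglongrightarrow> 0"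
    proof (rule Lim_null_comparison)
      show "(\<lambda>n. D * l2dist (X n) x) \<longlonglongrightarrow> 0" using tendsto_mult_left[OF x(2), of D] by simp
      have "norm (l2dist (Wlim lam A (X n)) (Wlim lam A x)) \<le> D * l2dist (X n) x" for n
        using D[OF subsp_diff[OF subsp_Ku Xu xu], of n] l2dist_nonneg[OF Wlim_l2[OF Xu] Wlim_l2[OF xu], of n]
        unfolding bop_diff[OF bop_Wlim Xu xu] l2dist_def by simp
      then show "\<forall>\<^sub>F n in sequentially. norm (l2dist (Wlim lam A (X n)) (Wlim lam A x)) \<le> D * l2dist (X n) x"
        by simp
    qed
    then have "Wlim lam A x = y"
      by (rule l2_limit_unique[OF Wlim_l2[OF Xu] Wlim_l2[OF xu] yl _ WX])
    then show ?thesis using xu by blast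
  qed
  obtain V where "bop (Ku lam) V" "\<And>x. x \<in> Ku lam \<Longrightarrow> V (Wlim lam A x) = x"
      "\<And>x. x \<in> Ku lam \<Longrightarrow> Wlim lam A (V x) = x"
    using bounded_below_inverse[OF subsp_Ku bop_Wlim below surj] by blast
  then show ?thesis using bop_Wlim unfolding invertible_on_def by blast
qed

end

end

theorem theorem4p3:
  fixes lam :: "nat \<Rightarrow> complex" and A :: "nat \<Rightarrow> sq \<Rightarrow> sq"
  assumes "infinite_blaschke lam"
    and "A \<in> Salg lam"
  shows "stable lam A \<longleftrightarrow> invertible_on (Ku lam) (Wlim lam A)"
proof
  assume "stable lam A"
  then show "invertible_on (Ku lam) (Wlim lam A)"
    by (rule stable_imp_invertible[OF assms(1) Salg_asym_const[OF assms]])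
next
  assume "invertible_on (Ku lam) (Wlim lam A)"
  then show "stable lam A"
    by (rule invertible_imp_stable[OF assms(1) Salg_asym_const[OF assms]])
qed

end
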